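(* Let $z_h^0\in K_h^{rt,*}$ and $\tau,\varepsilon_{stop}^h>0$, and consider the semi-implicit discretized $L^2$-gradient flow: for $k\in\mathbb{N}$, Step (i): compute $(z_h^k,\overline\lambda_h^k)\in\mathcal{R}T^0(\mathcal{T}_h)\times\mathcal{L}^0(\mathcal{T}_h)$ with $z_h^k\cdot n=g_h$ a.e. on $\Gamma_N$ such that for every $(y_h,\overline\eta_h)\in\mathcal{R}T^0_N(\mathcal{T}_h)\times\mathcal{L}^0(\mathcal{T}_h)$ $$\Big(\Pi_h\mathrm{d}_\tau z_h^k+\tfrac{D_t\varphi_h^*(\cdot,|\Pi_hz_h^{k-1}|)}{|\Pi_hz_h^{k-1}|}\Pi_hz_h^k,\ \Pi_hy_h\Big)_\Omega+(\overline\lambda_h^k,\operatorname{div}y_h)_\Omega=(y_h\cdot n,u_D^h)_{\Gamma_D},$$ $$(\operatorname{div}z_h^k,\overline\eta_h)_\Omega=-(f_h,\overline\eta_h)_\Omega,$$ where $\mathrm{d}_\tau z_h^k:=\frac1\tau(z_h^k-z_h^{k-1})$. Step (ii): compute $r_h^k\in\mathcal{R}T^0_N(\mathcal{T}_h)$ such that for every $y_h\in\mathcal{R}T^0_N(\mathcal{T}_h)$ $$(r_h^k,y_h)_\Omega=\Big(\tfrac{D_t\varphi_h^*(\cdot,|\Pi_hz_h^k|)}{|\Pi_hz_h^k|}\Pi_hz_h^k,\ \Pi_hy_h\Big)_\Omega+(\overline\lambda_h^k,\operatorname{div}y_h)_\Omega-(y_h\cdot n,u_D^h)_{\Gamma_D}.$$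 Stop if $\|r_h^k\|_{2,\Omega}\le\varepsilon_{stop}^h$; otherwise increase $k\to k+1$ and continue with Step (i). Then the following statements apply: (i) The algorithm is well-posed, i.e. for every $k\in\mathbb{N}$, given the most recent iterate $z_h^{k-1}\in\mathcal{R}T^0(\mathcal{T}_h)$, there exists a unique iterate $z_h^k\in\mathcal{R}T^0(\mathcal{T}_h)$ solving the system in Step (i). (ii) The algorithm is unconditionally strongly stable, i.e. for every $L\in\mathbb{N}$, $$-D_h^{rt}(z_h^L)+\tau\sum_{k=1}^L\|\Pi_h\mathrm{d}_\tau z_h^k\|_{2,\Omega}^2\le-D_h^{rt}(z_h^0).$$ (iii) The algorithm terminates after a finite number of steps, i.e. there exists $k^*\in\mathbb{N}$ such that $\|r_h^{k^*}\|_{2,\Omega}\le\varepsilon_{stop}^h$.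
   Context: Let $\Omega\subseteq\mathbb{R}^d$, $d\in\mathbb{N}$, be a bounded simplicial Lipschitz domain with $\partial\Omega=\overline\Gamma_D\cup\overline\Gamma_N$, $\Gamma_D,\Gamma_N$ disjoint and relatively open, $|\Gamma_D|>0$. $\mathcal{T}_h$ is a (shape-regular, conforming) simplicial triangulation of $\Omega$; $\mathcal{S}_h$ is the set of its sides (($d-1$)-dimensional faces), $\mathcal{S}_h^{\Gamma_D},\mathcal{S}_h^{\Gamma_N}$ the boundary sides whose relative interior lies in $\Gamma_D$, resp. $\Gamma_N$; every boundary side belongs to exactly one of these two sets. $(v,w)_\omega=\int_\omega v\cdot w$; $\|\cdot\|_{p,\omega}$ is the $L^p(\omega)$-norm. $\mathcal{L}^k(\mathcal{T}_h)$ are the element-wise polynomials of degree $\le k$; $\mathcal{L}^0(\mathcal{S}_h^{\gamma})$ the side-wise constant functions on $\mathcal{S}_h^\gamma$. $\Pi_h$ is the $L^2$-projection onto element-wise constants (element averages, component-wise for vector fields), $\pi_h$ the projection onto side-wise constants. $\nabla_h$ is the element-wise gradient, $n$ the outward unit normal on $\partial\Omega$. $\mathcal{S}^{1,cr}(\mathcal{T}_h)=\{v_h\in\mathcal{L}^1(\mathcal{T}_h):$ the side average of the jump of $v_h$ vanishes on every interior side$\}$. $\mathcal{R}T^0(\mathcal{T}_h)=\{y_h\in(\mathcal{L}^1(\mathcal{T}_h))^d: y_h|_T\cdot n_T$ is constant on each side of each $T\in\mathcal{T}_h$ and the normal jump of $y_h$ vanishes on every interior side$\}$ (lowest-order Raviart–Thomas;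 on each $T$, $y_h(x)=a_T+b_Tx$ with $a_T\in\mathbb{R}^d,b_T\in\mathbb{R}$). $\mathcal{R}T^0_N(\mathcal{T}_h)=\{y_h\in\mathcal{R}T^0(\mathcal{T}_h):y_h\cdot n=0\text{ a.e. on }\Gamma_N\}$. Data: $f_h\in\mathcal{L}^0(\mathcal{T}_h)$, $g_h\in\mathcal{L}^0(\mathcal{S}_h^{\Gamma_N})$, $\zeta_h\in\mathcal{L}^0(\mathcal{T}_h)$ with $\operatorname{ess\,inf}_\Omega\zeta_h>0$, $u_D^h\in\mathcal{L}^0(\mathcal{S}_h^{\Gamma_D})$ such that there exists $\widehat u_D^h\in\mathcal{S}^{1,cr}(\mathcal{T}_h)$ with $\pi_h\widehat u_D^h=u_D^h$ on $\Gamma_D$ and $\|\nabla_h\widehat u_D^h/\zeta_h\|_{\infty,\Omega}<1$. For a.e. $x\in\Omega$ and $r\ge0$: $\varphi_h^*(x,r)=\frac12r^2$ if $r\le\zeta_h(x)$, $\varphi_h^*(x,r)=\zeta_h(x)r-\frac12\zeta_h(x)^2$ if $r>\zeta_h(x)$; $D_t\varphi_h^*$ is the derivative in the second argument, so $D_t\varphi_h^*(x,r)/r=1$ for $r\le\zeta_h(x)$ (value $1$ at $r=0$ by continuity) and $\zeta_h(x)/r$ for $r>\zeta_h(x)$. $\phi_h^*(x,s)=\varphi_h^*(x,|s|)$ for $s\in\mathbb{R}^d$. Discrete dual functional: $K_h^{rt,*}=\{y_h\in\mathcal{R}T^0(\mathcal{T}_h):\operatorname{div}y_h=-f_h\text{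 a.e. in }\Omega,\ y_h\cdot n=g_h\text{ a.e. on }\Gamma_N\}$; $D_h^{rt}(y_h)=-\int_\Omega\phi_h^*(\cdot,\Pi_hy_h)\,\mathrm{d}x+(y_h\cdot n,u_D^h)_{\Gamma_D}$ if $y_h\in K_h^{rt,*}$ and $-\infty$ for other $y_h\in\mathcal{R}T^0(\mathcal{T}_h)$. In (ii), and for the indices considered in (iii), the iterates are those generated by Step (i) for all $k$, irrespective of the stopping test. *)

theory Defs
  imports "HOL-Analysis.Analysis" "HOL-Probability.Essential_Supremum"
begin

text \<open>Locally, up to a rotation taking \<open>e\<close> to the last coordinate direction, the domain is the strict
  epigraph of a Lipschitz function \<open>\<gamma>\<close> of the component orthogonal to \<open>e\<close>.\<close>

definition lipschitz_domain :: "(real^'n) set \<Rightarrow> bool" where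
  "lipschitz_domain \<Omega> \<longleftrightarrow>
     open \<Omega> \<and> connected \<Omega> \<and> \<Omega> \<noteq> {} \<and> bounded \<Omega> \<and>
     (\<forall>x0\<in>frontier \<Omega>. \<exists>e r L. \<exists>\<gamma> :: real^'n \<Rightarrow> real.
        norm e = 1 \<and> r > 0 \<and> L-lipschitz_on UNIV \<gamma> \<and>
        \<Omega> \<inter> ball x0 r = {y \<in> ball x0 r. \<gamma> (y - (y \<bullet> e) *\<^sub>R e) < y \<bullet> e})"

text \<open>\<^const>\<open>triangulation\<close> provides finiteness and conformity (the intersection of any two elements is
  a, possibly empty, common face).\<close>

definition simplicial_mesh :: "(real^'n) set \<Rightarrow> (real^'n) set set \<Rightarrow> bool" where
  "simplicial_mesh \<Omega> \<T> \<longleftrightarrow>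
     triangulation \<T> \<and> (\<forall>T\<in>\<T>. int CARD('n) simplex T) \<and> \<Union>\<T> = closure \<Omega>"

definition inradius :: "(real^'n) set \<Rightarrow> real" where
  "inradius T = Sup {r. r > 0 \<and> (\<exists>x\<in>T. ball x r \<subseteq> T)}"

definition shape_regular :: "real \<Rightarrow> (real^'n) set set \<Rightarrow> bool" where
  "shape_regular \<kappa> \<T> \<longleftrightarrow> (\<forall>T\<in>\<T>. diameter T \<le> \<kappa> * inradius T)"

definition sides :: "(real^'n) set set \<Rightarrow> (real^'n) set set" where
  "sides \<T> = {S. \<exists>T\<in>\<T>. S facet_of T}"

definition bd_sides :: "(real^'n) set \<Rightarrow> (real^'n) set set \<Rightarrow> (real^'n) set set" where
  "bd_sides \<Omega> \<T> = {S \<in> sides \<T>. S \<subseteq> frontier \<Omega>}"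

definition int_sides :: "(real^'n) set \<Rightarrow> (real^'n) set set \<Rightarrow> (real^'n) set set" where
  "int_sides \<Omega> \<T> = sides \<T> - bd_sides \<Omega> \<T>"

definition sides_on ::
  "(real^'n) set \<Rightarrow> (real^'n) set set \<Rightarrow> (real^'n) set \<Rightarrow> (real^'n) set set" where
  "sides_on \<Omega> \<T> \<Gamma> = {S \<in> bd_sides \<Omega> \<T>. rel_interior S \<subseteq> \<Gamma>}"

text \<open>The element adjacent to a boundary side (for an interior side the value is meaningless).\<close>

definition adj :: "(real^'n) set set \<Rightarrow> (real^'n) set \<Rightarrow> (real^'n) set" where
  "adj \<T> S = (THE T. T \<in> \<T> \<and> S facet_of T)"

definition outer_normal :: "(real^'n) set \<Rightarrow> (real^'n) set \<Rightarrow> real^'n" where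
  "outer_normal T S = (THE n. norm n = 1 \<and> (\<forall>x\<in>S. \<forall>y\<in>T. n \<bullet> y \<le> n \<bullet> x))"

text \<open>The \<open>(d-1)\<close>-dimensional Lebesgue measure on a side \<open>S\<close> is realised as the image, under the
  orthogonal projection onto the hyperplane of \<open>S\<close>, of the \<open>d\<close>-dimensional Lebesgue measure on the
  right prism with mid-section \<open>S\<close> and height \<open>1\<close>. For \<open>d = 1\<close> this is the unit point mass. By symmetry
  of the prism the choice of the sign of the normal is irrelevant.\<close>

definition side_normal :: "(real^'n) set \<Rightarrow> real^'n" where
  "side_normal S = (SOME \<nu>. norm \<nu> = 1 \<and> (\<forall>x\<in>S. \<forall>y\<in>S. \<nu> \<bullet> (x - y) = 0))"

definition prism :: "(real^'n) set \<Rightarrow> (real^'n) set" where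
  "prism S = {x + t *\<^sub>R side_normal S | x t. x \<in> S \<and> \<bar>t\<bar> \<le> 1/2}"

definition side_measure :: "(real^'n) set \<Rightarrow> (real^'n) measure" where
  "side_measure S =
     completion (distr (restrict_space lborel (prism S)) borel (closest_point (affine hull S)))"

definition side_average :: "(real^'n) set \<Rightarrow> (real^'n \<Rightarrow> real) \<Rightarrow> real" where
  "side_average S w = (LINT x:S|side_measure S. w x) / measure (side_measure S) S"

definition bd_measure :: "(real^'n) set \<Rightarrow> (real^'n) set set \<Rightarrow> (real^'n) set \<Rightarrow> real" where
  "bd_measure \<Omega> \<T> \<Gamma> = (\<Sum>S\<in>bd_sides \<Omega> \<T>. measure (side_measure S) (S \<inter> \<Gamma>))"

definition boundary_partition ::
  "(real^'n) set \<Rightarrow> (real^'n) set set \<Rightarrow> (real^'n) set \<Rightarrow> (real^'n) set \<Rightarrow> bool" where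
  "boundary_partition \<Omega> \<T> \<Gamma>D \<Gamma>N \<longleftrightarrow>
     openin (top_of_set (frontier \<Omega>)) \<Gamma>D \<and> openin (top_of_set (frontier \<Omega>)) \<Gamma>N \<and>
     \<Gamma>D \<inter> \<Gamma>N = {} \<and> frontier \<Omega> = closure \<Gamma>D \<union> closure \<Gamma>N \<and>
     bd_measure \<Omega> \<T> \<Gamma>D > 0 \<and>
     (\<forall>S\<in>bd_sides \<Omega> \<T>. (S \<in> sides_on \<Omega> \<T> \<Gamma>D) \<noteq> (S \<in> sides_on \<Omega> \<T> \<Gamma>N))"

text \<open>Discrete functions are functions on the whole space of which only the values in the element
  interiors (for side-wise constants: in the relative interiors of the sides) matter. Accordingly,
  identities between them are understood almost everywhere, and values of an element-wise
  polynomial on an element boundary are always one-sided limits \<open>elt_trace T v\<close> from the interior of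
  that element.\<close>

definition L0 :: "(real^'n) set set \<Rightarrow> (real^'n \<Rightarrow> real) set" where
  "L0 \<T> = {v. \<forall>T\<in>\<T>. \<exists>c. \<forall>x\<in>interior T. v x = c}"

definition L1 :: "(real^'n) set set \<Rightarrow> (real^'n \<Rightarrow> real) set" where
  "L1 \<T> = {v. \<forall>T\<in>\<T>. \<exists>a c. \<forall>x\<in>interior T. v x = a \<bullet> x + c}"

definition L0_sides :: "(real^'n) set set \<Rightarrow> (real^'n \<Rightarrow> real) set" where
  "L0_sides \<S> = {v. \<forall>S\<in>\<S>. \<exists>c. \<forall>x\<in>rel_interior S. v x = c}"

definition elt_trace :: "(real^'n) set \<Rightarrow> (real^'n \<Rightarrow> 'b::t2_space) \<Rightarrow> real^'n \<Rightarrow> 'b" where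
  "elt_trace T v x = Lim (at x within interior T) v"

text \<open>\<open>\<Pi>\<^sub>h\<close>: element averages; the element interiors are disjoint, so at most one summand is nonzero.\<close>

definition Pi_h :: "(real^'n) set set \<Rightarrow> (real^'n \<Rightarrow> real^'n) \<Rightarrow> real^'n \<Rightarrow> real^'n" where
  "Pi_h \<T> v x = (\<Sum>T\<in>\<T>. indicator (interior T) x *\<^sub>R
                   ((1 / measure lebesgue T) *\<^sub>R (LINT y:T|lebesgue. v y)))"

text \<open>\<open>\<pi>\<^sub>h\<close> applied to the boundary trace of \<open>v\<close>, on the boundary sides in \<open>\<S>\<close>; the relative interiors
  of distinct sides are disjoint.\<close>

definition pi_h :: "(real^'n) set set \<Rightarrow> (real^'n) set set \<Rightarrow> (real^'n \<Rightarrow> real) \<Rightarrow> real^'n \<Rightarrow> real" where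
  "pi_h \<T> \<S> v x = (\<Sum>S\<in>\<S>. indicator (rel_interior S) x * side_average S (elt_trace (adj \<T> S) v))"

text \<open>Classical gradient and divergence at points of differentiability; in the element interiors
  these are the element-wise operators.\<close>

definition grad :: "(real^'n \<Rightarrow> real) \<Rightarrow> real^'n \<Rightarrow> real^'n" where
  "grad v x = (\<chi> i. frechet_derivative v (at x) (axis i 1))"

definition divg :: "(real^'n \<Rightarrow> real^'n) \<Rightarrow> real^'n \<Rightarrow> real" where
  "divg y x = (\<Sum>i\<in>UNIV. frechet_derivative y (at x) (axis i 1) $ i)"

definition pairing :: "(real^'n) set \<Rightarrow> (real^'n \<Rightarrow> 'b::real_inner) \<Rightarrow> (real^'n \<Rightarrow> 'b) \<Rightarrow> real" where
  "pairing \<omega> v w = (LINT x:\<omega>|lebesgue. v x \<bullet> w x)"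

definition L2norm :: "(real^'n) set \<Rightarrow> (real^'n \<Rightarrow> 'b::real_normed_vector) \<Rightarrow> real" where
  "L2norm \<omega> v = sqrt (LINT x:\<omega>|lebesgue. (norm (v x))\<^sup>2)"

definition ess_inf :: "(real^'n) set \<Rightarrow> (real^'n \<Rightarrow> real) \<Rightarrow> ereal" where
  "ess_inf \<omega> v = - esssup (lebesgue_on \<omega>) (\<lambda>x. - ereal (v x))"

definition Linf_norm :: "(real^'n) set \<Rightarrow> (real^'n \<Rightarrow> 'b::real_normed_vector) \<Rightarrow> ereal" where
  "Linf_norm \<omega> v = esssup (lebesgue_on \<omega>) (\<lambda>x. ereal (norm (v x)))"

definition CR1 :: "(real^'n) set \<Rightarrow> (real^'n) set set \<Rightarrow> (real^'n \<Rightarrow> real) set" where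
  "CR1 \<Omega> \<T> = {v \<in> L1 \<T>. \<forall>S\<in>int_sides \<Omega> \<T>. \<forall>T\<in>\<T>. \<forall>T'\<in>\<T>.
     T \<noteq> T' \<and> S facet_of T \<and> S facet_of T' \<longrightarrow>
       side_average S (\<lambda>x. elt_trace T v x - elt_trace T' v x) = 0}"

definition RT0 :: "(real^'n) set \<Rightarrow> (real^'n) set set \<Rightarrow> (real^'n \<Rightarrow> real^'n) set" where
  "RT0 \<Omega> \<T> = {y. (\<forall>i. (\<lambda>x. y x $ i) \<in> L1 \<T>) \<and>
     (\<forall>T\<in>\<T>. \<forall>S. S facet_of T \<longrightarrow> (\<exists>c. \<forall>x\<in>S. elt_trace T y x \<bullet> outer_normal T S = c)) \<and>
     (\<forall>S\<in>int_sides \<Omega> \<T>. \<forall>T\<in>\<T>. \<forall>T'\<in>\<T>. T \<noteq> T' \<and> S facet_of T \<and> S facet_of T' \<longrightarrow>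
        (\<forall>x\<in>S. elt_trace T y x \<bullet> outer_normal T S + elt_trace T' y x \<bullet> outer_normal T' S = 0))}"

text \<open>\<open>y \<cdot> n\<close> on a boundary side \<open>S\<close>.\<close>

definition ntrace :: "(real^'n) set set \<Rightarrow> (real^'n) set \<Rightarrow> (real^'n \<Rightarrow> real^'n) \<Rightarrow> real^'n \<Rightarrow> real" where
  "ntrace \<T> S y x = elt_trace (adj \<T> S) y x \<bullet> outer_normal (adj \<T> S) S"

definition normal_eq_on :: "(real^'n) set \<Rightarrow> (real^'n) set set \<Rightarrow> (real^'n) set \<Rightarrow>
    (real^'n \<Rightarrow> real^'n) \<Rightarrow> (real^'n \<Rightarrow> real) \<Rightarrow> bool" where
  "normal_eq_on \<Omega> \<T> \<Gamma> y g \<longleftrightarrow>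
     (\<forall>S\<in>bd_sides \<Omega> \<T>. AE x in side_measure S. x \<in> S \<inter> \<Gamma> \<longrightarrow> ntrace \<T> S y x = g x)"

definition normal_pairing :: "(real^'n) set \<Rightarrow> (real^'n) set set \<Rightarrow> (real^'n) set \<Rightarrow>
    (real^'n \<Rightarrow> real^'n) \<Rightarrow> (real^'n \<Rightarrow> real) \<Rightarrow> real" where
  "normal_pairing \<Omega> \<T> \<Gamma> y u =
     (\<Sum>S\<in>bd_sides \<Omega> \<T>. LINT x:(S \<inter> \<Gamma>)|side_measure S. ntrace \<T> S y x * u x)"

definition RT0_N :: "(real^'n) set \<Rightarrow> (real^'n) set set \<Rightarrow> (real^'n) set \<Rightarrow> (real^'n \<Rightarrow> real^'n) set" where
  "RT0_N \<Omega> \<T> \<Gamma>N = {y \<in> RT0 \<Omega> \<T>. normal_eq_on \<Omega> \<T> \<Gamma>N y (\<lambda>x. 0)}"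

definition phi_star :: "(real^'n \<Rightarrow> real) \<Rightarrow> real^'n \<Rightarrow> real \<Rightarrow> real" where
  "phi_star \<zeta> x r = (if r \<le> \<zeta> x then r\<^sup>2 / 2 else \<zeta> x * r - (\<zeta> x)\<^sup>2 / 2)"

text \<open>\<open>D\<^sub>t \<phi>\<^sub>h\<^sup>* (x, r) / r\<close>, extended by continuity to \<open>r = 0\<close>.\<close>

definition phi_weight :: "(real^'n \<Rightarrow> real) \<Rightarrow> real^'n \<Rightarrow> real \<Rightarrow> real" where
  "phi_weight \<zeta> x r = (if r = 0 then 1 else deriv (phi_star \<zeta> x) r / r)"

definition K_rt :: "(real^'n) set \<Rightarrow> (real^'n) set set \<Rightarrow> (real^'n) set \<Rightarrow>
    (real^'n \<Rightarrow> real) \<Rightarrow> (real^'n \<Rightarrow> real) \<Rightarrow> (real^'n \<Rightarrow> real^'n) set" where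
  "K_rt \<Omega> \<T> \<Gamma>N f g = {y \<in> RT0 \<Omega> \<T>.
     (AE x in lebesgue_on \<Omega>. divg y x = - f x) \<and> normal_eq_on \<Omega> \<T> \<Gamma>N y g}"

definition D_rt :: "(real^'n) set \<Rightarrow> (real^'n) set set \<Rightarrow> (real^'n) set \<Rightarrow> (real^'n) set \<Rightarrow>
    (real^'n \<Rightarrow> real) \<Rightarrow> (real^'n \<Rightarrow> real) \<Rightarrow> (real^'n \<Rightarrow> real) \<Rightarrow> (real^'n \<Rightarrow> real) \<Rightarrow>
    (real^'n \<Rightarrow> real^'n) \<Rightarrow> ereal" where
  "D_rt \<Omega> \<T> \<Gamma>D \<Gamma>N f g \<zeta> uD y =
     (if y \<in> K_rt \<Omega> \<T> \<Gamma>N f g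
      then ereal (- (LINT x:\<Omega>|lebesgue. phi_star \<zeta> x (norm (Pi_h \<T> y x)))
                  + normal_pairing \<Omega> \<T> \<Gamma>D y uD)
      else - \<infinity>)"

text \<open>Backward difference quotient; \<open>z'\<close> is the previous iterate.\<close>

definition d_tau :: "real \<Rightarrow> (real^'n \<Rightarrow> real^'n) \<Rightarrow> (real^'n \<Rightarrow> real^'n) \<Rightarrow> real^'n \<Rightarrow> real^'n" where
  "d_tau \<tau> z' z x = (1 / \<tau>) *\<^sub>R (z x - z' x)"

text \<open>\<open>z'\<close> is the previous and \<open>(z, lam)\<close> the new iterate of the semi-implicit scheme.\<close>

definition flow_step :: "(real^'n) set \<Rightarrow> (real^'n) set set \<Rightarrow> (real^'n) set \<Rightarrow> (real^'n) set \<Rightarrow>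
    (real^'n \<Rightarrow> real) \<Rightarrow> (real^'n \<Rightarrow> real) \<Rightarrow> (real^'n \<Rightarrow> real) \<Rightarrow> (real^'n \<Rightarrow> real) \<Rightarrow> real \<Rightarrow>
    (real^'n \<Rightarrow> real^'n) \<Rightarrow> (real^'n \<Rightarrow> real^'n) \<Rightarrow> (real^'n \<Rightarrow> real) \<Rightarrow> bool" where
  "flow_step \<Omega> \<T> \<Gamma>D \<Gamma>N f g \<zeta> uD \<tau> z' z lam \<longleftrightarrow>
     z \<in> RT0 \<Omega> \<T> \<and> lam \<in> L0 \<T> \<and> normal_eq_on \<Omega> \<T> \<Gamma>N z g \<and>
     (\<forall>y\<in>RT0_N \<Omega> \<T> \<Gamma>N. \<forall>\<eta>\<in>L0 \<T>.
        pairing \<Omega> (\<lambda>x. Pi_h \<T> (d_tau \<tau> z' z) x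
                       + phi_weight \<zeta> x (norm (Pi_h \<T> z' x)) *\<^sub>R Pi_h \<T> z x) (Pi_h \<T> y)
          + pairing \<Omega> lam (divg y) = normal_pairing \<Omega> \<T> \<Gamma>D y uD \<and>
        pairing \<Omega> (divg z) \<eta> = - pairing \<Omega> f \<eta>)"

definition flow_residual :: "(real^'n) set \<Rightarrow> (real^'n) set set \<Rightarrow> (real^'n) set \<Rightarrow> (real^'n) set \<Rightarrow>
    (real^'n \<Rightarrow> real) \<Rightarrow> (real^'n \<Rightarrow> real) \<Rightarrow>
    (real^'n \<Rightarrow> real^'n) \<Rightarrow> (real^'n \<Rightarrow> real) \<Rightarrow> (real^'n \<Rightarrow> real^'n) \<Rightarrow> bool" where
  "flow_residual \<Omega> \<T> \<Gamma>D \<Gamma>N \<zeta> uD z lam r \<longleftrightarrow>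
     r \<in> RT0_N \<Omega> \<T> \<Gamma>N \<and>
     (\<forall>y\<in>RT0_N \<Omega> \<T> \<Gamma>N.
        pairing \<Omega> r y =
          pairing \<Omega> (\<lambda>x. phi_weight \<zeta> x (norm (Pi_h \<T> z x)) *\<^sub>R Pi_h \<T> z x) (Pi_h \<T> y)
          + pairing \<Omega> lam (divg y) - normal_pairing \<Omega> \<T> \<Gamma>D y uD)"

end

theory Submission
  imports Defs
begin

text \<open>
  On an element \<open>T\<close> a lowest-order Raviart--Thomas field has the form \<open>a + \<beta> x\<close>, so up to null sets a
  field is described by finitely many numbers: its element averages \<open>avg T y\<close> and its element
  divergences \<open>dvg T y\<close>. Every integral in a step is a sum over the elements of volumes times such
  numbers, and a field without divergence is element-wise constant and equal to its averages. This
  turns a step of the flow into the finite system \<open>flow_step_iff\<close>.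

  Well-posedness. Let \<open>Z\<close> consist of the divergence-free fields without flux through the Neumann sides.
  Two solutions of a step differ by an element of \<open>Z\<close> on which the weighted quadratic form vanishes;
  the weights \<open>1/\<tau> + W\<close> are positive, so the difference is zero. For existence, the Riesz theorem
  \<open>riesz_finitely_many_functionals\<close> on \<open>Z\<close> corrects the admissible field \<open>z0\<close> such that the equation
  holds for all test fields in \<open>Z\<close>. What is left over is a functional that vanishes on the common
  kernel of the element divergences; it is therefore a combination of them, and the coefficients give
  the multiplier.

  Stability. The density \<open>\<phi>\<^sup>*\<close> is a concave function of \<open>r\<^sup>2\<close> whose slope is half the weight of the scheme.
  Testing the step with the increment, which is an element of \<open>Z\<close>, bounds the energy \<open>- D\<close> of the new
  iterate by that of the old one minus \<open>\<tau>\<close> times the squared norm of the difference quotient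
  (\<open>energy_decreases\<close>).

  Termination. The energy is bounded from below on the admissible set (\<open>energy_bounded_below\<close>): for
  fields in \<open>Z\<close> the boundary term equals the integral of the field against the gradient of the lift
  (\<open>integration_by_parts\<close>), this gradient is at most \<open>\<zeta>\<close> in norm, and \<open>\<phi>\<^sup>*\<close> grows like \<open>\<zeta> r\<close>. Hence the
  dissipation is summable and becomes arbitrarily small. The residual measures by how much the step
  with old weights misses the equation with new weights, and since the weight times its argument is
  the projection onto a ball, its norm is at most \<open>1 + 2 \<tau>\<close> times that of the difference quotient
  (\<open>residual_bound\<close>).

  The integration by parts rests on the divergence theorem for a constant field and an affine function
  on one simplex (\<open>divergence_simplex_constant_field\<close>). The measure of a side is the projection of
  Lebesgue measure on a prism, so the point is to express the volume of that prism by the volume of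
  the simplex and to know that all barycentric coordinates have the same mean over a side. Both follow
  from the uniqueness of translation-invariant measures, which makes affine involutions and shears
  measure preserving.
\<close>

section \<open>Translation invariance and measure preserving involutions\<close>

text \<open>Both sides equal the integral of \<open>1\<^sub>A(x) 1\<^sub>B(x + y)\<close> over \<open>x\<close> and \<open>y\<close>. Integrating over \<open>y\<close> first
  produces the Lebesgue measure of \<open>B\<close>; shifting \<open>x\<close> by \<open>- y\<close> before integrating over \<open>y\<close> produces
  the Lebesgue measure of the reflection of \<open>A\<close>.\<close>

lemma translation_invariant_proportional_lborel:
  fixes \<nu> :: "'a::euclidean_space measure"
  assumes [measurable_cong]: "sets \<nu> = sets borel" and fin: "sigma_finite_measure \<nu>"
    and inv: "\<And>a. distr \<nu> borel ((+) a) = \<nu>"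
    and [measurable]: "A \<in> sets borel" "B \<in> sets borel"
  shows "emeasure \<nu> A * emeasure lborel B = emeasure \<nu> B * emeasure lborel A"
proof -
  interpret \<nu>: sigma_finite_measure \<nu> by fact
  interpret pair_sigma_finite \<nu> lborel ..
  have shift: "(\<integral>\<^sup>+y. h (a + y) \<partial>lborel) = (\<integral>\<^sup>+y. h y \<partial>lborel)"
    if [measurable]: "h \<in> borel_measurable borel" for h :: "'a \<Rightarrow> ennreal" and a
  proof -
    have "(\<integral>\<^sup>+y. h y \<partial>lborel) = (\<integral>\<^sup>+y. h y \<partial>distr lborel borel ((+) a))"
      by (simp add: lborel_distr_plus)
    also have "\<dots> = (\<integral>\<^sup>+y. h (a + y) \<partial>lborel)"
      by (subst nn_integral_distr) auto
    finally show ?thesis by simp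
  qed
  have shift': "(\<integral>\<^sup>+y. h (a + y) \<partial>\<nu>) = (\<integral>\<^sup>+y. h y \<partial>\<nu>)"
    if [measurable]: "h \<in> borel_measurable borel" for h :: "'a \<Rightarrow> ennreal" and a
  proof -
    have "(\<integral>\<^sup>+y. h y \<partial>\<nu>) = (\<integral>\<^sup>+y. h y \<partial>distr \<nu> borel ((+) a))"
      by (simp add: inv)
    also have "\<dots> = (\<integral>\<^sup>+y. h (a + y) \<partial>\<nu>)"
      by (subst nn_integral_distr) auto
    finally show ?thesis by simp
  qed
  have refl: "(\<integral>\<^sup>+y. h (a - y) \<partial>lborel) = (\<integral>\<^sup>+y. h y \<partial>lborel)"
    if [measurable]: "h \<in> borel_measurable borel" for h :: "'a \<Rightarrow> ennreal" and a
  proof -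
    have u: "(lborel :: 'a measure) = distr lborel borel uminus"
      using lborel_affine_euclidean[of "\<lambda>_. -1 :: real" "0::'a"]
      by (simp add: density_1 euclidean_representation sum_negf)
    have "(\<integral>\<^sup>+y. h y \<partial>lborel) = (\<integral>\<^sup>+y. h (a + y) \<partial>lborel)"
      by (simp add: shift)
    also have "\<dots> = (\<integral>\<^sup>+y. h (a + y) \<partial>distr lborel borel uminus)"
      by (simp add: u[symmetric])
    also have "\<dots> = (\<integral>\<^sup>+y. h (a - y) \<partial>lborel)"
      by (subst nn_integral_distr) auto
    finally show ?thesis by simp
  qed
  have "emeasure \<nu> A * emeasure lborel B = (\<integral>\<^sup>+x. indicator A x * emeasure lborel B \<partial>\<nu>)"
    by (simp add: nn_integral_multc)
  also have "\<dots> = (\<integral>\<^sup>+x. indicator A x * (\<integral>\<^sup>+y. indicator B (x + y) \<partial>lborel) \<partial>\<nu>)"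
    by (subst shift) auto
  also have "\<dots> = (\<integral>\<^sup>+x. (\<integral>\<^sup>+y. indicator A x * indicator B (x + y) \<partial>lborel) \<partial>\<nu>)"
    by (intro nn_integral_cong) (simp add: nn_integral_cmult)
  also have "\<dots> = (\<integral>\<^sup>+y. (\<integral>\<^sup>+x. indicator A x * indicator B (x + y) \<partial>\<nu>) \<partial>lborel)"
    by (rule Fubini'[symmetric]) measurable
  also have "\<dots> = (\<integral>\<^sup>+y. (\<integral>\<^sup>+x. indicator A (- y + x) * indicator B x \<partial>\<nu>) \<partial>lborel)"
  proof (rule nn_integral_cong)
    fix y :: 'a
    have "(\<integral>\<^sup>+x. indicator A x * indicator B (x + y) \<partial>\<nu>) =
        (\<integral>\<^sup>+x. indicator A (- y + x) * indicator B ((- y + x) + y) \<partial>\<nu>)"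
      by (rule shift'[symmetric]) measurable
    then show "(\<integral>\<^sup>+x. indicator A x * indicator B (x + y) \<partial>\<nu>) =
        (\<integral>\<^sup>+x. (indicator A (- y + x) :: ennreal) * indicator B x \<partial>\<nu>)" by simp
  qed
  also have "\<dots> = (\<integral>\<^sup>+x. (\<integral>\<^sup>+y. indicator A (- y + x) * indicator B x \<partial>lborel) \<partial>\<nu>)"
    by (rule Fubini') measurable
  also have "\<dots> = (\<integral>\<^sup>+x. indicator B x * (\<integral>\<^sup>+y. indicator A (x - y) \<partial>lborel) \<partial>\<nu>)"
    by (intro nn_integral_cong, subst nn_integral_cmult[symmetric]) (auto simp: mult.commute)
  also have "\<dots> = (\<integral>\<^sup>+x. indicator B x * emeasure lborel A \<partial>\<nu>)"
    by (subst refl) auto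
  also have "\<dots> = emeasure \<nu> B * emeasure lborel A"
    by (simp add: nn_integral_multc)
  finally show ?thesis .
qed

text \<open>The image measure is translation invariant, so \<open>f\<close> scales all volumes by the same factor. Applying
  \<open>f\<close> twice shows that the square of the factor is one.\<close>

lemma linear_involution_distr_lborel:
  fixes f :: "'a::euclidean_space \<Rightarrow> 'a"
  assumes lin: "linear f" and invol: "\<And>x. f (f x) = x"
  shows "distr lborel borel f = lborel"
proof -
  have [measurable]: "f \<in> borel_measurable borel"
    using lin by (simp add: linear_continuous_on linear_linear borel_measurable_continuous_onI)
  have vim: "f -` X = f ` X" for X using invol by (auto simp: image_iff) metis
  let ?\<nu> = "distr lborel borel f"
  have em: "emeasure ?\<nu> X = emeasure lborel (f -` X)" if "X \<in> sets borel" for X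
    using that by (simp add: emeasure_distr)
  have fin: "sigma_finite_measure ?\<nu>"
  proof
    have "emeasure lborel (f -` cball 0 (real n)) < \<infinity>" for n
    proof (rule emeasure_bounded_finite)
      show "bounded (f -` cball 0 (real n))"
        unfolding vim using lin by (intro bounded_linear_image) (auto simp: linear_linear)
    qed
    then show "\<exists>A. countable A \<and> A \<subseteq> sets ?\<nu> \<and> \<Union> A = space ?\<nu> \<and> (\<forall>a\<in>A. emeasure ?\<nu> a \<noteq> \<infinity>)"
      using real_arch_simple by (intro exI[of _ "range (\<lambda>n. cball 0 (real n))"]) (auto simp: em less_top[symmetric])
  qed
  have inv: "distr ?\<nu> borel ((+) a) = ?\<nu>" for a
  proof -
    have "distr ?\<nu> borel ((+) a) = distr (distr lborel borel ((+) (f a))) borel f"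
      by (subst (1 2) distr_distr) (auto simp: o_def linear_add[OF lin] invol)
    then show ?thesis by (simp add: lborel_distr_plus)
  qed
  have sq: "x = y" if "x * x = y * y" for x y :: ennreal
    using that unfolding power2_eq_square[symmetric]
    by (cases x; cases y) (auto simp: ennreal_power power2_eq_iff_nonneg power_eq_top_ennreal
        eq_commute[of top "_ ^ 2"])
  show ?thesis
  proof (rule measure_eqI)
    fix X assume "X \<in> sets ?\<nu>"
    then have [measurable]: "X \<in> sets borel" by simp
    have [measurable]: "f -` X \<in> sets borel"
      using measurable_sets[of f borel borel X] by simp
    have "emeasure ?\<nu> X * emeasure lborel (f -` X) = emeasure ?\<nu> (f -` X) * emeasure lborel X"
      by (rule translation_invariant_proportional_lborel[OF _ fin inv]) auto
    moreover have "f -` (f -` X) = X" using invol by auto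
    ultimately have "emeasure ?\<nu> X * emeasure ?\<nu> X = emeasure lborel X * emeasure lborel X"
      by (simp add: em)
    then show "emeasure ?\<nu> X = emeasure lborel X" by (rule sq)
  qed simp
qed

lemma affine_involution_distr_lborel:
  fixes f :: "'a::euclidean_space \<Rightarrow> 'a"
  assumes lin: "linear f" and invol: "\<And>x. f (f x + b) + b = x"
  shows "distr lborel borel (\<lambda>x. f x + b) = lborel"
proof -
  have "f (f x) = x" for x
    using invol[of x] invol[of 0] by (simp add: linear_add[OF lin] linear_0[OF lin] add.assoc)
  then have d: "distr lborel borel f = lborel" by (rule linear_involution_distr_lborel[OF lin])
  have [measurable]: "f \<in> borel_measurable borel"
    using lin by (simp add: linear_continuous_on linear_linear borel_measurable_continuous_onI)
  have "distr lborel borel (\<lambda>x. f x + b) = distr (distr lborel borel f) borel ((+) b)"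
    by (subst distr_distr) (auto simp: o_def add.commute)
  then show ?thesis by (simp add: d lborel_distr_plus)
qed

text \<open>A shear is the composition of two skew reflections.\<close>

text \<open>The map changes the sign of \<open>m \<bullet> x + \<alpha>\<close> and moves points along \<open>w\<close> only, so it is an involution.\<close>

lemma skew_reflection_distr_lborel:
  fixes m w :: "'a::euclidean_space"
  assumes "m \<bullet> w = - 2"
  shows "distr lborel borel (\<lambda>x. x + (m \<bullet> x + \<alpha>) *\<^sub>R w) = lborel"
proof -
  have "linear (\<lambda>x. x + (m \<bullet> x) *\<^sub>R w)"
    by (intro linearI) (auto simp: algebra_simps inner_add_right)
  then have "distr lborel borel (\<lambda>x. (x + (m \<bullet> x) *\<^sub>R w) + \<alpha> *\<^sub>R w) = lborel"
  proof (rule affine_involution_distr_lborel)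
    fix x
    define j where "j = m \<bullet> (x + (m \<bullet> x) *\<^sub>R w + \<alpha> *\<^sub>R w)"
    have "m \<bullet> x + \<alpha> + j + \<alpha> = 0"
      using assms by (simp add: j_def inner_add_right)
    moreover have "x + (m \<bullet> x) *\<^sub>R w + \<alpha> *\<^sub>R w + j *\<^sub>R w + \<alpha> *\<^sub>R w = x + (m \<bullet> x + \<alpha> + j + \<alpha>) *\<^sub>R w"
      by (simp only: scaleR_left_distrib add.assoc)
    ultimately show "x + (m \<bullet> x) *\<^sub>R w + \<alpha> *\<^sub>R w + (m \<bullet> (x + (m \<bullet> x) *\<^sub>R w + \<alpha> *\<^sub>R w)) *\<^sub>R w + \<alpha> *\<^sub>R w = x"
      by (simp add: j_def)
  qed
  then show ?thesis by (simp add: algebra_simps)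
qed

lemma shear_distr_lborel:
  fixes m u :: "'a::euclidean_space"
  assumes "m \<bullet> u = 0" "m \<noteq> 0"
  shows "distr lborel borel (\<lambda>x. x + (m \<bullet> x + \<alpha>) *\<^sub>R u) = lborel"
proof -
  define r where "r = (- 2 / (m \<bullet> m)) *\<^sub>R m"
  have r: "m \<bullet> r = - 2" using assms by (simp add: r_def)
  have "(\<lambda>x. x + (m \<bullet> x + \<alpha>) *\<^sub>R u) =
      (\<lambda>x. x + (m \<bullet> x + \<alpha>) *\<^sub>R (r - u)) \<circ> (\<lambda>x. x + (m \<bullet> x + \<alpha>) *\<^sub>R r)"
  proof
    fix x
    have "m \<bullet> (x + (m \<bullet> x + \<alpha>) *\<^sub>R r) + \<alpha> = - (m \<bullet> x + \<alpha>)"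
      using r by (simp add: inner_add_right)
    then show "x + (m \<bullet> x + \<alpha>) *\<^sub>R u =
      ((\<lambda>x. x + (m \<bullet> x + \<alpha>) *\<^sub>R (r - u)) \<circ> (\<lambda>x. x + (m \<bullet> x + \<alpha>) *\<^sub>R r)) x"
      unfolding o_def by (simp only:) (simp add: algebra_simps)
  qed
  then have "distr lborel borel (\<lambda>x. x + (m \<bullet> x + \<alpha>) *\<^sub>R u) =
     distr (distr lborel borel (\<lambda>x. x + (m \<bullet> x + \<alpha>) *\<^sub>R r)) borel (\<lambda>x. x + (m \<bullet> x + \<alpha>) *\<^sub>R (r - u))"
    by (subst distr_distr) auto
  also have "\<dots> = lborel"
    using r assms by (simp add: skew_reflection_distr_lborel inner_diff_right)
  finally show ?thesis .
qed

section \<open>Barycentric coordinates of a simplex\<close>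

abbreviation vol :: "(real^'n) set \<Rightarrow> real" where
  "vol \<equiv> measure lebesgue"

text \<open>The gradient of the barycentric coordinate of the vertex \<open>c\<close>: the affine function that is \<open>1\<close> at \<open>c\<close>
  and \<open>0\<close> at the other vertices drops by one along each edge that leaves \<open>c\<close>.\<close>

definition bgrad :: "(real^'n) set \<Rightarrow> real^'n \<Rightarrow> real^'n" where
  "bgrad C c = (SOME m. \<forall>c'\<in>C - {c}. m \<bullet> (c' - c) = - 1)"

definition bary :: "(real^'n) set \<Rightarrow> real^'n \<Rightarrow> real^'n \<Rightarrow> real" where
  "bary C c x = 1 + bgrad C c \<bullet> (x - c)"

text \<open>The orthogonal projection onto the hyperplane of the side opposite to \<open>c\<close>. Together with \<open>bary C c\<close>
  it provides tangential and normal coordinates relative to this side.\<close>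

definition foot :: "(real^'n) set \<Rightarrow> real^'n \<Rightarrow> real^'n \<Rightarrow> real^'n" where
  "foot C c x = x - (bary C c x / (bgrad C c \<bullet> bgrad C c)) *\<^sub>R bgrad C c"

lemma bary_diff: "bary C c y - bary C c x = bgrad C c \<bullet> (y - x)"
  by (simp add: bary_def inner_diff_right)

lemma bary_add: "bary C c (x + v) = bary C c x + bgrad C c \<bullet> v"
  by (simp add: bary_def inner_diff_right inner_add_right)

lemma bary_combine: "bary C c ((1 - t) *\<^sub>R x + t *\<^sub>R y) = (1 - t) * bary C c x + t * bary C c y"
  by (simp add: bary_def inner_diff_right inner_add_right algebra_simps)

lemma continuous_bary [continuous_intros]: "continuous_on S (bary C c)"
  unfolding bary_def by (intro continuous_intros)

lemma bary_measurable [measurable]: "bary C c \<in> borel_measurable borel"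
  by (intro borel_measurable_continuous_onI continuous_intros)

lemma continuous_foot [continuous_intros]: "continuous_on S (foot C c)"
  unfolding foot_def divide_inverse by (intro continuous_intros)

lemma foot_measurable [measurable]: "foot C c \<in> borel_measurable borel"
  by (intro borel_measurable_continuous_onI continuous_intros)

locale full_simplex =
  fixes C :: "(real^'n) set"
  assumes indep: "\<not> affine_dependent C" and card: "card C = Suc CARD('n)"
begin

abbreviation (input) facet :: "real^'n \<Rightarrow> (real^'n) set" where
  "facet c \<equiv> convex hull (C - {c})"

abbreviation (input) normal :: "real^'n \<Rightarrow> real^'n" where
  "normal c \<equiv> outer_normal (convex hull C) (facet c)"

lemma finite_C [simp]: "finite C"
  using indep by (rule aff_independent_finite)

lemma other_vertex: obtains c' where "c' \<in> C" "c' \<noteq> c"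
proof -
  have "\<not> C \<subseteq> {c}"
    using card card_mono[of "{c}" C] by fastforce
  then show ?thesis using that by auto
qed

lemma bgrad_edge: 
  assumes "c \<in> C" "c' \<in> C" "c' \<noteq> c"
  shows "bgrad C c \<bullet> (c' - c) = - 1"
proof -
  let ?B = "(\<lambda>x. - c + x) ` (C - {c})"
  have "independent ?B"
    using indep assms(1) affine_dependent_iff_dependent2 by blast
  then obtain h :: "real^'n \<Rightarrow> real" where h: "linear h" "\<forall>x\<in>?B. h x = - 1"
    using linear_independent_extend[of ?B "\<lambda>_. - 1 :: real"] by auto
  have "\<forall>c'\<in>C - {c}. adjoint h 1 \<bullet> (c' - c) = - 1"
    using h by (auto simp: inner_commute[of "adjoint h 1"] adjoint_works)
  then have "\<forall>c'\<in>C - {c}. bgrad C c \<bullet> (c' - c) = - 1"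
    unfolding bgrad_def by (rule someI)
  then show ?thesis using assms by auto
qed

lemma bary_vertex:
  assumes "c \<in> C" "c' \<in> C"
  shows "bary C c c' = (if c' = c then 1 else 0)"
  using bgrad_edge[OF assms] by (simp add: bary_def)

lemma bary_affine_combination:
  assumes "c \<in> C" "sum u C = 1"
  shows "bary C c (\<Sum>v\<in>C. u v *\<^sub>R v) = u c"
proof -
  have "(\<Sum>v\<in>C. u v *\<^sub>R v) - c = (\<Sum>v\<in>C. u v *\<^sub>R (v - c))"
    using assms(2) by (simp add: scaleR_right_diff_distrib sum_subtractf scaleR_sum_left[symmetric])
  then have "bary C c (\<Sum>v\<in>C. u v *\<^sub>R v) = 1 + (\<Sum>v\<in>C. u v * (bgrad C c \<bullet> (v - c)))"
    by (simp add: bary_def inner_sum_right)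
  also have "(\<Sum>v\<in>C. u v * (bgrad C c \<bullet> (v - c))) = (\<Sum>v\<in>C. (if v = c then u v else 0) - u v)"
    using assms(1) by (intro sum.cong) (auto simp: bgrad_edge)
  also have "\<dots> = u c - 1"
    using assms by (simp add: sum_subtractf)
  finally show ?thesis by simp
qed

lemma affine_hull_vertices: "affine hull C = UNIV"
  using indep card by (intro affine_independent_span_eq) auto

lemma sum_bary: "(\<Sum>c\<in>C. bary C c x) = 1" and bary_representation: "(\<Sum>c\<in>C. bary C c x *\<^sub>R c) = x"
proof -
  have "x \<in> affine hull C" by (simp add: affine_hull_vertices)
  then obtain u where u: "sum u C = 1" "(\<Sum>v\<in>C. u v *\<^sub>R v) = x"
    by (auto simp: affine_hull_finite)
  have "bary C c x = u c" if "c \<in> C" for c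
    using bary_affine_combination[OF that u(1)] u(2) by simp
  then show "(\<Sum>c\<in>C. bary C c x) = 1" "(\<Sum>c\<in>C. bary C c x *\<^sub>R c) = x"
    using u by auto
qed

lemma sum_bgrad_inner: "(\<Sum>c\<in>C. bgrad C c \<bullet> v) = 0"
proof -
  have "(\<Sum>c\<in>C. bgrad C c \<bullet> v) = (\<Sum>c\<in>C. bary C c v - bary C c 0)"
    by (simp add: bary_diff)
  then show ?thesis by (simp add: sum_subtractf sum_bary)
qed

lemma bgrad_representation: "(\<Sum>c\<in>C. (bgrad C c \<bullet> v) *\<^sub>R c) = v"
proof -
  have "(\<Sum>c\<in>C. (bgrad C c \<bullet> v) *\<^sub>R c) = (\<Sum>c\<in>C. bary C c v *\<^sub>R c - bary C c 0 *\<^sub>R c)"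
    by (intro sum.cong) (simp_all add: bary_diff scaleR_left_diff_distrib[symmetric])
  then show ?thesis by (simp add: sum_subtractf bary_representation)
qed

lemma sum_bgrad: "(\<Sum>c\<in>C. bgrad C c) = 0"
  by (simp add: vector_eq_rdot[symmetric] inner_sum_left sum_bgrad_inner)

lemma bgrad_inner_diff:
  assumes "c \<in> C" "c1 \<in> C" "c2 \<in> C"
  shows "bgrad C c \<bullet> (c1 - c2) = (if c1 = c then 1 else 0) - (if c2 = c then 1 else 0)"
  using assms by (simp add: bary_diff[symmetric] bary_vertex)

lemma bgrad_nonzero: assumes "c \<in> C" shows "bgrad C c \<noteq> 0"
proof -
  obtain c' where "c' \<in> C" "c' \<noteq> c" by (rule other_vertex)
  then show ?thesis using bgrad_edge[OF assms, of c'] by auto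
qed

lemma convex_hull_bary: "convex hull C = {x. \<forall>c\<in>C. 0 \<le> bary C c x}"
proof (intro subset_antisym subsetI)
  fix x assume "x \<in> convex hull C"
  then obtain u where "\<forall>v\<in>C. 0 \<le> u v" "sum u C = 1" "(\<Sum>v\<in>C. u v *\<^sub>R v) = x"
    by (auto simp: convex_hull_finite)
  then show "x \<in> {x. \<forall>c\<in>C. 0 \<le> bary C c x}"
    using bary_affine_combination by auto
next
  fix x assume "x \<in> {x. \<forall>c\<in>C. 0 \<le> bary C c x}"
  then show "x \<in> convex hull C"
    using sum_bary bary_representation by (auto simp: convex_hull_finite intro!: exI[of _ "\<lambda>c. bary C c x"])
qed

lemma facet_combination:
  assumes "c \<in> C"
  shows "(\<Sum>v\<in>C - {c}. u v *\<^sub>R v) = (\<Sum>v\<in>C. (u(c := 0)) v *\<^sub>R v)"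
    and "sum u (C - {c}) = sum (u(c := 0)) C"
  using assms by (auto simp: sum.remove[of C c] intro!: sum.cong)

lemma facet_affine_hull_bary:
  assumes c: "c \<in> C"
  shows "affine hull (C - {c}) = {x. bary C c x = 0}"
proof (intro subset_antisym subsetI)
  fix x assume "x \<in> affine hull (C - {c})"
  then obtain u where "sum (u(c := 0)) C = 1" "(\<Sum>v\<in>C. (u(c := 0)) v *\<^sub>R v) = x"
    by (auto simp: affine_hull_finite facet_combination[OF c] simp del: fun_upd_apply)
  then show "x \<in> {x. bary C c x = 0}"
    using bary_affine_combination[OF c, of "u(c := 0)"] by simp
next
  fix x assume "x \<in> {x. bary C c x = 0}"
  then have "(\<lambda>v. bary C v x)(c := 0) = (\<lambda>v. bary C v x)" by auto
  then show "x \<in> affine hull (C - {c})"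
    using sum_bary[of x] bary_representation[of x]
    by (auto simp: affine_hull_finite facet_combination[OF c] simp del: fun_upd_apply
        intro!: exI[of _ "\<lambda>v. bary C v x"])
qed

lemma facet_bary:
  assumes c: "c \<in> C"
  shows "facet c = {x. bary C c x = 0 \<and> (\<forall>c'\<in>C - {c}. 0 \<le> bary C c' x)}"
proof (intro subset_antisym subsetI)
  fix x assume "x \<in> facet c"
  then obtain u where "sum (u(c := 0)) C = 1" "(\<Sum>v\<in>C. (u(c := 0)) v *\<^sub>R v) = x"
      "\<forall>v\<in>C - {c}. 0 \<le> u v"
    by (auto simp: convex_hull_finite facet_combination[OF c] simp del: fun_upd_apply)
  then show "x \<in> {x. bary C c x = 0 \<and> (\<forall>c'\<in>C - {c}. 0 \<le> bary C c' x)}"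
    using bary_affine_combination[of _ "u(c := 0)"] c by auto
next
  fix x assume x: "x \<in> {x. bary C c x = 0 \<and> (\<forall>c'\<in>C - {c}. 0 \<le> bary C c' x)}"
  then have "(\<lambda>v. bary C v x)(c := 0) = (\<lambda>v. bary C v x)" by auto
  then show "x \<in> facet c"
    using sum_bary[of x] bary_representation[of x] x
    by (auto simp: convex_hull_finite facet_combination[OF c] simp del: fun_upd_apply
        intro!: exI[of _ "\<lambda>v. bary C v x"])
qed

lemma facet_rel_interior_bary:
  assumes c: "c \<in> C"
  shows "rel_interior (facet c) = {x. bary C c x = 0 \<and> (\<forall>c'\<in>C - {c}. 0 < bary C c' x)}"
proof (intro subset_antisym subsetI)
  have ind: "\<not> affine_dependent (C - {c})"
    using indep affine_dependent_subset by blast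
  {
    fix x assume "x \<in> rel_interior (facet c)"
    then obtain u where "sum (u(c := 0)) C = 1" "(\<Sum>v\<in>C. (u(c := 0)) v *\<^sub>R v) = x"
        "\<forall>v\<in>C - {c}. 0 < u v"
      by (auto simp: rel_interior_convex_hull_explicit[OF ind] facet_combination[OF c] simp del: fun_upd_apply)
    then show "x \<in> {x. bary C c x = 0 \<and> (\<forall>c'\<in>C - {c}. 0 < bary C c' x)}"
      using bary_affine_combination[of _ "u(c := 0)"] c by auto
  next
    fix x assume x: "x \<in> {x. bary C c x = 0 \<and> (\<forall>c'\<in>C - {c}. 0 < bary C c' x)}"
    then have "(\<lambda>v. bary C v x)(c := 0) = (\<lambda>v. bary C v x)" by auto
    then show "x \<in> rel_interior (facet c)"
      using sum_bary[of x] bary_representation[of x] x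
      by (auto simp: rel_interior_convex_hull_explicit[OF ind] facet_combination[OF c] simp del: fun_upd_apply
          intro!: exI[of _ "\<lambda>v. bary C v x"])
  }
qed

lemma facet_of_iff: "S facet_of convex hull C \<longleftrightarrow> (\<exists>c\<in>C. S = facet c)"
  using facet_of_convex_hull_affine_independent_alt[OF indep, of S] card
  by (auto simp: Suc_le_eq)

text \<open>A vector \<open>v\<close> is the sum of the vectors \<open>c' - c1\<close> with coefficients \<open>bgrad C c' \<bullet> v\<close>, and \<open>w\<close> sees only
  the term of the vertex \<open>c\<close>. So the directions normal to a side form a line, which identifies the
  normals chosen by description operators and later the shape of Raviart--Thomas fields.\<close>

lemma orthogonal_to_facet:
  assumes "c \<in> C" "c1 \<in> C - {c}" and w: "\<And>c'. c' \<in> C - {c} \<Longrightarrow> w \<bullet> (c' - c1) = 0"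
  shows "w = (w \<bullet> (c - c1)) *\<^sub>R bgrad C c"
proof -
  have "w \<bullet> v = ((w \<bullet> (c - c1)) *\<^sub>R bgrad C c) \<bullet> v" for v
  proof -
    have "(\<Sum>c'\<in>C. (bgrad C c' \<bullet> v) *\<^sub>R (c' - c1)) = v"
      using bgrad_representation[of v] sum_bgrad_inner[of v]
      by (simp add: scaleR_right_diff_distrib sum_subtractf scaleR_sum_left[symmetric])
    then have "w \<bullet> v = w \<bullet> (\<Sum>c'\<in>C. (bgrad C c' \<bullet> v) *\<^sub>R (c' - c1))" by simp
    also have "\<dots> = (\<Sum>c'\<in>C. (bgrad C c' \<bullet> v) * (w \<bullet> (c' - c1)))"
      by (simp add: inner_sum_right)
    also have "\<dots> = (\<Sum>c'\<in>C. if c' = c then (bgrad C c' \<bullet> v) * (w \<bullet> (c' - c1)) else 0)"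
      using w by (intro sum.cong) auto
    finally show ?thesis using assms(1) by (simp add: mult.commute)
  qed
  show ?thesis by (rule vector_eq_rdot[THEN iffD1, OF allI]) fact
qed

lemma vertex_in_facet: "c' \<in> C - {c} \<Longrightarrow> c' \<in> facet c"
  by (rule hull_inc)

text \<open>The barycentric coordinate of \<open>c\<close> vanishes on the side and is nonnegative on the simplex, so its
  gradient points inwards.\<close>

lemma outer_normal_facet:
  assumes c: "c \<in> C"
  shows "normal c = - (1 / norm (bgrad C c)) *\<^sub>R bgrad C c"
    (is "_ = ?n")
  unfolding outer_normal_def
proof (rule the_equality)
  let ?g = "bgrad C c"
  have g: "?g \<noteq> 0" by (rule bgrad_nonzero[OF c])
  have "?n \<bullet> y \<le> ?n \<bullet> x" if "x \<in> facet c" "y \<in> convex hull C" for x y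
  proof -
    have "0 \<le> bary C c y - bary C c x"
      using that c by (auto simp: facet_bary[OF c] convex_hull_bary)
    then have "?g \<bullet> x \<le> ?g \<bullet> y" by (simp add: bary_diff inner_diff_right)
    then show ?thesis by (simp add: divide_right_mono)
  qed
  then show "norm ?n = 1 \<and> (\<forall>x\<in>facet c. \<forall>y\<in>convex hull C. ?n \<bullet> y \<le> ?n \<bullet> x)"
    using g by simp
next
  let ?g = "bgrad C c"
  have g: "?g \<noteq> 0" by (rule bgrad_nonzero[OF c])
  fix n :: "real^'n"
  assume n: "norm n = 1 \<and> (\<forall>x\<in>facet c. \<forall>y\<in>convex hull C. n \<bullet> y \<le> n \<bullet> x)"
  obtain c1 where c1: "c1 \<in> C - {c}" using other_vertex[of c] by auto
  have "n \<bullet> (c' - c1) = 0" if "c' \<in> C - {c}" for c'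
  proof -
    have "c' \<in> facet c" "c1 \<in> facet c" "c' \<in> convex hull C" "c1 \<in> convex hull C"
      using that c1 by (auto intro: hull_inc)
    then have "n \<bullet> c' = n \<bullet> c1" using n by (intro antisym) auto
    then show ?thesis by (simp add: inner_diff_right)
  qed
  from orthogonal_to_facet[OF c c1 this]
  have eq: "n = (n \<bullet> (c - c1)) *\<^sub>R ?g" by blast
  have "c1 \<in> facet c" "c \<in> convex hull C"
    using c c1 by (auto intro: hull_inc)
  then have le: "n \<bullet> (c - c1) \<le> 0"
    using n by (auto simp: inner_diff_right)
  have "1 = \<bar>n \<bullet> (c - c1)\<bar> * norm ?g"
    using n arg_cong[OF eq, of norm] by simp
  then have "n \<bullet> (c - c1) = - (1 / norm ?g)"
    using le g by (simp add: field_simps)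
  with eq show "n = ?n" by simp
qed

lemma foot_bary:
  assumes "c \<in> C" shows "bary C c (foot C c x) = 0"
  using bgrad_nonzero[OF assms] bary_add[of C c x "- (bary C c x / (bgrad C c \<bullet> bgrad C c)) *\<^sub>R bgrad C c"]
  by (simp add: foot_def)

lemma foot_on_facet: "bary C c x = 0 \<Longrightarrow> foot C c x = x"
  by (simp add: foot_def)

lemma closest_point_facet:
  assumes c: "c \<in> C"
  shows "closest_point (affine hull (facet c)) x = foot C c x"
proof (rule closest_point_unique[symmetric])
  let ?A = "affine hull (facet c)"
  have A: "?A = {x. bary C c x = 0}"
    by (simp add: facet_affine_hull_bary[OF c])
  show "convex ?A" "closed ?A" by (auto simp: affine_imp_convex)
  show "foot C c x \<in> ?A" unfolding A using foot_bary[OF c] by simp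
  show "\<forall>z\<in>?A. dist x (foot C c x) \<le> dist x z"
  proof
    fix z assume "z \<in> ?A"
    then have "bary C c z = 0" unfolding A by simp
    then have "bgrad C c \<bullet> (z - foot C c x) = 0"
      using foot_bary[OF c, of x] by (simp add: bary_diff[symmetric])
    then have "bgrad C c \<bullet> (foot C c x - z) = 0" by (simp add: inner_diff_right)
    moreover have "x - foot C c x = (bary C c x / (bgrad C c \<bullet> bgrad C c)) *\<^sub>R bgrad C c"
      by (simp add: foot_def)
    ultimately have "orthogonal (x - foot C c x) (foot C c x - z)"
      by (simp only: orthogonal_def inner_scaleR_left mult_zero_right)
    then have "(norm (x - z))\<^sup>2 = (norm (x - foot C c x))\<^sup>2 + (norm (foot C c x - z))\<^sup>2"
      using norm_add_Pythagorean[of "x - foot C c x" "foot C c x - z"] by simp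
    then have "(norm (x - foot C c x))\<^sup>2 \<le> (norm (x - z))\<^sup>2" by simp
    then show "dist x (foot C c x) \<le> dist x z" by (simp add: dist_norm)
  qed
qed

lemma side_normal_facet:
  assumes c: "c \<in> C"
  obtains \<sigma> where "\<bar>\<sigma>\<bar> = 1" "side_normal (facet c) = (\<sigma> / norm (bgrad C c)) *\<^sub>R bgrad C c"
proof -
  let ?g = "bgrad C c" and ?S = "facet c"
  have g: "?g \<noteq> 0" by (rule bgrad_nonzero[OF c])
  have "norm ((1 / norm ?g) *\<^sub>R ?g) = 1 \<and> (\<forall>x\<in>?S. \<forall>y\<in>?S. ((1 / norm ?g) *\<^sub>R ?g) \<bullet> (x - y) = 0)"
    using g by (auto simp: facet_bary[OF c] bary_diff[symmetric])
  then have "norm (side_normal ?S) = 1 \<and> (\<forall>x\<in>?S. \<forall>y\<in>?S. side_normal ?S \<bullet> (x - y) = 0)"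
    unfolding side_normal_def by (rule someI)
  then have n: "norm (side_normal ?S) = 1" "\<forall>x\<in>?S. \<forall>y\<in>?S. side_normal ?S \<bullet> (x - y) = 0"
    by auto
  obtain c1 where c1: "c1 \<in> C - {c}" using other_vertex[of c] by auto
  have "side_normal ?S = (side_normal ?S \<bullet> (c - c1)) *\<^sub>R ?g"
    using n(2) c1 by (intro orthogonal_to_facet[OF c c1]) (auto intro: hull_inc)
  then obtain \<alpha> where \<alpha>: "side_normal ?S = \<alpha> *\<^sub>R ?g" by blast
  then have "\<bar>\<alpha> * norm ?g\<bar> = 1" using n(1) by (simp add: abs_mult)
  moreover have "side_normal ?S = ((\<alpha> * norm ?g) / norm ?g) *\<^sub>R ?g" using \<alpha> g by simp
  ultimately show ?thesis by (rule that)
qed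

lemma prism_facet:
  assumes c: "c \<in> C"
  shows "prism (facet c) =
    {x. foot C c x \<in> facet c \<and> \<bar>bary C c x\<bar> \<le> norm (bgrad C c) / 2}"
proof -
  let ?g = "bgrad C c" and ?S = "facet c"
  have g: "?g \<noteq> 0" by (rule bgrad_nonzero[OF c])
  obtain \<sigma> where \<sigma>: "\<bar>\<sigma>\<bar> = 1" "side_normal ?S = (\<sigma> / norm ?g) *\<^sub>R ?g"
    using side_normal_facet[OF c] .
  have gg: "?g \<bullet> ?g = norm ?g * norm ?g" by (simp add: dot_square_norm power2_eq_square)
  show ?thesis
  proof (intro subset_antisym subsetI)
    fix x assume "x \<in> prism ?S"
    then obtain s t where x: "x = s + (t * \<sigma> / norm ?g) *\<^sub>R ?g" "s \<in> ?S" "\<bar>t\<bar> \<le> 1/2"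
      by (auto simp: prism_def \<sigma>)
    have b: "bary C c x = t * \<sigma> * norm ?g"
      using x(2) g unfolding x(1) bary_add by (simp add: facet_bary[OF c] gg)
    have "foot C c x = s"
      unfolding foot_def b using g by (simp add: x(1) gg)
    then show "x \<in> {x. foot C c x \<in> ?S \<and> \<bar>bary C c x\<bar> \<le> norm ?g / 2}"
      using x(2,3) \<sigma>(1) g mult_right_mono[of "\<bar>t\<bar> * 2" 1 "norm ?g"] by (simp add: b abs_mult mult_ac)
  next
    fix x assume x: "x \<in> {x. foot C c x \<in> ?S \<and> \<bar>bary C c x\<bar> \<le> norm ?g / 2}"
    define t where "t = \<sigma> * bary C c x / norm ?g"
    have \<sigma>2: "\<sigma> * \<sigma> = 1" using \<sigma>(1) by (metis abs_mult_self_eq mult_1)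
    have "\<bar>t\<bar> \<le> 1/2"
      using x g \<sigma>(1) by (simp add: t_def abs_mult field_simps)
    moreover have "x = foot C c x + t *\<^sub>R side_normal ?S"
      using \<sigma>2 g by (simp add: foot_def \<sigma>(2) t_def gg mult.assoc[symmetric])
    ultimately show "x \<in> prism ?S" using x unfolding prism_def by blast
  qed
qed

end

section \<open>The volume of a slab over a side\<close>

context full_simplex begin

text \<open>The part of the right cylinder over a side in which the normal coordinate lies in \<open>J\<close>. The normal
  coordinate is \<open>bary C c\<close>, so the unit interval corresponds to the height of the simplex.\<close>

definition slab :: "real^'n \<Rightarrow> real set \<Rightarrow> (real^'n) set" where
  "slab c J = {x. foot C c x \<in> facet c \<and> bary C c x \<in> J}"

lemma compact_facet: "compact (facet c)"
  by (intro finite_imp_compact_convex_hull) simp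

lemma facet_borel [measurable]: "facet c \<in> sets borel"
  using compact_facet compact_imp_closed borel_closed by blast

lemma slab_borel [measurable]:
  assumes [measurable]: "J \<in> sets borel" shows "slab c J \<in> sets borel"
  unfolding slab_def by measurable

lemma bounded_slab:
  assumes "c \<in> C" "bounded J" shows "bounded (slab c J)"
proof -
  obtain B where B: "\<And>x. x \<in> facet c \<Longrightarrow> norm x \<le> B"
    using compact_imp_bounded[OF compact_facet] unfolding bounded_iff by metis
  obtain r where r: "\<And>x. x \<in> J \<Longrightarrow> \<bar>x\<bar> \<le> r" using assms(2) by (auto simp: bounded_iff)
  have "norm x \<le> B + r / (norm (bgrad C c))\<^sup>2 * norm (bgrad C c)" if "x \<in> slab c J" for x
  proof -
    have "x = foot C c x + (bary C c x / (norm (bgrad C c))\<^sup>2) *\<^sub>R bgrad C c"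
      by (simp add: foot_def dot_square_norm)
    then have "norm x \<le> norm (foot C c x) + norm ((bary C c x / (norm (bgrad C c))\<^sup>2) *\<^sub>R bgrad C c)"
      by (metis norm_triangle_ineq)
    also have "\<dots> \<le> B + r / (norm (bgrad C c))\<^sup>2 * norm (bgrad C c)"
      using that B r by (intro add_mono) (auto simp: slab_def intro!: mult_right_mono divide_right_mono)
    finally show ?thesis .
  qed
  then show ?thesis by (auto simp: bounded_iff)
qed

lemma slab_shift:
  assumes "c \<in> C"
  defines "e \<equiv> (1 / (bgrad C c \<bullet> bgrad C c)) *\<^sub>R bgrad C c"
  shows "bary C c (t *\<^sub>R e + x) = t + bary C c x" "foot C c (t *\<^sub>R e + x) = foot C c x"
proof -
  show b: "bary C c (t *\<^sub>R e + x) = t + bary C c x"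
    using bgrad_nonzero[OF assms(1)] bary_add[of C c x "t *\<^sub>R e"] by (simp add: e_def add.commute)
  show "foot C c (t *\<^sub>R e + x) = foot C c x"
    unfolding foot_def b using bgrad_nonzero[OF assms(1)]
    by (simp add: e_def add_divide_distrib scaleR_left_distrib)
qed

text \<open>As a function of \<open>J\<close> the volume of a slab is a translation-invariant measure on the line.\<close>

lemma measure_slab_interval:
  assumes c: "c \<in> C" and "a \<le> b"
  shows "measure lborel (slab c {a..b}) = (b - a) * measure lborel (slab c {0..1})"
proof -
  define Z where "Z = {x. foot C c x \<in> facet c}"
  have [measurable]: "Z \<in> sets borel" unfolding Z_def by measurable
  let ?\<nu> = "distr (restrict_space lborel Z) borel (bary C c)"
  have [measurable]: "bary C c \<in> borel_measurable (restrict_space lborel Z)"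
    by (intro measurable_restrict_space1) measurable
  have \<nu>: "emeasure ?\<nu> J = emeasure lborel (slab c J)" if "J \<in> sets borel" for J
  proof -
    have "emeasure ?\<nu> J = emeasure (restrict_space lborel Z) (bary C c -` J \<inter> Z)"
      using that by (subst emeasure_distr) (auto simp: space_restrict_space)
    also have "\<dots> = emeasure lborel (bary C c -` J \<inter> Z)"
      by (rule emeasure_restrict_space) auto
    also have "bary C c -` J \<inter> Z = slab c J"
      by (auto simp: slab_def Z_def)
    finally show ?thesis .
  qed
  have fin: "sigma_finite_measure ?\<nu>"
  proof
    have "emeasure lborel (slab c {- real n..real n}) \<noteq> \<infinity>" for n
      using emeasure_bounded_finite[OF bounded_slab[OF c]] by (simp add: less_top)
    then show "\<exists>A. countable A \<and> A \<subseteq> sets ?\<nu> \<and> \<Union> A = space ?\<nu> \<and> (\<forall>a\<in>A. emeasure ?\<nu> a \<noteq> \<infinity>)"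
    proof (intro exI[of _ "range (\<lambda>n. {- real n..real n})"] conjI)
      show "(\<Union>n. {- real n..real n}) = space ?\<nu>"
      proof (safe; simp)
        fix x :: real
        obtain n where "\<bar>x\<bar> \<le> real n" using real_arch_simple by blast
        then show "\<exists>n. - real n \<le> x \<and> x \<le> real n" by (intro exI[of _ n]) auto
      qed
    qed (auto simp: \<nu>)
  qed
  define e where "e = (1 / (bgrad C c \<bullet> bgrad C c)) *\<^sub>R bgrad C c"
  have inv: "distr ?\<nu> borel ((+) t) = ?\<nu>" for t
  proof (rule measure_eqI)
    fix J assume "J \<in> sets (distr ?\<nu> borel ((+) t))"
    then have [measurable]: "J \<in> sets borel" by simp
    have J: "(+) t -` J \<in> sets borel" using measurable_sets[of "(+) t" borel borel J] by simp
    have "emeasure (distr ?\<nu> borel ((+) t)) J = emeasure ?\<nu> ((+) t -` J)"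
      by (subst emeasure_distr) auto
    also have "\<dots> = emeasure lborel (slab c ((+) t -` J))" by (rule \<nu>[OF J])
    also have "slab c ((+) t -` J) = (+) (t *\<^sub>R e) -` slab c J"
      using slab_shift[OF c, folded e_def] by (auto simp: slab_def)
    also have "emeasure lborel \<dots> = emeasure (distr lborel borel ((+) (t *\<^sub>R e))) (slab c J)"
      by (subst emeasure_distr) auto
    also have "\<dots> = emeasure ?\<nu> J" by (simp add: lborel_distr_plus \<nu>)
    finally show "emeasure (distr ?\<nu> borel ((+) t)) J = emeasure ?\<nu> J" .
  qed simp
  have "emeasure ?\<nu> {a..b} * emeasure lborel {0..1::real} = emeasure ?\<nu> {0..1} * emeasure lborel {a..b}"
    by (rule translation_invariant_proportional_lborel[OF _ fin inv]) auto
  then have "emeasure lborel (slab c {a..b}) = emeasure lborel (slab c {0..1}) * ennreal (b - a)"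
    using \<open>a \<le> b\<close> by (simp add: \<nu>)
  then show ?thesis
    using \<open>a \<le> b\<close> by (simp add: measure_def enn2real_mult)
qed

lemma prism_slab: "c \<in> C \<Longrightarrow> prism (facet c) = slab c {- norm (bgrad C c) / 2..norm (bgrad C c) / 2}"
  by (auto simp: prism_facet slab_def abs_le_iff)

lemma measure_prism:
  assumes "c \<in> C"
  shows "measure lborel (prism (facet c)) = norm (bgrad C c) * measure lborel (slab c {0..1})"
  using measure_slab_interval[OF assms, of "- norm (bgrad C c) / 2" "norm (bgrad C c) / 2"]
  by (simp add: prism_slab[OF assms])

lemma prism_borel [measurable]: "c \<in> C \<Longrightarrow> prism (facet c) \<in> sets borel"
  by (simp add: prism_slab slab_borel)

lemma measure_lebesgue_homothety:
  "0 \<le> s \<Longrightarrow> s \<le> 1 \<Longrightarrow> vol ((\<lambda>x. (1 - s) *\<^sub>R x + s *\<^sub>R p) ` A) = (1 - s) ^ CARD('n) * vol (A :: (real^'n) set)"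
  using measure_lebesgue_affine[of "1 - s" "s *\<^sub>R p" A] by simp

text \<open>The part of the simplex above level \<open>s\<close> is its image under the homothety with centre \<open>c\<close> and ratio
  \<open>1 - s\<close>.\<close>

lemma measure_simplex_cap:
  assumes c: "c \<in> C" and s: "0 < s" "s < 1"
  shows "vol {x \<in> convex hull C. bary C c x \<le> s} = (1 - (1 - s) ^ CARD('n)) * vol (convex hull C)"
proof -
  let ?T = "convex hull C"
  have T: "compact ?T" by (intro finite_imp_compact_convex_hull) simp
  let ?A = "{x \<in> ?T. bary C c x \<le> s}" and ?B = "{x \<in> ?T. s \<le> bary C c x}"
  have "closed {x. bary C c x \<le> s}" "closed {x. s \<le> bary C c x}"
    by (auto intro!: closed_Collect_le continuous_intros)
  then have "compact (?T \<inter> {x. bary C c x \<le> s})" "compact (?T \<inter> {x. s \<le> bary C c x})"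
    using T by (auto intro: compact_Int_closed)
  then have meas: "?A \<in> lmeasurable" "?B \<in> lmeasurable"
    by (auto simp: Int_def lmeasurable_compact)
  have B: "?B = (\<lambda>x. (1 - s) *\<^sub>R x + s *\<^sub>R c) ` ?T"
  proof (intro subset_antisym subsetI)
    fix x assume x: "x \<in> ?B"
    let ?y = "(1 / (1 - s)) *\<^sub>R (x - s *\<^sub>R c)"
    have eq: "x = (1 - s) *\<^sub>R ?y + s *\<^sub>R c" using s by simp
    have "bary C v x = (1 - s) * bary C v ?y + s * bary C v c" for v
      using bary_combine[of C v s ?y c] eq by simp
    then have "bary C v ?y = (bary C v x - s * bary C v c) / (1 - s)" for v
      using s by (simp add: field_simps)
    then have "?y \<in> ?T"
      using x s c by (auto simp: convex_hull_bary bary_vertex)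
    then show "x \<in> (\<lambda>x. (1 - s) *\<^sub>R x + s *\<^sub>R c) ` ?T" using eq by (rule_tac image_eqI)
  next
    fix x assume "x \<in> (\<lambda>x. (1 - s) *\<^sub>R x + s *\<^sub>R c) ` ?T"
    then show "x \<in> ?B" using s c by (auto simp: bary_combine convex_hull_bary bary_vertex)
  qed
  have "negligible (?A \<inter> ?B)"
  proof (rule negligible_subset)
    show "negligible {x. bgrad C c \<bullet> x = s - 1 + bgrad C c \<bullet> c}"
      using bgrad_nonzero[OF c] by (intro negligible_hyperplane) auto
  qed (auto simp: bary_def inner_diff_right)
  then have "vol (?A \<union> ?B) = vol ?A + vol ?B"
    by (simp add: measure_Un3[OF meas] negligible_imp_measure0)
  moreover have "?A \<union> ?B = ?T" by auto
  moreover have "vol ?B = (1 - s) ^ CARD('n) * vol ?T"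
    unfolding B using s by (intro measure_lebesgue_homothety) auto
  ultimately show ?thesis by (simp add: algebra_simps)
qed

lemma lebesgue_eq_lborel: "A \<in> sets borel \<Longrightarrow> vol A = measure lborel A" for A :: "(real^'n) set"
  by (simp add: measure_completion)

text \<open>This is the formula "base times height divided by the dimension" for the volume of a simplex. A shear
  parallel to the side moves the apex to the point vertically above another vertex \<open>p\<close>; the
  cross-sections of the sheared simplex then shrink towards \<open>p\<close> and lie over the side. Its layer of
  height \<open>s\<close> lies in the slab of height \<open>s\<close> and contains the image of that slab under the homothety
  with centre \<open>p\<close> and ratio \<open>1 - s\<close>. Dividing the volumes by \<open>s\<close> and letting \<open>s\<close> tend to zero gives the
  claim.\<close>

lemma measure_slab_simplex:
  assumes c: "c \<in> C"
  shows "measure lborel (slab c {0..1}) = CARD('n) * vol (convex hull C)"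
proof -
  let ?T = "convex hull C" and ?Q = "measure lborel (slab c {0..1})" and ?g = "bgrad C c"
  obtain p where p: "p \<in> C" "p \<noteq> c" using other_vertex[of c] .
  define e where "e = (1 / (?g \<bullet> ?g)) *\<^sub>R ?g"
  \<comment> \<open>With \<open>e\<close> the unit step of the normal coordinate, adding \<open>u\<close> at level one takes the apex \<open>c\<close> to \<open>p + e\<close>.\<close>
  define u where "u = e - (c - p)"
  have g: "?g \<noteq> 0" by (rule bgrad_nonzero[OF c])
  have ge: "?g \<bullet> e = 1" using g by (simp add: e_def)
  have gu: "?g \<bullet> u = 0"
    using bgrad_inner_diff[OF c c p(1)] p by (simp add: u_def inner_diff_right[of _ e] ge)
  define G where "G = (\<lambda>x. x + (?g \<bullet> x + (1 - ?g \<bullet> c)) *\<^sub>R u)"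
  have G: "G x = x + bary C c x *\<^sub>R u" for x
    by (simp add: G_def bary_def inner_diff_right algebra_simps)
  have dG: "distr lborel borel G = lborel"
    unfolding G_def using gu g by (rule shear_distr_lborel)
  have [measurable]: "G \<in> borel_measurable borel" unfolding G_def by measurable
  have mG: "measure lborel (G -` A) = measure lborel A" if "A \<in> sets borel" for A
    using measure_distr[of G lborel borel A] that by (simp add: dG)
  have bG: "bary C c (G x) = bary C c x" for x
    by (simp add: G bary_add gu)
  have fG: "foot C c (G x) = x + bary C c x *\<^sub>R (p - c)" for x
    unfolding foot_def bG by (simp add: G u_def e_def algebra_simps)
  have bfG: "bary C v (foot C c (G x)) = bary C v x + bary C c x * ((if v = p then 1 else 0) - (if v = c then 1 else 0))"
    if "v \<in> C" for v x
    using that bgrad_inner_diff[OF that p(1) c] unfolding fG bary_add by auto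
  have upper: "vol {x \<in> ?T. bary C c x \<le> s} \<le> s * ?Q" if s: "0 < s" "s < 1" for s
  proof -
    have sub: "{x \<in> ?T. bary C c x \<le> s} \<subseteq> G -` slab c {0..s}"
      using c p by (auto simp: slab_def bG facet_bary[OF c] bfG convex_hull_bary)
    have Gm: "G -` slab c {0..s} \<in> sets borel"
      using measurable_sets[of G borel borel "slab c {0..s}"] by simp
    have "vol {x \<in> ?T. bary C c x \<le> s} = measure lborel {x \<in> ?T. bary C c x \<le> s}"
      by (intro lebesgue_eq_lborel) (simp add: convex_hull_bary)
    also have "\<dots> \<le> measure lborel (G -` slab c {0..s})"
    proof (rule measure_mono_fmeasurable[OF sub])
      have "emeasure lborel (G -` slab c {0..s}) = emeasure lborel (slab c {0..s})"
        using emeasure_distr[of G lborel borel "slab c {0..s}"] by (simp add: dG)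
      then show "G -` slab c {0..s} \<in> fmeasurable lborel"
        using Gm emeasure_bounded_finite[OF bounded_slab[OF c]] by (auto intro!: fmeasurableI)
    qed (simp add: convex_hull_bary)
    also have "\<dots> = s * ?Q"
      using mG[of "slab c {0..s}"] measure_slab_interval[OF c, of 0 s] s by simp
    finally show ?thesis .
  qed
  have lower: "(1 - s) ^ CARD('n) * (s * ?Q) \<le> vol {x \<in> ?T. bary C c x \<le> s}" if s: "0 < s" "s < 1" for s
  proof -
    let ?H = "\<lambda>x. (1 - s) *\<^sub>R x + s *\<^sub>R p" and ?H' = "\<lambda>x. (1 / (1 - s)) *\<^sub>R (x - s *\<^sub>R p)"
    have HH: "?H (?H' x) = x" for x using s by simp
    have HH': "?H' (?H x) = x" for x using s by simp
    have img: "?H ` slab c {0..s} = ?H' -` slab c {0..s}"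
      using HH HH' by (auto simp: image_iff) (metis HH)
    have Hm: "?H ` slab c {0..s} \<in> sets borel"
      unfolding img using measurable_sets[of ?H' borel borel "slab c {0..s}"] by simp
    have Gm: "G -` (?H ` slab c {0..s}) \<in> sets borel"
      using measurable_sets[OF _ Hm, of G borel] by simp
    have fH: "foot C c (?H y) = ?H (foot C c y)" for y
    proof -
      have b: "bary C c (?H y) = (1 - s) * bary C c y"
        using bary_vertex[OF c p(1)] p by (simp add: bary_combine)
      show ?thesis unfolding foot_def b by (simp add: scaleR_right_diff_distrib)
    qed
    have sub: "G -` (?H ` slab c {0..s}) \<subseteq> {x \<in> ?T. bary C c x \<le> s}"
    proof (rule subsetI)
      fix x assume "x \<in> G -` (?H ` slab c {0..s})"
      then obtain y where y: "G x = ?H y" "foot C c y \<in> facet c" "0 \<le> bary C c y" "bary C c y \<le> s"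
        by (auto simp: slab_def)
      have bx: "bary C c x = (1 - s) * bary C c y"
        using bG[of x] bary_vertex[OF c p(1)] p by (simp add: y(1) bary_combine)
      have bx': "bary C c x \<le> s"
        using mult_mono[of "1 - s" 1 "bary C c y" s] s y by (simp add: bx)
      have f: "foot C c (G x) = ?H (foot C c y)" unfolding y(1) by (rule fH)
      have "0 \<le> bary C v x" if v: "v \<in> C" for v
      proof -
        consider "v = c" | "v = p" | "v \<noteq> c" "v \<noteq> p" by blast
        then show ?thesis
        proof cases
          case 1 then show ?thesis using y s by (simp add: bx)
        next
          case 2
          have "bary C p x = (1 - s) * bary C p (foot C c y) + s - bary C c x"
            using bfG[OF p(1), of x] p unfolding f by (simp add: bary_combine bary_vertex)
          moreover have "0 \<le> (1 - s) * bary C p (foot C c y)"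
            using y(2) p s by (simp add: facet_bary[OF c])
          ultimately show ?thesis using 2 bx' by simp
        next
          case 3
          have "bary C v x = (1 - s) * bary C v (foot C c y)"
            using bfG[OF v, of x] 3 v p unfolding f by (simp add: bary_combine bary_vertex)
          then show ?thesis using y(2) 3 v s by (simp add: facet_bary[OF c])
        qed
      qed
      then show "x \<in> {x \<in> ?T. bary C c x \<le> s}" using bx' by (simp add: convex_hull_bary)
    qed
    have "(1 - s) ^ CARD('n) * (s * ?Q) = (1 - s) ^ CARD('n) * vol (slab c {0..s})"
      using measure_slab_interval[OF c, of 0 s] s by (simp add: lebesgue_eq_lborel)
    also have "\<dots> = vol (?H ` slab c {0..s})"
      using s by (intro measure_lebesgue_homothety[symmetric]) auto
    also have "\<dots> = measure lborel (G -` (?H ` slab c {0..s}))"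
      using mG[OF Hm] Hm by (simp add: lebesgue_eq_lborel)
    also have "\<dots> \<le> measure lborel {x \<in> ?T. bary C c x \<le> s}"
    proof (rule measure_mono_fmeasurable[OF sub])
      have "bounded {x \<in> ?T. bary C c x \<le> s}"
        by (rule bounded_subset[of ?T]) (auto intro!: compact_imp_bounded finite_imp_compact_convex_hull)
      then show "{x \<in> ?T. bary C c x \<le> s} \<in> fmeasurable lborel"
        using emeasure_bounded_finite by (auto intro!: fmeasurableI simp: convex_hull_bary)
    qed (use Gm in simp)
    also have "\<dots> = vol {x \<in> ?T. bary C c x \<le> s}"
      by (intro lebesgue_eq_lborel[symmetric]) (simp add: convex_hull_bary)
    finally show ?thesis .
  qed
  \<comment> \<open>The volume of the layer is \<open>s\<close> times a polynomial, so \<open>s\<close> can be cancelled before passing to the limit.\<close>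
  let ?h = "\<lambda>s::real. (\<Sum>i<CARD('n). (1 - s) ^ i) * vol ?T"
  have cap: "vol {x \<in> ?T. bary C c x \<le> s} = s * ?h s" if "0 < s" "s < 1" for s
    using measure_simplex_cap[OF c that] one_diff_power_eq[of "1 - s" "CARD('n)"] by simp
  have ev: "eventually (\<lambda>s::real. 0 < s \<and> s < 1) (at_right 0)"
    unfolding eventually_at_right_field by (intro exI[of _ 1]) auto
  have lim: "(?h \<longlongrightarrow> CARD('n) * vol ?T) (at_right 0)"
    by (rule tendsto_eq_intros refl | simp)+
  have "eventually (\<lambda>s. ?h s \<le> ?Q) (at_right 0)"
    using ev upper cap by (auto elim!: eventually_mono)
  then have "CARD('n) * vol ?T \<le> ?Q"
    using lim by (intro tendsto_upperbound[OF lim]) auto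
  moreover have "eventually (\<lambda>s. (1 - s) ^ CARD('n) * ?Q \<le> ?h s) (at_right 0)"
    using ev
  proof eventually_elim
    case (elim s)
    then have "s * ((1 - s) ^ CARD('n) * ?Q) \<le> s * ?h s" using lower[of s] cap[of s] by (simp add: mult_ac)
    then show ?case using elim by (simp add: mult_le_cancel_left_pos)
  qed
  moreover have "((\<lambda>s::real. (1 - s) ^ CARD('n) * ?Q) \<longlongrightarrow> ?Q) (at_right 0)"
    by (rule tendsto_eq_intros refl | simp)+
  ultimately show ?thesis
    using tendsto_le[OF _ lim, of "\<lambda>s::real. (1 - s) ^ CARD('n) * ?Q" ?Q] by (intro antisym) auto
qed

end

section \<open>Integrals over sides and the divergence theorem on a simplex\<close>

text \<open>In a complete measure space measurability passes to almost everywhere equal functions. This is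
  needed because discrete functions are arbitrary on the null sets where elements or sides meet, and a
  nonmeasurable integrand would have integral zero by convention.\<close>

lemma (in complete_measure) integral_cong_AE_complete:
  fixes f g :: "'a \<Rightarrow> 'b::{banach, second_countable_topology}"
  assumes g: "g \<in> borel_measurable M" and eq: "AE x in M. f x = g x"
  shows "f \<in> borel_measurable M" "integral\<^sup>L M f = integral\<^sup>L M g"
proof -
  show f: "f \<in> borel_measurable M"
  proof (rule measurableI)
    fix Y :: "'b set" assume "Y \<in> sets borel"
    then have "g -` Y \<inter> space M \<in> sets M" using g by (rule measurable_sets[rotated])
    moreover have "AE x in M. x \<in> g -` Y \<inter> space M \<longleftrightarrow> x \<in> f -` Y \<inter> space M"
      using eq by eventually_elim simp
    ultimately show "f -` Y \<inter> space M \<in> sets M"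
      using in_sets_AE by blast
  qed simp
  show "integral\<^sup>L M f = integral\<^sup>L M g"
    by (rule integral_cong_AE[OF f g eq])
qed

lemma AE_const_space_nonnull:
  assumes "AE x in M. P" "measure M (space M) \<noteq> 0" shows P
proof (rule ccontr)
  assume "\<not> P"
  with assms(1) have "AE x in M. False" by auto
  then have "emeasure M (space M) = 0" by (auto simp: AE_iff_null)
  with assms(2) show False by (simp add: measure_def)
qed

context full_simplex begin

lemma side_measure_facet:
  "c \<in> C \<Longrightarrow> side_measure (facet c) = completion (distr (restrict_space lborel (prism (facet c))) borel (foot C c))"
proof -
  assume "c \<in> C"
  then have "closest_point (affine hull (facet c)) = foot C c"
    by (intro ext closest_point_facet)
  then show ?thesis unfolding side_measure_def by (rule arg_cong)
qed

lemma prism_measurable_foot: 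
  "foot C c \<in> borel_measurable (restrict_space lborel (prism (facet c)))"
  by (intro measurable_restrict_space1) measurable

lemma integral_side_measure:
  assumes c: "c \<in> C" and [measurable]: "w \<in> borel_measurable borel"
  shows "(LINT x|side_measure (facet c). w x) =
    (LINT x|lborel. indicator (prism (facet c)) x * (w (foot C c x) :: real))"
  unfolding side_measure_facet[OF c]
  using prism_measurable_foot[of c] prism_borel[OF c]
  by (simp add: integral_completion integral_distr integral_restrict_space)

lemma set_integral_side_measure:
  assumes c: "c \<in> C" and [measurable]: "v \<in> borel_measurable borel" and eq: "\<And>x. x \<in> facet c \<Longrightarrow> w x = v x"
  shows "(LINT x:facet c|side_measure (facet c). w x) =
    (LINT x|lborel. indicator (prism (facet c)) x * (v (foot C c x) :: real))"
proof -
  have "(LINT x:facet c|side_measure (facet c). w x) = (LINT x|side_measure (facet c). indicator (facet c) x * v x)"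
    unfolding set_lebesgue_integral_def by (intro Bochner_Integration.integral_cong) (auto simp: indicator_def eq)
  also have "\<dots> = (LINT x|lborel. indicator (prism (facet c)) x * (indicator (facet c) (foot C c x) * v (foot C c x)))"
    by (rule integral_side_measure[OF c]) measurable
  also have "\<dots> = (LINT x|lborel. indicator (prism (facet c)) x * v (foot C c x))"
    by (intro Bochner_Integration.integral_cong) (auto simp: indicator_def prism_facet[OF c])
  finally show ?thesis .
qed

lemma bary_foot:
  "bary C v (foot C c x) = bary C v x - bary C c x * ((bgrad C v \<bullet> bgrad C c) / (bgrad C c \<bullet> bgrad C c))"
  using bary_add[of C v x "- (bary C c x / (bgrad C c \<bullet> bgrad C c)) *\<^sub>R bgrad C c"] by (simp add: foot_def)

lemma prism_foot: "c \<in> C \<Longrightarrow> x \<in> prism (facet c) \<Longrightarrow> foot C c x \<in> facet c"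
  by (simp add: prism_facet)

lemma facet_bary_nonneg: "c \<in> C \<Longrightarrow> x \<in> facet c \<Longrightarrow> v \<in> C - {c} \<Longrightarrow> 0 \<le> bary C v x"
  by (simp add: facet_bary)

text \<open>The affine involution \<open>B\<close> moves points parallel to the side, exchanges the vertices \<open>c1\<close> and \<open>c2\<close> of the
  side and fixes the others. It preserves Lebesgue measure and the prism.\<close>

lemma swap_vertices_integral:
  assumes c: "c \<in> C" and c1: "c1 \<in> C - {c}" and c2: "c2 \<in> C - {c}" and "c1 \<noteq> c2"
  shows "(LINT x|lborel. indicator (prism (facet c)) x * bary C c1 (foot C c x)) =
    (LINT x|lborel. indicator (prism (facet c)) x * bary C c2 (foot C c x))"
proof -
  let ?g = "bgrad C c"
  define m where "m = (bgrad C c1 - bgrad C c2) - (((bgrad C c1 - bgrad C c2) \<bullet> ?g) / (?g \<bullet> ?g)) *\<^sub>R ?g"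
  define \<mu> where "\<mu> x = bary C c1 (foot C c x) - bary C c2 (foot C c x)" for x
  have \<mu>_diff: "\<mu> y - \<mu> x = m \<bullet> (y - x)" for x y
    unfolding \<mu>_def bary_foot unfolding m_def bary_def
    by (simp add: inner_diff_left inner_diff_right diff_divide_distrib add_divide_distrib algebra_simps)
  define \<alpha> where "\<alpha> = \<mu> 0"
  have \<mu>: "\<mu> x = m \<bullet> x + \<alpha>" for x using \<mu>_diff[of x 0] by (simp add: \<alpha>_def)
  have gc: "?g \<bullet> (c2 - c1) = 0" using bgrad_inner_diff[OF c, of c2 c1] c1 c2 by auto
  have m: "m \<bullet> (c2 - c1) = - 2"
  proof -
    have "bgrad C c1 \<bullet> (c2 - c1) = - 1" "bgrad C c2 \<bullet> (c2 - c1) = 1"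
      using bgrad_inner_diff[of c1 c2 c1] bgrad_inner_diff[of c2 c2 c1] c1 c2 assms(4) by auto
    then show ?thesis using gc by (simp add: m_def inner_diff_left)
  qed
  define B where "B x = x + \<mu> x *\<^sub>R (c2 - c1)" for x
  have dB: "distr lborel borel B = lborel"
    unfolding B_def \<mu> by (rule skew_reflection_distr_lborel[OF m])
  have [measurable]: "B \<in> borel_measurable borel" unfolding B_def \<mu> by measurable
  have bB: "bary C c (B x) = bary C c x" for x by (simp add: B_def bary_add gc)
  have fB: "foot C c (B x) = foot C c x + \<mu> x *\<^sub>R (c2 - c1)" for x
    unfolding foot_def bB by (simp add: B_def)
  have bf: "bary C v (foot C c (B x)) = bary C v (foot C c x) + \<mu> x * (bgrad C v \<bullet> (c2 - c1))" for v x
    by (simp add: fB bary_add)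
  have bf1: "bary C c1 (foot C c (B x)) = bary C c2 (foot C c x)" for x
    using bgrad_inner_diff[of c1 c2 c1] c1 c2 assms(4) by (simp add: bf) (simp add: \<mu>_def)
  have bf2: "bary C c2 (foot C c (B x)) = bary C c1 (foot C c x)" for x
    using bgrad_inner_diff[of c2 c2 c1] c1 c2 assms(4) by (simp add: bf) (simp add: \<mu>_def)
  have bfo: "bary C v (foot C c (B x)) = bary C v (foot C c x)" if "v \<in> C" "v \<noteq> c1" "v \<noteq> c2" for v x
    using bgrad_inner_diff[OF that(1), of c2 c1] c1 c2 that by (simp add: bf)
  have all: "(\<forall>v\<in>C - {c}. 0 \<le> bary C v (foot C c (B x))) \<longleftrightarrow> (\<forall>v\<in>C - {c}. 0 \<le> bary C v (foot C c x))" for x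
    using bf1[of x] bf2[of x] bfo[of _ x] c1 c2 by (metis DiffD1)
  have pB: "B x \<in> prism (facet c) \<longleftrightarrow> x \<in> prism (facet c)" for x
    unfolding prism_facet[OF c] using all[of x] by (simp add: bB facet_bary[OF c] foot_bary[OF c])
  note [measurable] = prism_borel[OF c]
  let ?h = "\<lambda>x. indicator (prism (facet c)) x * bary C c1 (foot C c x)"
  have "(LINT x|lborel. ?h x) = (LINT x|distr lborel borel B. ?h x)" by (simp add: dB)
  also have "\<dots> = (LINT x|lborel. ?h (B x))" by (rule integral_distr) measurable
  finally show ?thesis by (simp add: bf1 pB indicator_def)
qed

text \<open>The coordinates of the vertices of a side add up to one there and have equal integrals, so each
  integral is the volume of the prism divided by the dimension, which cancels the factor from
  \<open>measure_slab_simplex\<close>.\<close>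

lemma integral_facet_bary:
  assumes c: "c \<in> C" and c1: "c1 \<in> C - {c}"
  shows "(LINT x|lborel. indicator (prism (facet c)) x * bary C c1 (foot C c x)) =
    norm (bgrad C c) * vol (convex hull C)"
    (is "?I c1 = _")
    and "integrable lborel (\<lambda>x. indicator (prism (facet c)) x * bary C c1 (foot C c x))"
proof -
  let ?P = "prism (facet c)"
  note [measurable] = prism_borel[OF c]
  have Pb: "bounded ?P" unfolding prism_slab[OF c] by (rule bounded_slab[OF c]) simp
  have Pf: "emeasure lborel ?P < \<infinity>" using emeasure_bounded_finite[OF Pb] .
  have int: "integrable lborel (\<lambda>x. indicator ?P x * bary C v (foot C c x))" if v: "v \<in> C - {c}" for v
  proof -
    have le1: "bary C v (foot C c x) \<le> 1" if "x \<in> ?P" for x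
    proof -
      have "bary C v (foot C c x) \<le> (\<Sum>u\<in>C. bary C u (foot C c x))"
      proof (rule member_le_sum)
        show "v \<in> C" using v by simp
        fix u assume "u \<in> C - {v}"
        then show "0 \<le> bary C u (foot C c x)"
          using prism_foot[OF c that] by (cases "u = c") (auto simp: facet_bary[OF c])
      qed simp
      then show ?thesis by (simp add: sum_bary)
    qed
    have "norm (indicator ?P x * bary C v (foot C c x)) \<le> norm (indicat_real ?P x)" for x
      using le1[of x] v prism_foot[OF c, of x] by (auto simp: indicator_def facet_bary[OF c])
    moreover have "integrable lborel (indicat_real ?P)"
      using Pf by (intro integrable_real_indicator) auto
    ultimately show ?thesis
      by (rule_tac Bochner_Integration.integrable_bound) auto
  qed
  from int[OF c1] show "integrable lborel (\<lambda>x. indicator ?P x * bary C c1 (foot C c x))" .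
  have "(\<Sum>v\<in>C - {c}. ?I v) = (LINT x|lborel. (\<Sum>v\<in>C - {c}. indicator ?P x * bary C v (foot C c x)))"
    by (rule Bochner_Integration.integral_sum[symmetric]) (rule int)
  also have "\<dots> = (LINT x|lborel. indicator ?P x)"
  proof (rule Bochner_Integration.integral_cong)
    fix x
    have "(\<Sum>v\<in>C - {c}. bary C v (foot C c x)) = 1"
      using sum_bary[of "foot C c x"] c by (simp add: sum.remove[of C c] foot_bary[OF c])
    then show "(\<Sum>v\<in>C - {c}. indicator ?P x * bary C v (foot C c x)) = indicator ?P x"
      by (simp add: sum_distrib_left[symmetric])
  qed simp
  also have "\<dots> = measure lborel ?P" by simp
  also have "\<dots> = CARD('n) * (norm (bgrad C c) * vol (convex hull C))"
    by (simp add: measure_prism[OF c] measure_slab_simplex[OF c])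
  also have "(\<Sum>v\<in>C - {c}. ?I v) = (\<Sum>v\<in>C - {c}. ?I c1)"
  proof (rule sum.cong)
    fix v assume "v \<in> C - {c}"
    then show "?I v = ?I c1" using swap_vertices_integral[OF c c1, of v] by (cases "v = c1") auto
  qed simp
  also have "\<dots> = CARD('n) * ?I c1"
    using c card by (simp add: card_Diff_singleton)
  finally show "?I c1 = norm (bgrad C c) * vol (convex hull C)" by simp
qed

lemma set_integral_facet_affine:
  assumes c: "c \<in> C" and w: "\<And>x. x \<in> facet c \<Longrightarrow> w x = a \<bullet> x + k"
  shows "(LINT x:facet c|side_measure (facet c). w x) =
    norm (bgrad C c) * vol (convex hull C) * (\<Sum>v\<in>C - {c}. a \<bullet> v + k)"
proof -
  let ?P = "prism (facet c)"
  have "(LINT x:facet c|side_measure (facet c). w x) = (LINT x|lborel. indicator ?P x * (a \<bullet> foot C c x + k))"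
    by (rule set_integral_side_measure[OF c _ w]) auto
  also have "\<dots> = (LINT x|lborel. (\<Sum>v\<in>C - {c}. indicator ?P x * bary C v (foot C c x) * (a \<bullet> v + k)))"
  proof (rule Bochner_Integration.integral_cong)
    fix x
    let ?y = "foot C c x"
    have "a \<bullet> ?y + k = a \<bullet> (\<Sum>v\<in>C. bary C v ?y *\<^sub>R v) + k * (\<Sum>v\<in>C. bary C v ?y)"
      by (simp add: bary_representation sum_bary)
    also have "\<dots> = (\<Sum>v\<in>C. bary C v ?y * (a \<bullet> v + k))"
      by (simp add: inner_sum_right sum_distrib_left distrib_left sum.distrib mult.commute[of k])
    also have "\<dots> = (\<Sum>v\<in>C - {c}. bary C v ?y * (a \<bullet> v + k))"
      using c by (simp add: sum.remove[of C c] foot_bary[OF c])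
    finally show "indicator ?P x * (a \<bullet> ?y + k) = (\<Sum>v\<in>C - {c}. indicator ?P x * bary C v ?y * (a \<bullet> v + k))"
      by (simp add: sum_distrib_left mult.assoc)
  qed simp
  also have "\<dots> = (\<Sum>v\<in>C - {c}. (LINT x|lborel. indicator ?P x * bary C v (foot C c x)) * (a \<bullet> v + k))"
    using integral_facet_bary(2)[OF c] by (subst Bochner_Integration.integral_sum) auto
  also have "\<dots> = norm (bgrad C c) * vol (convex hull C) * (\<Sum>v\<in>C - {c}. a \<bullet> v + k)"
    using integral_facet_bary(1)[OF c] by (simp add: sum_distrib_left)
  finally show ?thesis .
qed

lemma set_integral_facet_diff:
  assumes c: "c \<in> C" and "\<And>x. x \<in> facet c \<Longrightarrow> w x = a \<bullet> x + k" "\<And>x. x \<in> facet c \<Longrightarrow> w' x = a' \<bullet> x + k'"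
  shows "(LINT x:facet c|side_measure (facet c). w x - w' x) =
    (LINT x:facet c|side_measure (facet c). w x) - (LINT x:facet c|side_measure (facet c). w' x)"
proof -
  have "(LINT x:facet c|side_measure (facet c). w x - w' x) =
    norm (bgrad C c) * vol (convex hull C) * (\<Sum>v\<in>C - {c}. (a - a') \<bullet> v + (k - k'))"
    by (rule set_integral_facet_affine[OF c]) (simp add: assms inner_diff_left)
  then show ?thesis
    by (simp add: set_integral_facet_affine[OF c assms(2)] set_integral_facet_affine[OF c assms(3)]
        inner_diff_left algebra_simps sum.distrib sum_subtractf)
qed

lemma simplex_lmeasurable: "convex hull C \<in> lmeasurable"
  by (intro lmeasurable_compact finite_imp_compact_convex_hull) simp

lemma interior_nonempty: "interior (convex hull C) \<noteq> {}"
proof -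
  have "interior (convex hull C) = rel_interior (convex hull C)"
    by (simp add: rel_interior_interior affine_hull_vertices)
  moreover have "C \<noteq> {}" using card by auto
  ultimately show ?thesis by (simp add: rel_interior_eq_empty)
qed

lemma simplex_measure_pos: "0 < vol (convex hull C)"
proof -
  have "\<not> negligible (convex hull C)"
    using interior_nonempty negligible_convex_interior[of "convex hull C"] by simp
  then show ?thesis
    using simplex_lmeasurable by (metis measure_nonneg less_eq_real_def measure_eq_0_null_sets negligible_iff_measure)
qed

lemma measure_side_facet:
  assumes c: "c \<in> C"
  shows "measure (side_measure (facet c)) (facet c) = CARD('n) * norm (bgrad C c) * vol (convex hull C)"
    and "measure (side_measure (facet c)) UNIV = measure (side_measure (facet c)) (facet c)"
proof -
  have "measure (side_measure (facet c)) A = measure lborel (prism (facet c))" if "facet c \<subseteq> A" "A \<in> sets borel" for A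
  proof -
    have "measure (side_measure (facet c)) A = measure (distr (restrict_space lborel (prism (facet c))) borel (foot C c)) A"
      unfolding side_measure_facet[OF c] using that by simp
    also have "\<dots> = measure (restrict_space lborel (prism (facet c))) (foot C c -` A \<inter> prism (facet c))"
      using that prism_measurable_foot by (subst measure_distr) (auto simp: space_restrict_space)
    also have "foot C c -` A \<inter> prism (facet c) = prism (facet c)"
      using that by (auto simp: prism_facet[OF c])
    finally show ?thesis
      using prism_borel[OF c] by (simp add: measure_restrict_space)
  qed
  from this[of "facet c"] this[of UNIV]
  show "measure (side_measure (facet c)) (facet c) = CARD('n) * norm (bgrad C c) * vol (convex hull C)"
    "measure (side_measure (facet c)) UNIV = measure (side_measure (facet c)) (facet c)"
    by (auto simp: measure_prism[OF c] measure_slab_simplex[OF c])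
qed

lemma measure_side_facet_pos:
  "c \<in> C \<Longrightarrow> 0 < measure (side_measure (facet c)) (facet c)"
  using simplex_measure_pos by (simp add: measure_side_facet bgrad_nonzero)

lemma space_side_measure [simp]: "space (side_measure S) = UNIV" for S :: "(real^'n) set"
  by (simp add: side_measure_def)

text \<open>A point is projected into the relative boundary of the side only if it lies on one of finitely many
  hyperplanes.\<close>

lemma AE_side_rel_interior:
  assumes c: "c \<in> C"
  shows "AE x in side_measure (facet c). x \<in> rel_interior (facet c)"
proof -
  let ?g = "bgrad C c"
  note [measurable] = prism_borel[OF c]
  have neg: "AE x in lborel. bary C v (foot C c x) \<noteq> 0" if v: "v \<in> C - {c}" for v
  proof -
    define m where "m = bgrad C v - ((bgrad C v \<bullet> ?g) / (?g \<bullet> ?g)) *\<^sub>R ?g"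
    define b where "b = - bary C v (foot C c 0)"
    have eq: "bary C v (foot C c x) = m \<bullet> x - b" for x
      unfolding b_def bary_foot unfolding m_def bary_def
      by (simp add: inner_diff_left inner_diff_right diff_divide_distrib add_divide_distrib algebra_simps)
    have "foot C c v = v" by (rule foot_on_facet) (use v c in \<open>simp add: bary_vertex\<close>)
    then have "m \<bullet> v - b = 1" using v eq[of v] by (simp add: bary_vertex)
    then have "m \<noteq> 0 \<or> b \<noteq> 0" by auto
    then have "negligible {x. m \<bullet> x = b}" by (rule negligible_hyperplane)
    then have "AE x in lebesgue. bary C v (foot C c x) \<noteq> 0"
      unfolding negligible_iff_null_sets eq by (rule AE_I') auto
    then show ?thesis by (simp add: AE_completion_iff)
  qed
  have "AE x in lborel. \<forall>v\<in>C - {c}. bary C v (foot C c x) \<noteq> 0"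
    by (rule AE_finite_allI) (auto intro: neg)
  then have "AE x in lborel. x \<in> prism (facet c) \<longrightarrow> foot C c x \<in> rel_interior (facet c)"
  proof eventually_elim
    case (elim x)
    have "0 < bary C v (foot C c x)" if "x \<in> prism (facet c)" "v \<in> C - {c}" for v
      using elim that facet_bary_nonneg[OF c prism_foot[OF c that(1)] that(2)] by (simp add: less_le)
    then show ?case
      unfolding facet_rel_interior_bary[OF c] using foot_bary[OF c, of x] by blast
  qed
  moreover have "{x. x \<in> rel_interior (facet c)} \<in> sets borel"
    unfolding facet_rel_interior_bary[OF c] by simp
  ultimately show ?thesis
    unfolding side_measure_facet[OF c] using prism_measurable_foot[of c]
    by (simp add: AE_completion_iff AE_distr_iff AE_restrict_space_iff)
qed

lemma integral_side_AE_const: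
  assumes c: "c \<in> C" and "\<And>x. x \<in> rel_interior (facet c) \<Longrightarrow> h x = (k :: real)"
  shows "(LINT x|side_measure (facet c). h x) = k * measure (side_measure (facet c)) (facet c)"
proof -
  have "AE x in side_measure (facet c). h x = k"
    using AE_side_rel_interior[OF c] by eventually_elim (rule assms(2))
  then have "(LINT x|side_measure (facet c). h x) = (LINT x|side_measure (facet c). k)"
    unfolding side_measure_facet[OF c] by (intro completion.integral_cong_AE_complete(2)) auto
  also have "\<dots> = k * measure (side_measure (facet c)) UNIV" by simp
  finally show ?thesis by (simp add: measure_side_facet(2)[OF c])
qed

text \<open>Let \<open>g\<^sub>c\<close> be the gradients of the barycentric coordinates and \<open>s\<close> the sum of the values of \<open>w\<close> at the vertices. The
  side opposite to \<open>c\<close> contributes \<open>(a \<bullet> g\<^sub>c) (w(c) - s)\<close> times the volume. The sum over \<open>c\<close> loses the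
  constant terms because the \<open>g\<^sub>c\<close> add up to zero, and the linear part of \<open>w\<close> is recovered from the
  representation of \<open>a\<close> as the sum of \<open>(a \<bullet> g\<^sub>c) c\<close>.\<close>

theorem divergence_simplex_constant_field:
  assumes w: "\<And>c x. c \<in> C \<Longrightarrow> x \<in> facet c \<Longrightarrow> w x = m \<bullet> x + k"
  shows "(\<Sum>c\<in>C. (a \<bullet> normal c) * (LINT x:facet c|side_measure (facet c). w x))
    = vol (convex hull C) * (a \<bullet> m)"
proof -
  let ?M = "vol (convex hull C)" and ?s = "\<Sum>v\<in>C. m \<bullet> v + k"
  have "(a \<bullet> normal c) * (LINT x:facet c|side_measure (facet c). w x)
      = ?M * ((bgrad C c \<bullet> a) * (m \<bullet> c)) + ?M * (k - ?s) * (bgrad C c \<bullet> a)" if c: "c \<in> C" for c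
  proof -
    have "(\<Sum>v\<in>C - {c}. m \<bullet> v + k) = ?s - (m \<bullet> c + k)"
      using c by (simp add: sum_diff1)
    then have "(LINT x:facet c|side_measure (facet c). w x) = norm (bgrad C c) * ?M * (?s - (m \<bullet> c + k))"
      using set_integral_facet_affine[OF c w[OF c]] by simp
    moreover have "a \<bullet> normal c = - ((bgrad C c \<bullet> a) / norm (bgrad C c))"
      by (simp add: outer_normal_facet[OF c] inner_commute[of a])
    moreover have "- (p / q) * (q * M * (s - (r + k))) = M * (p * r) + M * (k - s) * p"
      if "q \<noteq> 0" for p q r s M :: real using that by (simp add: field_simps)
    ultimately show ?thesis using bgrad_nonzero[OF c] by (simp only: norm_eq_zero not_False_eq_True)
  qed
  then have "(\<Sum>c\<in>C. (a \<bullet> normal c) * (LINT x:facet c|side_measure (facet c). w x))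
     = (\<Sum>c\<in>C. ?M * ((bgrad C c \<bullet> a) * (m \<bullet> c)) + ?M * (k - ?s) * (bgrad C c \<bullet> a))"
    by (intro sum.cong) auto
  also have "\<dots> = ?M * (m \<bullet> (\<Sum>c\<in>C. (bgrad C c \<bullet> a) *\<^sub>R c)) + ?M * (k - ?s) * (\<Sum>c\<in>C. bgrad C c \<bullet> a)"
    by (simp add: sum.distrib sum_distrib_left inner_sum_right)
  finally show ?thesis by (simp add: bgrad_representation sum_bgrad_inner inner_commute[of m a])
qed

end

section \<open>Normals and Raviart--Thomas fields on one simplex\<close>

context full_simplex begin

text \<open>A constant normal flux on the side opposite to \<open>c\<close> means that the transposed linear part of the field
  maps the gradient for \<open>c\<close> to a multiple of itself. The gradients have only one linear relation, that
  they add up to zero; applying the transposed linear part to it shows that all the multiples agree.\<close>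

lemma raviart_thomas_shape:
  fixes A :: "'n \<Rightarrow> real^'n" and k :: "'n \<Rightarrow> real"
  defines "Y \<equiv> \<lambda>x. \<chi> i. A i \<bullet> x + k i"
  assumes flux: "\<And>c. c \<in> C \<Longrightarrow> \<exists>\<kappa>. \<forall>x\<in>facet c. Y x \<bullet> normal c = \<kappa>"
  obtains \<beta> where "\<And>i. A i = \<beta> *\<^sub>R axis i 1"
proof -
  define L where "L v = (\<chi> i. A i \<bullet> v)" for v
  define h where "h c = (\<Sum>i\<in>UNIV. (bgrad C c $ i) *\<^sub>R A i)" for c
  have YL: "Y y - Y x = L (y - x)" for x y
    by (simp add: Y_def L_def vec_eq_iff inner_diff_right)
  have hL: "h c \<bullet> v = L v \<bullet> bgrad C c" for c v
  proof -
    have "L v \<bullet> bgrad C c = (\<Sum>i\<in>UNIV. (A i \<bullet> v) * bgrad C c $ i)"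
      by (simp add: inner_vec_def[of "L v"]) (simp add: L_def)
    then show ?thesis by (simp add: h_def inner_sum_left mult.commute)
  qed
  have "\<exists>\<beta>. h c = \<beta> *\<^sub>R bgrad C c" if c: "c \<in> C" for c
  proof -
    obtain c1 where c1: "c1 \<in> C - {c}" using other_vertex[of c] by auto
    obtain \<kappa> where \<kappa>: "\<forall>x\<in>facet c. Y x \<bullet> normal c = \<kappa>"
      using flux[OF c] by blast
    have "h c \<bullet> (c' - c1) = 0" if c': "c' \<in> C - {c}" for c'
    proof -
      have "(Y c' - Y c1) \<bullet> normal c = 0"
        using \<kappa> vertex_in_facet[OF c'] vertex_in_facet[OF c1] by (simp add: inner_diff_left)
      then show ?thesis
        using bgrad_nonzero[OF c] by (simp add: hL outer_normal_facet[OF c] YL)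
    qed
    then have "h c = (h c \<bullet> (c - c1)) *\<^sub>R bgrad C c" by (rule orthogonal_to_facet[OF c c1])
    then show ?thesis by blast
  qed
  then obtain \<beta> where \<beta>: "\<And>c. c \<in> C \<Longrightarrow> h c = \<beta> c *\<^sub>R bgrad C c" by metis
  have "(\<Sum>c\<in>C. h c) \<bullet> v = 0" for v
  proof -
    have "(\<Sum>c\<in>C. h c) \<bullet> v = L v \<bullet> (\<Sum>c\<in>C. bgrad C c)"
      by (simp add: inner_sum_left inner_sum_right hL)
    then show ?thesis by (simp add: sum_bgrad)
  qed
  then have rel: "(\<Sum>c\<in>C. \<beta> c * (bgrad C c \<bullet> v)) = 0" for v
    using \<beta> by (simp add: inner_sum_left)
  have const: "\<beta> c1 = \<beta> c2" if c12: "c1 \<in> C" "c2 \<in> C" for c1 c2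
  proof -
    have "0 = (\<Sum>c\<in>C. \<beta> c * ((if c1 = c then 1 else 0) - (if c2 = c then 1 else 0)))"
      using rel[of "c1 - c2"] bgrad_inner_diff c12 by simp
    also have "\<dots> = (\<Sum>c\<in>C. (if c1 = c then \<beta> c else 0) - (if c2 = c then \<beta> c else 0))"
      by (intro sum.cong) auto
    also have "\<dots> = \<beta> c1 - \<beta> c2" using c12 by (simp add: sum_subtractf)
    finally show ?thesis by simp
  qed
  obtain c0 where c0: "c0 \<in> C" using other_vertex by blast
  have Lv: "L v = \<beta> c0 *\<^sub>R v" for v
  proof -
    have "bgrad C c \<bullet> L v = \<beta> c0 * (bgrad C c \<bullet> v)" if c: "c \<in> C" for c
      using hL[of c v] \<beta>[OF c] const[OF c c0] by (simp add: inner_commute)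
    then have "(\<Sum>c\<in>C. (bgrad C c \<bullet> L v) *\<^sub>R c) = \<beta> c0 *\<^sub>R (\<Sum>c\<in>C. (bgrad C c \<bullet> v) *\<^sub>R c)"
      by (simp add: scaleR_sum_right)
    then show ?thesis by (simp add: bgrad_representation)
  qed
  have "A i = \<beta> c0 *\<^sub>R axis i 1" for i
  proof (rule vector_eq_ldot[THEN iffD1, OF allI])
    fix v
    have "A i \<bullet> v = L v $ i" by (simp add: L_def)
    also have "\<dots> = \<beta> c0 * v $ i" by (simp add: Lv)
    finally show "v \<bullet> A i = v \<bullet> (\<beta> c0 *\<^sub>R axis i 1)"
      by (simp add: inner_commute[of v] inner_axis')
  qed
  then show ?thesis by (rule that)
qed

lemma inj_facet: "inj_on (\<lambda>c. facet c) C"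
proof (rule inj_onI)
  fix c c' assume "c \<in> C" "c' \<in> C" and eq: "facet c = facet c'"
  show "c = c'"
  proof (rule ccontr)
    assume "c \<noteq> c'"
    then have "c \<in> facet c" unfolding eq using \<open>c \<in> C\<close> by (intro hull_inc) auto
    then show False using \<open>c \<in> C\<close> by (simp add: facet_bary bary_vertex)
  qed
qed

text \<open>Near a point in the relative interior of a side the other barycentric coordinates remain positive, so
  membership in the simplex is decided by the half space of that side alone.\<close>

lemma local_half_space:
  assumes c: "c \<in> C" and p: "p \<in> rel_interior (facet c)"
  obtains \<epsilon> where "\<epsilon> > 0"
    "\<And>x. x \<in> ball p \<epsilon> \<Longrightarrow> normal c \<bullet> (x - p) \<le> 0 \<Longrightarrow> x \<in> convex hull C"
proof -
  let ?U = "{x. \<forall>v\<in>C - {c}. 0 < bary C v x}"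
  have p': "bary C c p = 0" "p \<in> ?U" using p by (auto simp: facet_rel_interior_bary[OF c])
  have U: "?U = (\<Inter>v\<in>C - {c}. {x. 0 < bary C v x})" by auto
  have "open ?U"
    unfolding U by (intro open_INT ballI open_Collect_less continuous_intros) simp
  then obtain \<epsilon> where \<epsilon>: "\<epsilon> > 0" "ball p \<epsilon> \<subseteq> ?U"
    using p' by (meson openE)
  show ?thesis
  proof (rule that[OF \<epsilon>(1)])
    fix x assume x: "x \<in> ball p \<epsilon>" "normal c \<bullet> (x - p) \<le> 0"
    have "0 \<le> bgrad C c \<bullet> (x - p)"
      using x(2) bgrad_nonzero[OF c] by (simp add: outer_normal_facet[OF c] field_simps)
    then have "0 \<le> bary C c x" using bary_diff[of C c x p] p' by simp
    then show "x \<in> convex hull C"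
      using x(1) \<epsilon>(2) c by (force simp: convex_hull_bary intro: less_imp_le)
  qed
qed

lemma outer_normal_side_normal:
  assumes c: "c \<in> C"
  shows "normal c = side_normal (facet c) \<or>
    normal c = - side_normal (facet c)"
proof -
  obtain \<sigma> where \<sigma>: "\<bar>\<sigma>\<bar> = 1" "side_normal (facet c) = (\<sigma> / norm (bgrad C c)) *\<^sub>R bgrad C c"
    using side_normal_facet[OF c] .
  from \<sigma>(1) have "\<sigma> = 1 \<or> \<sigma> = - 1" by linarith
  then show ?thesis unfolding \<sigma>(2) outer_normal_facet[OF c] by auto
qed

lemma norm_outer_normal: "c \<in> C \<Longrightarrow> norm (normal c) = 1"
  by (simp add: outer_normal_facet bgrad_nonzero)

lemma outer_normal_le:
  assumes c: "c \<in> C" and "p \<in> facet c" "x \<in> convex hull C"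
  shows "normal c \<bullet> (x - p) \<le> 0"
proof -
  have "0 \<le> bgrad C c \<bullet> (x - p)"
    using assms by (simp add: bary_diff[symmetric] facet_bary[OF c] convex_hull_bary)
  then show ?thesis by (simp add: outer_normal_facet[OF c])
qed

end

section \<open>Geometry of the mesh\<close>

definition vertices :: "(real^'n) set \<Rightarrow> (real^'n) set" where
  "vertices T = (SOME C. full_simplex C \<and> T = convex hull C)"

locale mesh =
  fixes \<Omega> :: "(real^'n) set" and \<T> :: "(real^'n) set set"
  assumes domain: "lipschitz_domain \<Omega>" and mesh: "simplicial_mesh \<Omega> \<T>"
begin

lemma finite_mesh [simp]: "finite \<T>"
  using mesh by (simp add: simplicial_mesh_def triangulation_def)

lemma element:
  assumes "T \<in> \<T>"
  shows "full_simplex (vertices T)" "convex hull (vertices T) = T"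
proof -
  have "int CARD('n) simplex T" using mesh assms by (simp add: simplicial_mesh_def)
  then have "\<exists>C. full_simplex C \<and> T = convex hull C"
    by (auto simp: simplex_def full_simplex_def)
  then have "full_simplex (vertices T) \<and> T = convex hull (vertices T)"
    unfolding vertices_def by (rule someI_ex)
  then show "full_simplex (vertices T)" "convex hull (vertices T) = T" by auto
qed

lemma facet_iff: "T \<in> \<T> \<Longrightarrow> S facet_of T \<longleftrightarrow> (\<exists>c\<in>vertices T. S = convex hull (vertices T - {c}))"
  using full_simplex.facet_of_iff[OF element(1)] element(2) by metis

lemma element_compact: "T \<in> \<T> \<Longrightarrow> compact T"
  using full_simplex.finite_C[OF element(1)] element(2) finite_imp_compact_convex_hull by metis

lemma element_convex: "T \<in> \<T> \<Longrightarrow> convex T"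
  using element(2) convex_convex_hull by metis

lemma element_lmeasurable: "T \<in> \<T> \<Longrightarrow> T \<in> lmeasurable"
  by (simp add: element_compact lmeasurable_compact)

lemma element_interior: "T \<in> \<T> \<Longrightarrow> interior T \<noteq> {}"
  using full_simplex.interior_nonempty[OF element(1)] element(2) by metis

lemma element_measure_pos: "T \<in> \<T> \<Longrightarrow> 0 < vol T"
  using full_simplex.simplex_measure_pos[OF element(1)] element(2) by metis

lemma element_aff_dim: "T \<in> \<T> \<Longrightarrow> aff_dim T = CARD('n)"
  using element_interior by (simp add: aff_dim_nonempty_interior)

lemma closure_interior_element: "T \<in> \<T> \<Longrightarrow> closure (interior T) = T"
  using convex_closure_interior[OF element_convex element_interior] element_compact
  by (metis closure_closed compact_imp_closed)

lemma element_limit_point: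
  assumes "T \<in> \<T>" "x \<in> T" shows "at x within interior T \<noteq> bot"
proof -
  have "x islimpt interior T"
  proof (cases "x \<in> interior T")
    case True then show ?thesis using interior_limit_point[of x "interior T"] by simp
  next
    case False
    then show ?thesis using closure_interior_element[OF assms(1)] assms(2) by (auto simp: closure_def)
  qed
  then show ?thesis by (simp add: trivial_limit_within)
qed

lemma elt_trace_eq:
  assumes "T \<in> \<T>" "x \<in> T" "\<And>y. y \<in> interior T \<Longrightarrow> v y = w y" "isCont w x"
  shows "elt_trace T v x = w x"
  unfolding elt_trace_def
proof (rule tendsto_Lim)
  show "at x within interior T \<noteq> bot" using assms(1,2) by (rule element_limit_point)
  have "(w \<longlongrightarrow> w x) (at x within interior T)"
    using assms(4) by (auto simp: isCont_def intro: tendsto_within_subset)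
  then show "(v \<longlongrightarrow> w x) (at x within interior T)"
    by (rule Lim_transform_within[where d = 1]) (auto simp: assms(3))
qed

lemma inter_face: "T \<in> \<T> \<Longrightarrow> T' \<in> \<T> \<Longrightarrow> T \<inter> T' face_of T"
  using mesh by (simp add: simplicial_mesh_def triangulation_def)

lemma not_subset:
  assumes "T \<in> \<T>" "T' \<in> \<T>" "T \<noteq> T'" shows "\<not> T \<subseteq> T'"
proof
  assume sub: "T \<subseteq> T'"
  have "T' \<inter> T face_of T'" by (rule inter_face[OF assms(2,1)])
  moreover have "T' \<inter> T = T" using sub by auto
  ultimately have "T face_of T'" by simp
  then have "T \<inter> interior T' = {}" using assms(3) by (rule face_of_disjoint_interior)
  moreover have "interior T \<subseteq> interior T'" using sub by (rule interior_mono)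
  ultimately show False using element_interior[OF assms(1)] interior_subset by blast
qed

lemma interior_disjoint:
  assumes "T \<in> \<T>" "T' \<in> \<T>" "T \<noteq> T'" shows "interior T \<inter> T' = {}"
proof -
  have "T \<inter> T' \<noteq> T" using not_subset[OF assms] by auto
  then have "(T \<inter> T') \<inter> interior T = {}" using inter_face assms face_of_disjoint_interior by blast
  then show ?thesis using interior_subset by blast
qed

lemma Union_mesh: "\<Union>\<T> = closure \<Omega>"
  using mesh by (simp add: simplicial_mesh_def)

lemma open_domain: "open \<Omega>"
  using domain by (simp add: lipschitz_domain_def)

text \<open>Directly below a boundary point the graph describing the boundary bounds an open region that does not
  meet \<open>\<Omega>\<close>, so a boundary point is not interior to the closure. This excludes slits, along which
  a side in the boundary would have elements on both of its faces.\<close>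

lemma interior_closure_domain: "interior (closure \<Omega>) = \<Omega>"
proof
  show "\<Omega> \<subseteq> interior (closure \<Omega>)"
    by (rule interior_maximal[OF closure_subset open_domain])
  show "interior (closure \<Omega>) \<subseteq> \<Omega>"
  proof (rule subsetI, rule ccontr)
    fix x assume x: "x \<in> interior (closure \<Omega>)" "x \<notin> \<Omega>"
    then have "x \<in> frontier \<Omega>"
      using open_domain interior_subset by (auto simp: frontier_def interior_open)
    then obtain e r L \<gamma> where e: "norm e = 1" "r > 0" "L-lipschitz_on UNIV (\<gamma> :: real^'n \<Rightarrow> real)"
      and eq: "\<Omega> \<inter> ball x r = {y \<in> ball x r. \<gamma> (y - (y \<bullet> e) *\<^sub>R e) < y \<bullet> e}"
      using domain unfolding lipschitz_domain_def by meson
    have cont: "continuous_on UNIV \<gamma>" using e(3) by (rule lipschitz_on_continuous_on)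
    let ?U = "{y. y \<bullet> e < \<gamma> (y - (y \<bullet> e) *\<^sub>R e)}"
    have c2: "continuous_on UNIV (\<lambda>y. \<gamma> (y - (y \<bullet> e) *\<^sub>R e))"
      by (rule continuous_on_compose2[OF cont]) (auto intro!: continuous_intros)
    have "open ?U"
      by (rule open_Collect_less) (auto intro!: continuous_intros c2)
    then have "open (?U \<inter> ball x r)" by auto
    moreover have "(?U \<inter> ball x r) \<inter> \<Omega> = {}" using eq by force
    ultimately have disj: "(?U \<inter> ball x r) \<inter> closure \<Omega> = {}"
      using open_Int_closure_eq_empty by blast
    obtain \<delta> where \<delta>: "\<delta> > 0" "ball x \<delta> \<subseteq> closure \<Omega>" using x(1) by (meson mem_interior)
    define s where "s = min r \<delta> / 2"
    have s: "0 < s" "s < r" "s < \<delta>" using \<delta> e by (auto simp: s_def)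
    define y where "y = x - s *\<^sub>R e"
    have ee: "e \<bullet> e = 1" using e(1) by (simp add: norm_eq_1)
    have ye: "y \<bullet> e = x \<bullet> e - s" by (simp add: y_def inner_diff_left ee)
    then have py: "y - (y \<bullet> e) *\<^sub>R e = x - (x \<bullet> e) *\<^sub>R e" by (simp add: y_def algebra_simps)
    have "x \<bullet> e \<le> \<gamma> (x - (x \<bullet> e) *\<^sub>R e)"
    proof (rule ccontr)
      assume "\<not> ?thesis"
      then have "x \<in> {y \<in> ball x r. \<gamma> (y - (y \<bullet> e) *\<^sub>R e) < y \<bullet> e}" using e by simp
      then show False using eq x(2) by blast
    qed
    then have "y \<in> ?U" using s unfolding mem_Collect_eq py by (simp add: ye)
    moreover have "dist x y = s" using s e by (simp add: y_def dist_norm)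
    ultimately have "y \<in> (?U \<inter> ball x r) \<inter> closure \<Omega>" using \<delta>(2) s by auto
    then show False using disj by blast
  qed
qed

lemma interior_element_subset: "T \<in> \<T> \<Longrightarrow> interior T \<subseteq> \<Omega>"
  using Union_mesh interior_closure_domain by (metis Union_upper interior_mono)

text \<open>The common face of the two elements contains a relative interior point of \<open>S\<close>, hence all of \<open>S\<close>, and
  it is proper; by dimension it is \<open>S\<close>.\<close>

lemma neighbour_of_point:
  assumes T: "T \<in> \<T>" "T' \<in> \<T>" "T \<noteq> T'" and S: "S facet_of T" and p: "p \<in> rel_interior S" "p \<in> T'"
  shows "S facet_of T'"
proof -
  let ?F = "T \<inter> T'"
  have F: "?F face_of T" "?F face_of T'"
    using inter_face[OF T(1,2)] inter_face[OF T(2,1)] by (simp_all add: Int_commute)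
  have ST: "S face_of T" "S \<subseteq> T" "S \<noteq> {}" "aff_dim S = aff_dim T - 1"
    using S facet_of_imp_subset by (auto simp: facet_of_def)
  have "p \<in> T" using p(1) ST(2) rel_interior_subset by blast
  then have SF: "S \<subseteq> ?F" using p by (intro subset_of_face_of[OF F(1) ST(2)]) auto
  have cF: "convex ?F" using T element_convex by (auto intro: convex_Int)
  have "?F \<noteq> T" using not_subset[OF T] by auto
  then have "aff_dim ?F < aff_dim T" using face_of_aff_dim_lt[OF element_convex[OF T(1)] F(1)] by simp
  moreover have "S face_of ?F" using ST(1) SF by (rule face_of_subset) simp
  ultimately have "S = ?F"
    using face_of_aff_dim_lt[OF cF, of S] ST(4) by fastforce
  then show ?thesis using F(2) ST T by (simp add: facet_of_def element_aff_dim)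
qed

text \<open>Both normals are unit vectors orthogonal to \<open>S\<close>. If they agreed, the two elements would share an open
  half ball; as they are opposite, the two half balls fill a neighbourhood of each relative interior
  point of \<open>S\<close>.\<close>

lemma outer_normal_opposite:
  assumes T: "T \<in> \<T>" "T' \<in> \<T>" "T \<noteq> T'" and S: "S facet_of T" "S facet_of T'"
  shows "outer_normal T' S = - outer_normal T S"
    and "p \<in> rel_interior S \<Longrightarrow> p \<in> \<Omega>"
proof -
  interpret A: full_simplex "vertices T" by (rule element[OF T(1)])
  interpret B: full_simplex "vertices T'" by (rule element[OF T(2)])
  obtain c where c: "c \<in> vertices T" "S = convex hull (vertices T - {c})" using S(1) T by (auto simp: facet_iff)
  obtain d where d: "d \<in> vertices T'" "S = convex hull (vertices T' - {d})" using S(2) T by (auto simp: facet_iff)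
  let ?n = "outer_normal T S" and ?n' = "outer_normal T' S"
  note hA = A.local_half_space[OF c(1), folded c(2), unfolded element(2)[OF T(1)]]
  note hB = B.local_half_space[OF d(1), folded d(2), unfolded element(2)[OF T(2)]]
  have n: "norm ?n = 1" using A.norm_outer_normal[OF c(1)] by (simp add: c(2)[symmetric] element(2)[OF T(1)])
  have pm: "?n' = ?n \<or> ?n' = - ?n"
    using A.outer_normal_side_normal[OF c(1)] B.outer_normal_side_normal[OF d(1)]
    unfolding c(2)[symmetric] d(2)[symmetric] element(2)[OF T(1)] element(2)[OF T(2)] by auto
  have "S \<noteq> {}" "convex S" using S(1) c(2) by (auto simp: facet_of_def)
  then obtain p0 where p0: "p0 \<in> rel_interior S" using rel_interior_eq_empty by blast
  show opp: "?n' = - ?n"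
  proof (rule ccontr)
    assume "?n' \<noteq> - ?n"
    with pm have eq: "?n' = ?n" by auto
    obtain \<epsilon> where \<epsilon>: "\<epsilon> > 0" "\<And>x. x \<in> ball p0 \<epsilon> \<Longrightarrow> ?n \<bullet> (x - p0) \<le> 0 \<Longrightarrow> x \<in> T" using hA[OF p0] by blast
    obtain \<epsilon>' where \<epsilon>': "\<epsilon>' > 0" "\<And>x. x \<in> ball p0 \<epsilon>' \<Longrightarrow> ?n' \<bullet> (x - p0) \<le> 0 \<Longrightarrow> x \<in> T'" using hB[OF p0] by blast
    let ?V = "ball p0 (min \<epsilon> \<epsilon>') \<inter> {x. ?n \<bullet> x < ?n \<bullet> p0}"
    have "open ?V" by (intro open_Int open_ball open_halfspace_lt)
    moreover have "?V \<subseteq> T" "?V \<subseteq> T'" using \<epsilon> \<epsilon>' by (auto simp: inner_diff_right eq)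
    ultimately have "?V \<subseteq> interior T \<inter> T'" using interior_maximal by blast
    then have "?V = {}" using interior_disjoint[OF T] by blast
    moreover have "p0 - (min \<epsilon> \<epsilon>' / 2) *\<^sub>R ?n \<in> ?V"
      using \<epsilon>(1) \<epsilon>'(1) n by (auto simp: dist_norm inner_diff_right dot_square_norm)
    ultimately show False by blast
  qed
  assume p: "p \<in> rel_interior S"
  obtain \<epsilon> where \<epsilon>: "\<epsilon> > 0" "\<And>x. x \<in> ball p \<epsilon> \<Longrightarrow> ?n \<bullet> (x - p) \<le> 0 \<Longrightarrow> x \<in> T" using hA[OF p] by blast
  obtain \<epsilon>' where \<epsilon>': "\<epsilon>' > 0" "\<And>x. x \<in> ball p \<epsilon>' \<Longrightarrow> ?n' \<bullet> (x - p) \<le> 0 \<Longrightarrow> x \<in> T'" using hB[OF p] by blast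
  have "ball p (min \<epsilon> \<epsilon>') \<subseteq> T \<union> T'"
  proof
    fix x assume x: "x \<in> ball p (min \<epsilon> \<epsilon>')"
    show "x \<in> T \<union> T'"
      using \<epsilon>(2)[of x] \<epsilon>'(2)[of x] x by (cases "?n \<bullet> (x - p) \<le> 0") (auto simp: opp)
  qed
  also have "\<dots> \<subseteq> closure \<Omega>" using T Union_mesh by auto
  finally have "p \<in> interior (closure \<Omega>)"
    unfolding mem_interior using \<epsilon>(1) \<epsilon>'(1) by (intro exI[of _ "min \<epsilon> \<epsilon>'"]) auto
  then show "p \<in> \<Omega>" by (simp add: interior_closure_domain)
qed

lemma rel_interior_facet_nonempty:
  assumes "S facet_of T" shows "rel_interior S \<noteq> {}"
  using assms face_of_imp_convex rel_interior_eq_empty by (auto simp: facet_of_def)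

lemma boundary_side_unique:
  assumes S: "S \<in> bd_sides \<Omega> \<T>" and T: "T \<in> \<T>" "T' \<in> \<T>" "S facet_of T" "S facet_of T'"
  shows "T = T'"
proof (rule ccontr)
  assume ne: "T \<noteq> T'"
  obtain p where p: "p \<in> rel_interior S" using rel_interior_facet_nonempty[OF T(3)] by blast
  then have "p \<in> \<Omega>" using outer_normal_opposite(2)[OF T(1,2) ne T(3,4)] by blast
  moreover have "p \<in> frontier \<Omega>" using S p rel_interior_subset by (auto simp: bd_sides_def)
  ultimately show False using open_domain by (simp add: frontier_def interior_open)
qed

lemma adj_boundary:
  assumes S: "S \<in> bd_sides \<Omega> \<T>"
  shows "adj \<T> S \<in> \<T>" "S facet_of adj \<T> S"
    and "T \<in> \<T> \<Longrightarrow> S facet_of T \<Longrightarrow> T = adj \<T> S"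
proof -
  obtain T0 where T0: "T0 \<in> \<T>" "S facet_of T0" using S by (auto simp: bd_sides_def sides_def)
  have "adj \<T> S = T0" unfolding adj_def
    using T0 boundary_side_unique[OF S] by (intro the_equality) auto
  then show "adj \<T> S \<in> \<T>" "S facet_of adj \<T> S" "T \<in> \<T> \<Longrightarrow> S facet_of T \<Longrightarrow> T = adj \<T> S"
    using T0 boundary_side_unique[OF S] by auto
qed

text \<open>Points of \<open>\<Omega>\<close> that approach a relative interior point of \<open>S\<close> from outside of \<open>T\<close> belong to the other
  elements, and the union of these is closed.\<close>

lemma interior_side_neighbour:
  assumes S: "S \<in> int_sides \<Omega> \<T>" and T: "T \<in> \<T>" "S facet_of T"
  obtains T' where "T' \<in> \<T>" "T' \<noteq> T" "S facet_of T'"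
proof -
  interpret A: full_simplex "vertices T" by (rule element[OF T(1)])
  obtain c where c: "c \<in> vertices T" "S = convex hull (vertices T - {c})" using T by (auto simp: facet_iff)
  have ST: "S \<subseteq> T" using T(2) by (rule facet_of_imp_subset)
  have cS: "convex S" "closed S" using c(2) A.compact_facet by (auto intro: compact_imp_closed)
  have "\<not> S \<subseteq> frontier \<Omega>" using S by (auto simp: int_sides_def bd_sides_def)
  then obtain x where x: "x \<in> S" "x \<notin> frontier \<Omega>" by blast
  then have "x \<in> closure \<Omega>" using ST T Union_mesh by auto
  then have "x \<in> \<Omega>" using x open_domain by (simp add: frontier_def interior_open)
  moreover have "S = closure (rel_interior S)"
    using convex_closure_rel_interior[OF cS(1)] cS(2) by simp
  ultimately have "\<Omega> \<inter> rel_interior S \<noteq> {}"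
    using x(1) open_Int_closure_eq_empty[OF open_domain, of "rel_interior S"] by blast
  then obtain p where p: "p \<in> \<Omega>" "p \<in> rel_interior S" by blast
  let ?n = "outer_normal T S"
  have n: "norm ?n = 1" using A.norm_outer_normal[OF c(1)] by (simp add: c(2)[symmetric] element(2)[OF T(1)])
  let ?q = "\<lambda>k. p + (1 / real (Suc k)) *\<^sub>R ?n"
  have "?q \<longlonglongrightarrow> p + 0 *\<^sub>R ?n"
    by (intro tendsto_intros LIMSEQ_inverse_real_of_nat[unfolded inverse_eq_divide])
  then have lim: "?q \<longlonglongrightarrow> p" by simp
  have "eventually (\<lambda>k. ?q k \<in> \<Omega>) sequentially"
    using lim open_domain p(1) by (rule topological_tendstoD)
  moreover have "?q k \<notin> T" for k
  proof
    assume "?q k \<in> T"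
    moreover have "p \<in> S" using p rel_interior_subset by blast
    ultimately have "?n \<bullet> (?q k - p) \<le> 0"
      using A.outer_normal_le[OF c(1)] unfolding c(2)[symmetric] element(2)[OF T(1)] by blast
    then show False using n by (simp add: dot_square_norm)
  qed
  ultimately have "eventually (\<lambda>k. ?q k \<in> \<Union>(\<T> - {T})) sequentially"
    using Union_mesh closure_subset by (auto elim!: eventually_mono) blast
  moreover have "closed (\<Union>(\<T> - {T}))"
    by (intro closed_Union) (auto intro: element_compact compact_imp_closed)
  ultimately have "p \<in> \<Union>(\<T> - {T})"
    using lim by (intro Lim_in_closed_set[of "\<Union>(\<T> - {T})" ?q sequentially]) auto
  then obtain T' where "T' \<in> \<T>" "T' \<noteq> T" "p \<in> T'" by blast
  with neighbour_of_point[OF T(1), of T' S p] T(2) p(2) show ?thesis by (intro that[of T']) auto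
qed

text \<open>Both sides are faces of the intersection of the elements to which they belong.\<close>

lemma rel_interior_sides_disjoint:
  assumes S: "S \<in> sides \<T>" "S' \<in> sides \<T>" and p: "p \<in> rel_interior S" "p \<in> rel_interior S'"
  shows "S = S'"
proof -
  obtain T T' where T: "T \<in> \<T>" "S face_of T" "T' \<in> \<T>" "S' face_of T'"
    using S by (auto simp: sides_def facet_of_def)
  have sub: "S \<subseteq> T" "S' \<subseteq> T'" using T face_of_imp_subset by auto
  let ?F = "T \<inter> T'"
  have F: "?F face_of T" "?F face_of T'"
    using inter_face[OF T(1,3)] inter_face[OF T(3,1)] by (simp_all add: Int_commute)
  have "p \<in> ?F" using p sub rel_interior_subset by blast
  then have "S \<subseteq> ?F" "S' \<subseteq> ?F"
    using subset_of_face_of[OF F(1) sub(1)] subset_of_face_of[OF F(2) sub(2)] p by auto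
  then have "S face_of ?F" "S' face_of ?F" using T face_of_subset by blast+
  then show ?thesis using face_of_eq p by blast
qed

lemma finite_sides: "finite (sides \<T>)"
proof -
  have "finite {S. S facet_of T}" if "T \<in> \<T>" for T
  proof -
    have "{S. S facet_of T} = (\<lambda>c. convex hull (vertices T - {c})) ` vertices T"
      using that by (auto simp: facet_iff)
    then show ?thesis using full_simplex.finite_C[OF element(1)[OF that]] by simp
  qed
  moreover have "sides \<T> = (\<Union>T\<in>\<T>. {S. S facet_of T})" by (auto simp: sides_def)
  ultimately show ?thesis by simp
qed

lemma off_frontiers:
  "AE x in lebesgue. \<forall>T\<in>\<T>. x \<notin> frontier T"
proof (rule AE_finite_allI)
  fix T assume "T \<in> \<T>"
  then have "frontier T \<in> null_sets lebesgue"
    using negligible_convex_frontier[OF element_convex] by (simp add: negligible_iff_null_sets)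
  then show "AE x in lebesgue. x \<notin> frontier T" by (rule AE_not_in)
qed simp

lemma domain_sets: "\<Omega> \<in> sets lebesgue"
  using open_domain by auto

lemma interior_of_element:
  assumes "\<forall>T\<in>\<T>. x \<notin> frontier T" "T \<in> \<T>" "x \<in> T" shows "x \<in> interior T"
  using assms closure_subset[of T] by (auto simp: frontier_def)

text \<open>Off the element frontiers, which are null sets, \<open>\<Omega>\<close> is the disjoint union of the elements.\<close>

lemma mesh_integral:
  fixes h :: "real^'n \<Rightarrow> real"
  assumes eq: "\<And>T x. T \<in> \<T> \<Longrightarrow> x \<in> interior T \<Longrightarrow> h x = H T x"
    and int: "\<And>T. T \<in> \<T> \<Longrightarrow> set_integrable lebesgue T (H T)"
  shows "(LINT x:\<Omega>|lebesgue. h x) = (\<Sum>T\<in>\<T>. LINT x:T|lebesgue. H T x)"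
proof -
  have AE: "AE x in lebesgue. indicator \<Omega> x *\<^sub>R h x = (\<Sum>T\<in>\<T>. indicator T x *\<^sub>R H T x)"
    using off_frontiers
  proof eventually_elim
    case (elim x)
    show "indicator \<Omega> x *\<^sub>R h x = (\<Sum>T\<in>\<T>. indicator T x *\<^sub>R H T x)"
    proof (cases "\<exists>T\<in>\<T>. x \<in> T")
      case True
      then obtain T0 where T0: "T0 \<in> \<T>" "x \<in> T0" by blast
      then have i: "x \<in> interior T0" using interior_of_element[OF elim] by blast
      then have "x \<in> \<Omega>" using interior_element_subset T0 by blast
      have other: "indicator T x *\<^sub>R H T x = 0" if "T \<in> \<T> - {T0}" for T
        using interior_disjoint[of T0 T] T0 i that by (auto simp: indicator_def)
      have "(\<Sum>T\<in>\<T> - {T0}. indicator T x *\<^sub>R H T x) = 0"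
        by (rule sum.neutral) (use other in blast)
      then have "(\<Sum>T\<in>\<T>. indicator T x *\<^sub>R H T x) = indicator T0 x *\<^sub>R H T0 x"
        by (subst sum.remove[OF finite_mesh T0(1)]) simp
      then show ?thesis using T0 i \<open>x \<in> \<Omega>\<close> by (simp add: eq)
    next
      case False
      then have "x \<notin> \<Omega>" using Union_mesh closure_subset by blast
      then show ?thesis using False by (auto intro!: sum.neutral[symmetric])
    qed
  qed
  have "(LINT x:\<Omega>|lebesgue. h x) = (LINT x|lebesgue. (\<Sum>T\<in>\<T>. indicator T x *\<^sub>R H T x))"
    unfolding set_lebesgue_integral_def
    using int by (intro completion.integral_cong_AE_complete(2)[OF _ AE] borel_measurable_sum)
      (simp add: set_integrable_def integrable_iff_bounded)
  also have "\<dots> = (\<Sum>T\<in>\<T>. LINT x:T|lebesgue. H T x)"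
    unfolding set_lebesgue_integral_def using int
    by (intro Bochner_Integration.integral_sum) (auto simp: set_integrable_def)
  finally show ?thesis .
qed

lemma set_integrable_element:
  fixes w :: "real^'n \<Rightarrow> 'b::{banach, second_countable_topology}"
  assumes "T \<in> \<T>" "continuous_on T w" shows "set_integrable lebesgue T w"
proof -
  have "integrable lborel (\<lambda>x. indicator T x *\<^sub>R w x)"
    by (rule borel_integrable_compact[OF element_compact[OF assms(1)] assms(2)])
  then show ?thesis
    unfolding set_integrable_def using integrable_completion borel_measurable_integrable by blast
qed

lemma mesh_integral_const:
  fixes h :: "real^'n \<Rightarrow> real"
  assumes "\<And>T x. T \<in> \<T> \<Longrightarrow> x \<in> interior T \<Longrightarrow> h x = k T"
  shows "(LINT x:\<Omega>|lebesgue. h x) = (\<Sum>T\<in>\<T>. vol T * k T)"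
proof -
  have "(LINT x:\<Omega>|lebesgue. h x) = (\<Sum>T\<in>\<T>. LINT x:T|lebesgue. k T)"
    by (rule mesh_integral) (auto simp: assms set_integrable_element)
  then show ?thesis
    using element_lmeasurable by (simp add: set_lebesgue_integral_def fmeasurable_def mult.commute)
qed

lemma AE_mesh:
  assumes "\<And>T x. T \<in> \<T> \<Longrightarrow> x \<in> interior T \<Longrightarrow> P x"
  shows "AE x in lebesgue_on \<Omega>. P x"
proof -
  have "AE x in lebesgue. x \<in> \<Omega> \<longrightarrow> P x"
    using off_frontiers
  proof eventually_elim
    case (elim x)
    then show ?case
      using interior_of_element[OF elim] assms Union_mesh closure_subset[of \<Omega>] by blast
  qed
  then show ?thesis using domain_sets by (simp add: AE_restrict_space_iff)
qed

lemma AE_mesh_point: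
  assumes "AE x in lebesgue_on \<Omega>. P x" "T \<in> \<T>"
  obtains x where "x \<in> interior T" "P x"
proof -
  have AE: "AE x in lebesgue. x \<in> \<Omega> \<longrightarrow> P x"
    using assms(1) domain_sets by (simp add: AE_restrict_space_iff)
  have "\<exists>x\<in>interior T. P x"
  proof (rule ccontr)
    assume "\<not> ?thesis"
    then have "AE x in lebesgue. x \<notin> interior T"
      using AE interior_element_subset[OF assms(2)] by (auto elim!: eventually_mono)
    then have "interior T \<in> null_sets lebesgue"
      by (simp add: AE_iff_null_sets)
    then have "negligible (interior T)" by (simp add: negligible_iff_null_sets)
    then show False using element_interior[OF assms(2)] open_not_negligible open_interior by blast
  qed
  then show ?thesis using that by blast
qed

end

section \<open>A Riesz theorem for finitely many functionals\<close>

text \<open>Finite dimension enters only through the functionals \<open>\<phi>\<close>, whose common kernel is invisible to the form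
  \<open>B\<close> and to \<open>F\<close>; this suits spaces of functions that are identified when they agree almost
  everywhere. The proof is a Gram--Schmidt process. The kernel \<open>V0\<close> of one functional has a representing
  element by induction. If the functional does not vanish on \<open>V\<close>, a second application of the induction
  hypothesis makes some \<open>e\<close> outside of \<open>V0\<close> orthogonal to \<open>V0\<close>, and a multiple of the resulting \<open>d\<close> completes the
  representing element.

  With \<open>B u v\<close> the sum of the products \<open>\<phi> i u * \<phi> i v\<close> the theorem says that a functional vanishing on the
  common kernel of the \<open>\<phi> i\<close> is a combination of them, which is how the multiplier is found.\<close>

lemma riesz_finitely_many_functionals:
  fixes V :: "('a \<Rightarrow> 'b::real_vector) set" and \<phi> :: "'i \<Rightarrow> ('a \<Rightarrow> 'b) \<Rightarrow> real"
    and B :: "('a \<Rightarrow> 'b) \<Rightarrow> ('a \<Rightarrow> 'b) \<Rightarrow> real"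
  assumes "finite I"
    and "(\<lambda>_. 0) \<in> V"
    and "\<And>u v c. u \<in> V \<Longrightarrow> v \<in> V \<Longrightarrow> (\<lambda>x. u x + c *\<^sub>R v x) \<in> V"
    and "\<And>i u v c. i \<in> I \<Longrightarrow> u \<in> V \<Longrightarrow> v \<in> V \<Longrightarrow> \<phi> i (\<lambda>x. u x + c *\<^sub>R v x) = \<phi> i u + c * \<phi> i v"
    and "\<And>u v. u \<in> V \<Longrightarrow> v \<in> V \<Longrightarrow> B u v = B v u"
    and "\<And>u v w c. u \<in> V \<Longrightarrow> v \<in> V \<Longrightarrow> w \<in> V \<Longrightarrow> B (\<lambda>x. u x + c *\<^sub>R v x) w = B u w + c * B v w"
    and "\<And>u i. u \<in> V \<Longrightarrow> B u u = 0 \<Longrightarrow> i \<in> I \<Longrightarrow> \<phi> i u = 0"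
    and "\<And>u w. u \<in> V \<Longrightarrow> w \<in> V \<Longrightarrow> \<forall>i\<in>I. \<phi> i u = 0 \<Longrightarrow> B u w = 0"
    and "\<And>u v c. u \<in> V \<Longrightarrow> v \<in> V \<Longrightarrow> F (\<lambda>x. u x + c *\<^sub>R v x) = F u + c * F v"
    and "\<And>u. u \<in> V \<Longrightarrow> \<forall>i\<in>I. \<phi> i u = 0 \<Longrightarrow> F u = (0::real)"
  shows "\<exists>x\<in>V. \<forall>y\<in>V. F y = B x y"
  using assms
proof (induction I arbitrary: V F)
  case empty
  then show ?case by (intro bexI[of _ "\<lambda>_. 0"]) auto
next
  case (insert m I)
  note zero = insert.prems(1) and cl = insert.prems(2) and \<phi> = insert.prems(3) and sym = insert.prems(4)
    and lin = insert.prems(5) and dfn = insert.prems(6) and nul = insert.prems(7)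
    and Flin = insert.prems(8) and Fnul = insert.prems(9)
  define V0 where "V0 = {u \<in> V. \<phi> m u = 0}"
  have V0: "u \<in> V" "\<phi> m u = 0" if "u \<in> V0" for u using that by (auto simp: V0_def)
  have \<phi>0: "\<phi> m (\<lambda>_. 0) = 0" using \<phi>[of m "\<lambda>_. 0" "\<lambda>_. 0" 1] zero by simp
  have sub: "\<exists>x\<in>V0. \<forall>y\<in>V0. G y = B x y"
    if Glin: "\<And>u v c. u \<in> V \<Longrightarrow> v \<in> V \<Longrightarrow> G (\<lambda>x. u x + c *\<^sub>R v x) = G u + c * G v"
      and Gnul: "\<And>u. u \<in> V \<Longrightarrow> \<forall>i\<in>insert m I. \<phi> i u = 0 \<Longrightarrow> G u = 0" for G
  proof (rule insert.IH)
    show "(\<lambda>_. 0) \<in> V0" using zero \<phi>0 by (simp add: V0_def)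
    show "(\<lambda>x. u x + c *\<^sub>R v x) \<in> V0" if "u \<in> V0" "v \<in> V0" for u v c
      using that cl \<phi> by (simp add: V0_def)
    show "\<phi> i (\<lambda>x. u x + c *\<^sub>R v x) = \<phi> i u + c * \<phi> i v" if "i \<in> I" "u \<in> V0" "v \<in> V0" for i u v c
      using that \<phi> V0 by auto
    show "B u v = B v u" if "u \<in> V0" "v \<in> V0" for u v using that sym V0 by blast
    show "B (\<lambda>x. u x + c *\<^sub>R v x) w = B u w + c * B v w" if "u \<in> V0" "v \<in> V0" "w \<in> V0" for u v w c
      using that lin V0 by blast
    show "\<phi> i u = 0" if "u \<in> V0" "B u u = 0" "i \<in> I" for u i
      using that dfn V0 by blast
    show "B u w = 0" if "u \<in> V0" "w \<in> V0" "\<forall>i\<in>I. \<phi> i u = 0" for u w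
      using that nul[of u w] V0 by auto
    show "G (\<lambda>x. u x + c *\<^sub>R v x) = G u + c * G v" if "u \<in> V0" "v \<in> V0" for u v c
      using that Glin V0 by blast
    show "G u = 0" if "u \<in> V0" "\<forall>i\<in>I. \<phi> i u = 0" for u
      using that Gnul[of u] V0 by auto
  qed
  obtain x0 where x0: "x0 \<in> V0" "\<And>y. y \<in> V0 \<Longrightarrow> F y = B x0 y"
  proof -
    have "\<exists>x\<in>V0. \<forall>y\<in>V0. F y = B x y"
      by (rule sub[where G = F]; (rule Flin | rule Fnul); assumption)
    then show ?thesis using that by blast
  qed
  show ?case
  proof (cases "\<exists>e\<in>V. \<phi> m e \<noteq> 0")
    case False
    then have "V0 = V" by (auto simp: V0_def)
    then show ?thesis using x0 by blast
  next
    case True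
    then obtain e where e: "e \<in> V" "\<phi> m e \<noteq> 0" by blast
    have lin2: "B e (\<lambda>x. u x + c *\<^sub>R v x) = B e u + c * B e v" if "u \<in> V" "v \<in> V" for u v c
      using lin[OF that e(1), of c] sym[OF e(1)] that cl by simp
    have nul2: "B e u = 0" if "u \<in> V" "\<forall>i\<in>insert m I. \<phi> i u = 0" for u
      using nul[OF that(1) e(1) that(2)] sym[OF e(1) that(1)] by simp
    obtain e0 where e0: "e0 \<in> V0" "\<And>y. y \<in> V0 \<Longrightarrow> B e y = B e0 y"
    proof -
      have "\<exists>x\<in>V0. \<forall>y\<in>V0. B e y = B x y"
        by (rule sub[where G = "B e"]; (rule lin2 | rule nul2); assumption)
      then show ?thesis using that by blast
    qed
    define d where "d = (\<lambda>x. e x + (- 1) *\<^sub>R e0 x)"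
    have dV: "d \<in> V" unfolding d_def using e e0 V0 by (intro cl) auto
    have \<phi>d: "\<phi> m d \<noteq> 0" unfolding d_def using \<phi>[of m e e0 "- 1"] e V0[OF e0(1)] by simp
    have orth: "B d y = 0" if "y \<in> V0" for y
      unfolding d_def using lin[of e e0 y "- 1"] e V0 e0 that by simp
    have Bdd: "B d d \<noteq> 0" using dfn[OF dV] \<phi>d by blast
    define x where "x = (\<lambda>p. x0 p + (F d / B d d) *\<^sub>R d p)"
    have xV: "x \<in> V" unfolding x_def using x0 dV V0 by (intro cl) auto
    have Bx: "B x y = B x0 y + (F d / B d d) * B d y" if "y \<in> V" for y
      unfolding x_def using x0 dV that V0 by (intro lin) auto
    have x0d: "B x0 d = 0" using orth[OF x0(1)] sym[of x0 d] dV V0[OF x0(1)] by simp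
    have "F y = B x y" if y: "y \<in> V" for y
    proof -
      define t where "t = \<phi> m y / \<phi> m d"
      define y0 where "y0 = (\<lambda>p. y p + (- t) *\<^sub>R d p)"
      have "y0 \<in> V" unfolding y0_def using y dV by (intro cl)
      moreover have "\<phi> m y0 = 0" unfolding y0_def using \<phi>[of m y d "- t"] y dV \<phi>d by (simp add: t_def)
      ultimately have y0: "y0 \<in> V0" by (simp add: V0_def)
      have yeq: "y = (\<lambda>p. y0 p + t *\<^sub>R d p)" by (simp add: y0_def)
      have "F y = F y0 + t * F d" 
        by (subst yeq, rule Flin) (use V0[OF y0] dV in auto)
      moreover have "B x y = B x y0 + t * B x d"
      proof -
        have "B y x = B y0 x + t * B d x" by (subst yeq, rule lin) (use V0[OF y0] dV xV in auto)
        then show ?thesis using sym[OF xV y] sym[OF xV V0(1)[OF y0]] sym[OF xV dV] by simp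
      qed
      moreover have "B x y0 = F y0" using Bx[OF V0(1)[OF y0]] orth[OF y0] x0(2)[OF y0] by simp
      moreover have "B x d = F d" using Bx[OF dV] x0d Bdd by simp
      ultimately show ?thesis by simp
    qed
    then show ?thesis using xV by blast
  qed
qed

section \<open>Raviart--Thomas fields element by element\<close>

context mesh begin

lemma element_integral_cong:
  fixes v :: "real^'n \<Rightarrow> 'b::{banach, second_countable_topology}"
  assumes "T \<in> \<T>" "\<And>x. x \<in> interior T \<Longrightarrow> v x = w x" "continuous_on T w"
  shows "(LINT x:T|lebesgue. v x) = (LINT x:T|lebesgue. w x)"
proof -
  have "AE x in lebesgue. indicator T x *\<^sub>R v x = indicator T x *\<^sub>R w x"
    using off_frontiers
  proof eventually_elim
    case (elim x)
    then show ?case using interior_of_element[OF elim assms(1)] assms(2) by (auto simp: indicator_def)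
  qed
  then show ?thesis
    unfolding set_lebesgue_integral_def using set_integrable_element[OF assms(1,3)]
    by (intro completion.integral_cong_AE_complete(2)) (auto simp: set_integrable_def)
qed

definition point :: "(real^'n) set \<Rightarrow> real^'n" where
  "point T = (SOME x. x \<in> interior T)"

definition avg :: "(real^'n) set \<Rightarrow> (real^'n \<Rightarrow> real^'n) \<Rightarrow> real^'n" where
  "avg T y = (1 / vol T) *\<^sub>R (LINT x:T|lebesgue. y x)"

text \<open>The divergence of a Raviart--Thomas field is constant in the interior of an element, so one value there suffices.\<close>

definition dvg :: "(real^'n) set \<Rightarrow> (real^'n \<Rightarrow> real^'n) \<Rightarrow> real" where
  "dvg T y = divg y (point T)"

lemma point: "T \<in> \<T> \<Longrightarrow> point T \<in> interior T"
  unfolding point_def using element_interior by (metis ex_in_conv someI_ex)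

lemma Pi_h_eq:
  assumes "T \<in> \<T>" "x \<in> interior T" shows "Pi_h \<T> y x = avg T y"
proof -
  have "(\<Sum>U\<in>\<T> - {T}. indicator (interior U) x *\<^sub>R ((1 / vol U) *\<^sub>R (LINT p:U|lebesgue. y p))) = 0"
  proof (rule sum.neutral, rule ballI)
    fix U assume "U \<in> \<T> - {T}"
    then have "x \<notin> interior U" using interior_disjoint[of T U] assms interior_subset[of U] by auto
    then show "indicator (interior U) x *\<^sub>R ((1 / vol U) *\<^sub>R (LINT p:U|lebesgue. y p)) = 0" by simp
  qed
  then show ?thesis
    using assms unfolding Pi_h_def sum.remove[OF finite_mesh assms(1)] by (simp add: avg_def)
qed

abbreviation "RT \<equiv> RT0 \<Omega> \<T>"

lemma RT0_facet_flux:
  "y \<in> RT \<Longrightarrow> T \<in> \<T> \<Longrightarrow> S facet_of T \<Longrightarrow> \<exists>\<kappa>. \<forall>x\<in>S. elt_trace T y x \<bullet> outer_normal T S = \<kappa>"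
  by (simp add: RT0_def)

lemma RT0_element:
  assumes y: "y \<in> RT" and T: "T \<in> \<T>"
  obtains a \<beta> where "\<And>x. x \<in> interior T \<Longrightarrow> y x = a + \<beta> *\<^sub>R x"
proof -
  interpret F: full_simplex "vertices T" by (rule element[OF T])
  have "\<forall>i. \<exists>a c. \<forall>x\<in>interior T. y x $ i = a \<bullet> x + c"
    using y T by (auto simp: RT0_def L1_def)
  then obtain A k where Ak: "\<And>i x. x \<in> interior T \<Longrightarrow> y x $ i = A i \<bullet> x + k i" by metis
  define Y where "Y x = (\<chi> i. A i \<bullet> x + k i)" for x
  have yY: "y x = Y x" if "x \<in> interior T" for x using Ak[OF that] by (simp add: Y_def vec_eq_iff)
  have "continuous_on UNIV Y"
    unfolding Y_def by (intro continuous_on_vec_lambda continuous_intros)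
  then have contY: "isCont Y x" for x by (simp add: continuous_on_eq_continuous_at)
  have tr: "elt_trace T y x = Y x" if "x \<in> T" for x
    by (rule elt_trace_eq[OF T that yY contY])
  have "\<exists>\<kappa>. \<forall>x\<in>convex hull (vertices T - {c}). Y x \<bullet> outer_normal (convex hull (vertices T)) (convex hull (vertices T - {c})) = \<kappa>"
    if c: "c \<in> vertices T" for c
  proof -
    let ?S = "convex hull (vertices T - {c})"
    have S: "?S facet_of T" using T c by (auto simp: facet_iff)
    then obtain \<kappa> where "\<forall>x\<in>?S. elt_trace T y x \<bullet> outer_normal T ?S = \<kappa>"
      using RT0_facet_flux[OF y T] by blast
    then show ?thesis using tr facet_of_imp_subset[OF S] element(2)[OF T] by (metis subsetD)
  qed
  then obtain \<beta> where \<beta>: "\<And>i. A i = \<beta> *\<^sub>R axis i 1"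
    using F.raviart_thomas_shape[of A k] unfolding Y_def by blast
  have "y x = (\<chi> i. k i) + \<beta> *\<^sub>R x" if "x \<in> interior T" for x
    using yY[OF that] by (simp add: Y_def \<beta> vec_eq_iff inner_axis')
  then show ?thesis by (rule that)
qed

lemma RT0_elements:
  assumes y: "y \<in> RT"
  obtains a \<beta> where "\<And>T x. T \<in> \<T> \<Longrightarrow> x \<in> interior T \<Longrightarrow> y x = a T + \<beta> T *\<^sub>R x"
proof -
  have "\<forall>T\<in>\<T>. \<exists>p. \<forall>x\<in>interior T. y x = fst p + snd p *\<^sub>R x"
  proof
    fix T assume "T \<in> \<T>"
    then obtain a \<beta> where "\<And>x. x \<in> interior T \<Longrightarrow> y x = a + \<beta> *\<^sub>R x" using RT0_element[OF y] by blast
    then show "\<exists>p. \<forall>x\<in>interior T. y x = fst p + snd p *\<^sub>R x" by (intro exI[of _ "(a, \<beta>)"]) simp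
  qed
  then obtain p where "\<forall>T\<in>\<T>. \<forall>x\<in>interior T. y x = fst (p T) + snd (p T) *\<^sub>R x"
    by (rule bchoice[THEN exE])
  then show ?thesis by (intro that[of "\<lambda>T. fst (p T)" "\<lambda>T. snd (p T)"]) blast
qed

lemma RT0_trace:
  assumes "y \<in> RT" "T \<in> \<T>" and eq: "\<And>x. x \<in> interior T \<Longrightarrow> y x = a + \<beta> *\<^sub>R x" and x: "x \<in> T"
  shows "elt_trace T y x = a + \<beta> *\<^sub>R x"
  by (rule elt_trace_eq[OF assms(2) x eq]) (auto intro!: continuous_intros)

lemma RT0_divg:
  fixes y :: "real^'n \<Rightarrow> real^'n" and \<beta> :: real
  assumes eq: "\<And>x. x \<in> interior T \<Longrightarrow> y x = a + \<beta> *\<^sub>R x" and x: "x \<in> interior T"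
  shows "divg y x = CARD('n) * \<beta>"
proof -
  have "((\<lambda>x. a + \<beta> *\<^sub>R x) has_derivative (\<lambda>v. \<beta> *\<^sub>R v)) (at x)"
    by (auto intro!: derivative_eq_intros)
  then have "(y has_derivative (\<lambda>v. \<beta> *\<^sub>R v)) (at x)"
    by (rule has_derivative_transform_within_open[OF _ open_interior x]) (simp add: eq)
  then have "frechet_derivative y (at x) = (\<lambda>v. \<beta> *\<^sub>R v)"
    by (rule frechet_derivative_at[symmetric])
  then show ?thesis by (simp add: divg_def)
qed

lemma RT0_dvg:
  fixes \<beta> :: real
  assumes "T \<in> \<T>" "\<And>x. x \<in> interior T \<Longrightarrow> y x = a + \<beta> *\<^sub>R x"
  shows "dvg T y = CARD('n) * \<beta>"
  unfolding dvg_def by (rule RT0_divg[OF assms(2) point[OF assms(1)]])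

lemma RT0_divg_dvg:
  assumes "y \<in> RT" "T \<in> \<T>" "x \<in> interior T" shows "divg y x = dvg T y"
  by (metis RT0_element[OF assms(1,2)] RT0_divg RT0_dvg assms(2,3))

lemma RT0_zero: "(\<lambda>_. 0) \<in> RT"
proof -
  have "elt_trace T (\<lambda>_. 0 :: real^'n) x = 0" if "T \<in> \<T>" "x \<in> T" for T x
    using elt_trace_eq[OF that, of "\<lambda>_. 0" "\<lambda>_. 0"] by simp
  moreover have "S facet_of T \<Longrightarrow> x \<in> S \<Longrightarrow> x \<in> T" for S T :: "(real^'n) set" and x
    using facet_of_imp_subset by blast
  moreover have "(\<lambda>x. 0 :: real) \<in> L1 \<T>"
    unfolding L1_def by (auto intro!: exI[of _ 0])
  ultimately show ?thesis unfolding RT0_def by auto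
qed

lemma RT0_trace_combine:
  assumes u: "u \<in> RT" and v: "v \<in> RT" and T: "T \<in> \<T>" "x \<in> T"
  shows "elt_trace T (\<lambda>x. u x + c *\<^sub>R v x) x = elt_trace T u x + c *\<^sub>R elt_trace T v x"
proof -
  obtain a \<beta> where a: "\<And>x. x \<in> interior T \<Longrightarrow> u x = a + \<beta> *\<^sub>R x" using RT0_element[OF u T(1)] by blast
  obtain a' \<beta>' where a': "\<And>x. x \<in> interior T \<Longrightarrow> v x = a' + \<beta>' *\<^sub>R x" using RT0_element[OF v T(1)] by blast
  have "elt_trace T (\<lambda>x. u x + c *\<^sub>R v x) x = (a + \<beta> *\<^sub>R x) + c *\<^sub>R (a' + \<beta>' *\<^sub>R x)"
    by (rule elt_trace_eq[OF T, of _ "\<lambda>x. (a + \<beta> *\<^sub>R x) + c *\<^sub>R (a' + \<beta>' *\<^sub>R x)"])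
      (auto simp: a a' intro!: continuous_intros)
  then show ?thesis using RT0_trace[OF u T(1) a T(2)] RT0_trace[OF v T(1) a' T(2)] by simp
qed

lemma RT0_combine:
  assumes u: "u \<in> RT" and v: "v \<in> RT"
  shows "(\<lambda>x. u x + c *\<^sub>R v x) \<in> RT"
proof -
  let ?w = "\<lambda>x. u x + c *\<^sub>R v x"
  have sub: "x \<in> T" if "S facet_of T" "x \<in> S" for S T :: "(real^'n) set" and x
    using that facet_of_imp_subset by blast
  have p1: "\<exists>a k. \<forall>x\<in>interior T. ?w x $ i = a \<bullet> x + k" if T: "T \<in> \<T>" for T i
  proof -
    obtain a k where "\<forall>x\<in>interior T. u x $ i = a \<bullet> x + k" using u T by (fastforce simp: RT0_def L1_def)
    moreover obtain a' k' where "\<forall>x\<in>interior T. v x $ i = a' \<bullet> x + k'" using v T by (fastforce simp: RT0_def L1_def)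
    ultimately show ?thesis
      by (intro exI[of _ "a + c *\<^sub>R a'"] exI[of _ "k + c * k'"]) (simp add: inner_add_left algebra_simps)
  qed
  have p2: "\<exists>\<kappa>. \<forall>x\<in>S. elt_trace T ?w x \<bullet> outer_normal T S = \<kappa>" if T: "T \<in> \<T>" "S facet_of T" for T S
  proof -
    obtain \<kappa> where "\<forall>x\<in>S. elt_trace T u x \<bullet> outer_normal T S = \<kappa>" using RT0_facet_flux[OF u T] by blast
    moreover obtain \<kappa>' where "\<forall>x\<in>S. elt_trace T v x \<bullet> outer_normal T S = \<kappa>'" using RT0_facet_flux[OF v T] by blast
    ultimately show ?thesis
      using sub[OF T(2)] by (intro exI[of _ "\<kappa> + c * \<kappa>'"]) (simp add: RT0_trace_combine[OF u v T(1)] inner_add_left)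
  qed
  have p3: "elt_trace T ?w x \<bullet> outer_normal T S + elt_trace T' ?w x \<bullet> outer_normal T' S = 0"
    if S: "S \<in> int_sides \<Omega> \<T>" and T: "T \<in> \<T>" "T' \<in> \<T>" "T \<noteq> T'" "S facet_of T" "S facet_of T'" and x: "x \<in> S" for S T T' x
  proof -
    have "elt_trace T u x \<bullet> outer_normal T S + elt_trace T' u x \<bullet> outer_normal T' S = 0"
      using u S T x by (auto simp: RT0_def)
    moreover have "elt_trace T v x \<bullet> outer_normal T S + elt_trace T' v x \<bullet> outer_normal T' S = 0"
      using v S T x by (auto simp: RT0_def)
    ultimately have "(elt_trace T u x \<bullet> outer_normal T S + elt_trace T' u x \<bullet> outer_normal T' S)
        + c * (elt_trace T v x \<bullet> outer_normal T S + elt_trace T' v x \<bullet> outer_normal T' S) = 0" by simp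
    then show ?thesis
      using sub[OF T(4) x] sub[OF T(5) x]
      by (simp add: RT0_trace_combine[OF u v T(1)] RT0_trace_combine[OF u v T(2)] inner_add_left algebra_simps)
  qed
  show ?thesis unfolding RT0_def L1_def
    by (intro CollectI conjI allI ballI impI; (elim conjE)?; (rule p1 | rule p2 | rule p3); assumption)
qed

lemma avg_combine:
  assumes u: "u \<in> RT" and v: "v \<in> RT" and T: "T \<in> \<T>"
  shows "avg T (\<lambda>x. u x + c *\<^sub>R v x) = avg T u + c *\<^sub>R avg T v"
proof -
  obtain a \<beta> where a: "\<And>x. x \<in> interior T \<Longrightarrow> u x = a + \<beta> *\<^sub>R x" using RT0_element[OF u T] by blast
  obtain a' \<beta>' where a': "\<And>x. x \<in> interior T \<Longrightarrow> v x = a' + \<beta>' *\<^sub>R x" using RT0_element[OF v T] by blast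
  let ?u = "\<lambda>x. a + \<beta> *\<^sub>R x" and ?v = "\<lambda>x. a' + \<beta>' *\<^sub>R x"
  have cont: "continuous_on T ?u" "continuous_on T ?v" "continuous_on T (\<lambda>x. ?u x + c *\<^sub>R ?v x)"
    by (auto intro!: continuous_intros)
  have "(LINT x:T|lebesgue. u x + c *\<^sub>R v x) = (LINT x:T|lebesgue. ?u x + c *\<^sub>R ?v x)"
    by (rule element_integral_cong[OF T _ cont(3)]) (simp add: a a')
  also have "\<dots> = (LINT x:T|lebesgue. ?u x) + c *\<^sub>R (LINT x:T|lebesgue. ?v x)"
    using set_integrable_element[OF T cont(1)] set_integrable_element[OF T cont(2)]
    by (subst set_integral_add) auto
  also have "\<dots> = (LINT x:T|lebesgue. u x) + c *\<^sub>R (LINT x:T|lebesgue. v x)"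
    using element_integral_cong[OF T a cont(1)] element_integral_cong[OF T a' cont(2)] by simp
  finally show ?thesis by (simp add: avg_def scaleR_right_distrib)
qed

lemma dvg_combine:
  assumes u: "u \<in> RT" and v: "v \<in> RT" and T: "T \<in> \<T>"
  shows "dvg T (\<lambda>x. u x + c *\<^sub>R v x) = dvg T u + c * dvg T v"
proof -
  obtain a \<beta> where a: "\<And>x. x \<in> interior T \<Longrightarrow> u x = a + \<beta> *\<^sub>R x" using RT0_element[OF u T] by blast
  obtain a' \<beta>' where a': "\<And>x. x \<in> interior T \<Longrightarrow> v x = a' + \<beta>' *\<^sub>R x" using RT0_element[OF v T] by blast
  have "dvg T (\<lambda>x. u x + c *\<^sub>R v x) = CARD('n) * (\<beta> + c * \<beta>')"
    by (rule RT0_dvg[OF T, of _ "a + c *\<^sub>R a'"]) (simp add: a a' algebra_simps)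
  then show ?thesis using RT0_dvg[OF T a] RT0_dvg[OF T a'] by (simp add: algebra_simps)
qed

lemma avg_const:
  assumes "T \<in> \<T>" "\<And>x. x \<in> interior T \<Longrightarrow> y x = a" shows "avg T y = a"
proof -
  have "(LINT x:T|lebesgue. y x) = (LINT x:T|lebesgue. a)"
    by (rule element_integral_cong[OF assms]) auto
  also have "\<dots> = vol T *\<^sub>R a"
    using element_lmeasurable[OF assms(1)] unfolding set_lebesgue_integral_def fmeasurable_def
    by (subst integral_scaleR_left) auto
  finally show ?thesis using element_measure_pos[OF assms(1)] by (simp add: avg_def)
qed

text \<open>The divergence of \<open>a + \<beta> x\<close> is the dimension times \<open>\<beta>\<close>, so such a field is constant on the element.\<close>

lemma RT0_divergence_free:
  assumes "y \<in> RT" "T \<in> \<T>" "dvg T y = 0" "x \<in> interior T"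
  shows "y x = avg T y"
proof -
  obtain a \<beta> where a: "\<And>x. x \<in> interior T \<Longrightarrow> y x = a + \<beta> *\<^sub>R x" using RT0_element[OF assms(1,2)] by blast
  have "\<beta> = 0" using RT0_dvg[OF assms(2) a] assms(3) by simp
  then have "y x = a" if "x \<in> interior T" for x using a[OF that] by simp
  then show ?thesis using avg_const[OF assms(2)] assms(4) by metis
qed

text \<open>On each element the integral of the squared deviation from the average is nonnegative.\<close>

lemma avg_norm_le:
  assumes "y \<in> RT"
  shows "(\<Sum>T\<in>\<T>. vol T * (norm (avg T y))\<^sup>2) \<le> pairing \<Omega> y y"
    and "(L2norm \<Omega> y)\<^sup>2 = pairing \<Omega> y y"
proof -
  obtain a \<beta> where a: "\<And>T x. T \<in> \<T> \<Longrightarrow> x \<in> interior T \<Longrightarrow> y x = a T + \<beta> T *\<^sub>R x"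
    using RT0_elements[OF assms] by blast
  let ?w = "\<lambda>T x. a T + \<beta> T *\<^sub>R x"
  have "pairing \<Omega> y y = (\<Sum>T\<in>\<T>. LINT x:T|lebesgue. ?w T x \<bullet> ?w T x)"
    unfolding pairing_def
  proof (rule mesh_integral)
    fix T x assume "T \<in> \<T>" "x \<in> interior T"
    then show "y x \<bullet> y x = ?w T x \<bullet> ?w T x" using a[of T x] by simp
  qed (intro set_integrable_element continuous_intros)
  moreover have "vol T * (norm (avg T y))\<^sup>2 \<le> (LINT x:T|lebesgue. ?w T x \<bullet> ?w T x)" if T: "T \<in> \<T>" for T
  proof -
    let ?A = "avg T y"
    have cw: "continuous_on T (?w T)" by (intro continuous_intros)
    have iw: "set_integrable lebesgue T (?w T)" by (rule set_integrable_element[OF T cw])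
    have i1: "set_integrable lebesgue T (\<lambda>x. ?w T x \<bullet> ?w T x)" "set_integrable lebesgue T (\<lambda>x. ?w T x \<bullet> ?A)"
      "set_integrable lebesgue T (\<lambda>x. ?A \<bullet> ?A)"
      by (auto intro!: set_integrable_element T continuous_intros)
    have m: "(LINT x:T|lebesgue. ?w T x) = vol T *\<^sub>R ?A"
      using element_integral_cong[OF T a[OF T] cw] element_measure_pos[OF T] by (simp add: avg_def)
    have "0 \<le> (LINT x:T|lebesgue. (?w T x - ?A) \<bullet> (?w T x - ?A))"
      unfolding set_lebesgue_integral_def by (rule Bochner_Integration.integral_nonneg) simp
    also have "\<dots> = (LINT x:T|lebesgue. (?w T x \<bullet> ?w T x - 2 * (?w T x \<bullet> ?A)) + ?A \<bullet> ?A)"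
      by (rule arg_cong[where f = "set_lebesgue_integral lebesgue T"], rule ext)
        (simp add: inner_diff_left inner_diff_right inner_commute)
    also have "\<dots> = (LINT x:T|lebesgue. ?w T x \<bullet> ?w T x) - 2 * (LINT x:T|lebesgue. ?w T x \<bullet> ?A) + (LINT x:T|lebesgue. ?A \<bullet> ?A)"
      using i1 by (simp add: set_integral_add set_integral_diff)
    also have "(LINT x:T|lebesgue. ?w T x \<bullet> ?A) = (LINT x:T|lebesgue. ?w T x) \<bullet> ?A"
      using iw unfolding set_lebesgue_integral_def set_integrable_def by (simp flip: integral_inner_left)
    also have "\<dots> = vol T * (?A \<bullet> ?A)" by (simp add: m)
    also have "(LINT x:T|lebesgue. ?A \<bullet> ?A) = vol T * (?A \<bullet> ?A)"
      using element_lmeasurable[OF T] by (simp add: set_lebesgue_integral_def fmeasurable_def)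
    finally show ?thesis by (simp add: dot_square_norm)
  qed
  ultimately show "(\<Sum>T\<in>\<T>. vol T * (norm (avg T y))\<^sup>2) \<le> pairing \<Omega> y y"
    by (simp add: sum_mono)
  have "pairing \<Omega> y y = (LINT x:\<Omega>|lebesgue. (norm (y x))\<^sup>2)"
    by (simp add: pairing_def dot_square_norm)
  moreover have "0 \<le> (LINT x:\<Omega>|lebesgue. (norm (y x))\<^sup>2)"
    unfolding set_lebesgue_integral_def by (rule Bochner_Integration.integral_nonneg) simp
  ultimately show "(L2norm \<Omega> y)\<^sup>2 = pairing \<Omega> y y" by (simp add: L2norm_def)
qed

lemma pairing_combine:
  assumes "u \<in> RT" "v \<in> RT" "w \<in> RT"
  shows "pairing \<Omega> (\<lambda>x. u x + c *\<^sub>R v x) w = pairing \<Omega> u w + c * pairing \<Omega> v w"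
proof -
  obtain a \<beta> where u: "\<And>T x. T \<in> \<T> \<Longrightarrow> x \<in> interior T \<Longrightarrow> u x = a T + \<beta> T *\<^sub>R x"
    using RT0_elements[OF assms(1)] by blast
  obtain a' \<beta>' where v: "\<And>T x. T \<in> \<T> \<Longrightarrow> x \<in> interior T \<Longrightarrow> v x = a' T + \<beta>' T *\<^sub>R x"
    using RT0_elements[OF assms(2)] by blast
  obtain a'' \<beta>'' where w: "\<And>T x. T \<in> \<T> \<Longrightarrow> x \<in> interior T \<Longrightarrow> w x = a'' T + \<beta>'' T *\<^sub>R x"
    using RT0_elements[OF assms(3)] by blast
  let ?u = "\<lambda>T x. a T + \<beta> T *\<^sub>R x" and ?v = "\<lambda>T x. a' T + \<beta>' T *\<^sub>R x" and ?w = "\<lambda>T x. a'' T + \<beta>'' T *\<^sub>R x"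
  have "pairing \<Omega> (\<lambda>x. u x + c *\<^sub>R v x) w = (\<Sum>T\<in>\<T>. LINT x:T|lebesgue. (?u T x \<bullet> ?w T x) + c * (?v T x \<bullet> ?w T x))"
    unfolding pairing_def
  proof (rule mesh_integral)
    fix T x assume "T \<in> \<T>" "x \<in> interior T"
    then show "(u x + c *\<^sub>R v x) \<bullet> w x = (?u T x \<bullet> ?w T x) + c * (?v T x \<bullet> ?w T x)"
      using u[of T x] v[of T x] w[of T x] by (simp add: inner_add_left)
  qed (intro set_integrable_element continuous_intros)
  also have "\<dots> = (\<Sum>T\<in>\<T>. (LINT x:T|lebesgue. ?u T x \<bullet> ?w T x) + c * (LINT x:T|lebesgue. ?v T x \<bullet> ?w T x))"
    by (intro sum.cong refl, subst set_integral_add) (auto intro!: set_integrable_element continuous_intros)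
  also have "\<dots> = (\<Sum>T\<in>\<T>. LINT x:T|lebesgue. ?u T x \<bullet> ?w T x) + c * (\<Sum>T\<in>\<T>. LINT x:T|lebesgue. ?v T x \<bullet> ?w T x)"
    by (simp add: sum.distrib sum_distrib_left)
  also have "(\<Sum>T\<in>\<T>. LINT x:T|lebesgue. ?u T x \<bullet> ?w T x) = pairing \<Omega> u w"
    unfolding pairing_def
  proof (rule mesh_integral[symmetric])
    fix T x assume "T \<in> \<T>" "x \<in> interior T"
    then show "u x \<bullet> w x = ?u T x \<bullet> ?w T x" using u[of T x] w[of T x] by simp
  qed (intro set_integrable_element continuous_intros)
  also have "(\<Sum>T\<in>\<T>. LINT x:T|lebesgue. ?v T x \<bullet> ?w T x) = pairing \<Omega> v w"
    unfolding pairing_def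
  proof (rule mesh_integral[symmetric])
    fix T x assume "T \<in> \<T>" "x \<in> interior T"
    then show "v x \<bullet> w x = ?v T x \<bullet> ?w T x" using v[of T x] w[of T x] by simp
  qed (intro set_integrable_element continuous_intros)
  finally show ?thesis .
qed

lemma pairing_zero_imp:
  assumes "y \<in> RT" "pairing \<Omega> y y = 0" "T \<in> \<T>" "x \<in> interior T"
  shows "y x = 0"
proof (rule ccontr)
  assume ne: "y x \<noteq> 0"
  obtain a \<beta> where a: "\<And>T x. T \<in> \<T> \<Longrightarrow> x \<in> interior T \<Longrightarrow> y x = a T + \<beta> T *\<^sub>R x"
    using RT0_elements[OF assms(1)] by blast
  let ?w = "\<lambda>T x. a T + \<beta> T *\<^sub>R x"
  have "pairing \<Omega> y y = (\<Sum>T\<in>\<T>. LINT x:T|lebesgue. ?w T x \<bullet> ?w T x)"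
    unfolding pairing_def
  proof (rule mesh_integral)
    fix T x assume "T \<in> \<T>" "x \<in> interior T"
    then show "y x \<bullet> y x = ?w T x \<bullet> ?w T x" using a[of T x] by simp
  qed (intro set_integrable_element continuous_intros)
  moreover have "0 \<le> (LINT x:T|lebesgue. ?w T x \<bullet> ?w T x)" for T
    unfolding set_lebesgue_integral_def by (rule Bochner_Integration.integral_nonneg) simp
  ultimately have "(LINT x:T|lebesgue. ?w T x \<bullet> ?w T x) = 0"
    using assms(2,3) by (simp add: sum_nonneg_eq_0_iff)
  moreover have "set_integrable lebesgue T (\<lambda>x. ?w T x \<bullet> ?w T x)"
    by (intro set_integrable_element assms(3) continuous_intros)
  ultimately have "AE p in lebesgue. indicator T p *\<^sub>R (?w T p \<bullet> ?w T p) = 0"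
    unfolding set_lebesgue_integral_def set_integrable_def
    by (subst (asm) integral_nonneg_eq_0_iff_AE) auto
  then have "AE p in lebesgue. p \<notin> interior T \<inter> {p. ?w T p \<noteq> 0}"
    using interior_subset[of T] by (auto elim!: eventually_mono simp: indicator_def)
  moreover have op: "open (interior T \<inter> {p. ?w T p \<noteq> 0})"
    by (intro open_Int open_interior open_Collect_neq continuous_intros)
  ultimately have "negligible (interior T \<inter> {p. ?w T p \<noteq> 0})"
    by (simp add: negligible_iff_null_sets AE_iff_null_sets)
  moreover have "x \<in> interior T \<inter> {p. ?w T p \<noteq> 0}" using assms(3,4) a ne by auto
  ultimately show False using open_not_negligible[OF op] by blast
qed

end

section \<open>Boundary fluxes and integration by parts\<close>

context mesh begin

lemma side_facet:
  assumes "S \<in> sides \<T>"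
  obtains T c where "T \<in> \<T>" "S facet_of T" "c \<in> vertices T" "S = convex hull (vertices T - {c})"
  using assms unfolding sides_def by (auto simp: facet_iff)

lemma side_AE_rel_interior:
  assumes "S \<in> sides \<T>" shows "AE x in side_measure S. x \<in> rel_interior S"
proof -
  obtain T c where T: "T \<in> \<T>" "c \<in> vertices T" "S = convex hull (vertices T - {c})" using side_facet[OF assms] .
  show ?thesis unfolding T(3) by (rule full_simplex.AE_side_rel_interior[OF element(1)[OF T(1)] T(2)])
qed

lemma side_measure_pos:
  assumes "S \<in> sides \<T>"
  shows "0 < measure (side_measure S) S" "0 < measure (side_measure S) (space (side_measure S))"
proof -
  obtain T c where T: "T \<in> \<T>" "c \<in> vertices T" "S = convex hull (vertices T - {c})" using side_facet[OF assms] .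
  interpret F: full_simplex "vertices T" by (rule element(1)[OF T(1)])
  show "0 < measure (side_measure S) S" "0 < measure (side_measure S) (space (side_measure S))"
    unfolding T(3) using F.measure_side_facet_pos[OF T(2)] F.measure_side_facet(2)[OF T(2)] F.space_side_measure
    by auto
qed

lemma side_integral_const:
  assumes "S \<in> sides \<T>" "\<And>x. x \<in> rel_interior S \<Longrightarrow> h x = (k :: real)"
  shows "(LINT x|side_measure S. h x) = k * measure (side_measure S) S"
proof -
  obtain T c where T: "T \<in> \<T>" "c \<in> vertices T" "S = convex hull (vertices T - {c})" using side_facet[OF assms(1)] .
  show ?thesis unfolding T(3)
    using assms(2) by (intro full_simplex.integral_side_AE_const[OF element(1)[OF T(1)] T(2)]) (simp add: T(3))
qed

definition side_point :: "(real^'n) set \<Rightarrow> real^'n" where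
  "side_point S = (SOME x. x \<in> rel_interior S)"

lemma side_point:
  assumes "S \<in> sides \<T>" shows "side_point S \<in> rel_interior S" "side_point S \<in> S"
proof -
  have "rel_interior S \<noteq> {}" using assms rel_interior_facet_nonempty by (auto simp: sides_def)
  then show "side_point S \<in> rel_interior S" unfolding side_point_def by (meson ex_in_conv someI_ex)
  then show "side_point S \<in> S" using rel_interior_subset by blast
qed

text \<open>The normal trace of a Raviart--Thomas field is constant on a boundary side.\<close>

definition bflux :: "(real^'n) set \<Rightarrow> (real^'n \<Rightarrow> real^'n) \<Rightarrow> real" where
  "bflux S y = ntrace \<T> S y (side_point S)"

lemma bd_sides_subset: "bd_sides \<Omega> \<T> \<subseteq> sides \<T>"
  by (auto simp: bd_sides_def)

lemma bd_side_subset_adj: "S \<in> bd_sides \<Omega> \<T> \<Longrightarrow> S \<subseteq> adj \<T> S"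
  using adj_boundary(2) facet_of_imp_subset by blast

lemma ntrace_const:
  assumes "y \<in> RT" "S \<in> bd_sides \<Omega> \<T>" "x \<in> S"
  shows "ntrace \<T> S y x = bflux S y"
proof -
  obtain \<kappa> where "\<forall>x\<in>S. elt_trace (adj \<T> S) y x \<bullet> outer_normal (adj \<T> S) S = \<kappa>"
    using RT0_facet_flux[OF assms(1) adj_boundary(1,2)[OF assms(2)]] by blast
  then show ?thesis
    using assms(3) side_point(2)[of S] assms(2) bd_sides_subset by (auto simp: bflux_def ntrace_def)
qed

lemma bflux_combine:
  assumes "u \<in> RT" "v \<in> RT" "S \<in> bd_sides \<Omega> \<T>"
  shows "bflux S (\<lambda>x. u x + c *\<^sub>R v x) = bflux S u + c * bflux S v"
proof -
  have "side_point S \<in> adj \<T> S"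
    using assms(3) bd_sides_subset side_point(2) bd_side_subset_adj by blast
  then show ?thesis
    using RT0_trace_combine[OF assms(1,2) adj_boundary(1)[OF assms(3)]]
    by (simp add: bflux_def ntrace_def inner_add_left)
qed

lemma bflux_zero:
  assumes "\<And>T x. T \<in> \<T> \<Longrightarrow> x \<in> interior T \<Longrightarrow> y x = 0" "S \<in> bd_sides \<Omega> \<T>"
  shows "bflux S y = 0"
proof -
  have "side_point S \<in> adj \<T> S"
    using assms(2) bd_sides_subset side_point(2) bd_side_subset_adj by blast
  then have "elt_trace (adj \<T> S) y (side_point S) = 0"
    using elt_trace_eq[OF adj_boundary(1)[OF assms(2)], of _ y "\<lambda>_. 0"] assms(1) adj_boundary(1)[OF assms(2)] by auto
  then show ?thesis by (simp add: bflux_def ntrace_def)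
qed

end

locale mesh_boundary = mesh \<Omega> \<T> for \<Omega> :: "(real^'n) set" and \<T> +
  fixes \<Gamma>D \<Gamma>N :: "(real^'n) set"
  assumes boundary: "boundary_partition \<Omega> \<T> \<Gamma>D \<Gamma>N"
begin

abbreviation "SD \<equiv> sides_on \<Omega> \<T> \<Gamma>D"
abbreviation "SN \<equiv> sides_on \<Omega> \<T> \<Gamma>N"
abbreviation "RTN \<equiv> RT0_N \<Omega> \<T> \<Gamma>N"

lemma sides_on_subset: "SD \<subseteq> bd_sides \<Omega> \<T>" "SN \<subseteq> bd_sides \<Omega> \<T>"
  by (auto simp: sides_on_def)

lemma bd_sides_split: "bd_sides \<Omega> \<T> = SD \<union> SN" "SD \<inter> SN = {}"
proof -
  have "\<forall>S\<in>bd_sides \<Omega> \<T>. (S \<in> SD) \<noteq> (S \<in> SN)"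
    using boundary unfolding boundary_partition_def by blast
  then show "bd_sides \<Omega> \<T> = SD \<union> SN" "SD \<inter> SN = {}" using sides_on_subset by blast+
qed

lemma parts_disjoint: "\<Gamma>D \<inter> \<Gamma>N = {}"
  using boundary unfolding boundary_partition_def by blast

lemma finite_bd_sides: "finite (bd_sides \<Omega> \<T>)" "finite SD" "finite SN"
  using finite_sides bd_sides_subset sides_on_subset by (meson finite_subset)+

lemma side_constant:
  assumes "u \<in> L0_sides \<S>" "S \<in> \<S>" "S \<in> sides \<T>" "x \<in> rel_interior S"
  shows "u x = u (side_point S)"
proof -
  obtain k where "\<forall>x\<in>rel_interior S. u x = k" using assms(1,2) by (auto simp: L0_sides_def)
  then show ?thesis using assms(4) side_point(1)[OF assms(3)] by metis
qed

text \<open>The relative boundary of a side is a null set. Hence on a Neumann side the condition compares two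
  constants, and on a Dirichlet side it is void almost everywhere.\<close>

lemma normal_eq_on_iff:
  assumes y: "y \<in> RT" and g: "g \<in> L0_sides SN"
  shows "normal_eq_on \<Omega> \<T> \<Gamma>N y g \<longleftrightarrow> (\<forall>S\<in>SN. bflux S y = g (side_point S))"
proof
  assume eq: "normal_eq_on \<Omega> \<T> \<Gamma>N y g"
  show "\<forall>S\<in>SN. bflux S y = g (side_point S)"
  proof
    fix S assume S: "S \<in> SN"
    then have bd: "S \<in> bd_sides \<Omega> \<T>" "S \<in> sides \<T>" "rel_interior S \<subseteq> \<Gamma>N"
      by (auto simp: sides_on_def bd_sides_def)
    have "AE x in side_measure S. x \<in> S \<inter> \<Gamma>N \<longrightarrow> ntrace \<T> S y x = g x"
      using eq bd(1) by (simp add: normal_eq_on_def)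
    with side_AE_rel_interior[OF bd(2)] have "AE x in side_measure S. bflux S y = g (side_point S)"
    proof eventually_elim
      case (elim x)
      then have "x \<in> S" using rel_interior_subset by blast
      then show ?case
        using elim bd side_constant[OF g S bd(2)] ntrace_const[OF y bd(1)] by auto
    qed
    then show "bflux S y = g (side_point S)"
      by (rule AE_const_space_nonnull) (use side_measure_pos(2)[OF bd(2)] in linarith)
  qed
next
  assume eq: "\<forall>S\<in>SN. bflux S y = g (side_point S)"
  show "normal_eq_on \<Omega> \<T> \<Gamma>N y g" unfolding normal_eq_on_def
  proof
    fix S assume bd: "S \<in> bd_sides \<Omega> \<T>"
    then have sd: "S \<in> sides \<T>" using bd_sides_subset by blast
    show "AE x in side_measure S. x \<in> S \<inter> \<Gamma>N \<longrightarrow> ntrace \<T> S y x = g x"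
      using side_AE_rel_interior[OF sd]
    proof eventually_elim
      case (elim x)
      show ?case
      proof
        assume x: "x \<in> S \<inter> \<Gamma>N"
        have "S \<notin> SD" using elim x parts_disjoint by (auto simp: sides_on_def)
        then have S: "S \<in> SN" using bd bd_sides_split by blast
        then show "ntrace \<T> S y x = g x"
          using eq side_constant[OF g S sd elim] ntrace_const[OF y bd, of x] x by simp
      qed
    qed
  qed
qed

lemma RT0_N_iff: "y \<in> RTN \<longleftrightarrow> y \<in> RT \<and> (\<forall>S\<in>SN. bflux S y = 0)"
proof -
  have "(\<lambda>_. 0) \<in> L0_sides SN" by (auto simp: L0_sides_def)
  from normal_eq_on_iff[OF _ this] show ?thesis by (auto simp: RT0_N_def)
qed

lemma RT0_N_combine: "u \<in> RTN \<Longrightarrow> v \<in> RTN \<Longrightarrow> (\<lambda>x. u x + c *\<^sub>R v x) \<in> RTN"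
  using sides_on_subset(2) bflux_combine by (simp add: RT0_N_iff RT0_combine subset_iff)

lemma RT0_N_zero: "(\<lambda>_. 0) \<in> RTN"
  using sides_on_subset(2) by (auto simp: RT0_N_iff RT0_zero intro!: bflux_zero)

lemma normal_pairing_eq:
  assumes y: "y \<in> RT" and u: "u \<in> L0_sides SD"
  shows "normal_pairing \<Omega> \<T> \<Gamma>D y u = (\<Sum>S\<in>SD. (u (side_point S) * measure (side_measure S) S) * bflux S y)"
proof -
  let ?I = "\<lambda>S. LINT x:(S \<inter> \<Gamma>D)|side_measure S. ntrace \<T> S y x * u x"
  have D: "?I S = (u (side_point S) * measure (side_measure S) S) * bflux S y" if S: "S \<in> SD" for S
  proof -
    have bd: "S \<in> bd_sides \<Omega> \<T>" "S \<in> sides \<T>" "rel_interior S \<subseteq> \<Gamma>D"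
      using S by (auto simp: sides_on_def bd_sides_def)
    have "?I S = (bflux S y * u (side_point S)) * measure (side_measure S) S"
      unfolding set_lebesgue_integral_def
    proof (rule side_integral_const[OF bd(2)])
      fix x assume x: "x \<in> rel_interior S"
      then have "x \<in> S \<inter> \<Gamma>D" using bd rel_interior_subset by blast
      then show "indicat_real (S \<inter> \<Gamma>D) x *\<^sub>R (ntrace \<T> S y x * u x) = bflux S y * u (side_point S)"
        using ntrace_const[OF y bd(1), of x] side_constant[OF u S bd(2) x] by simp
    qed
    then show ?thesis by simp
  qed
  have N: "?I S = 0" if S: "S \<in> SN" for S
  proof -
    have bd: "S \<in> sides \<T>" "rel_interior S \<subseteq> \<Gamma>N"
      using S by (auto simp: sides_on_def bd_sides_def)
    have "?I S = 0 * measure (side_measure S) S"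
      unfolding set_lebesgue_integral_def
    proof (rule side_integral_const[OF bd(1)])
      fix x assume "x \<in> rel_interior S"
      then have "x \<notin> S \<inter> \<Gamma>D" using bd parts_disjoint by blast
      then show "indicat_real (S \<inter> \<Gamma>D) x *\<^sub>R (ntrace \<T> S y x * u x) = 0" by simp
    qed
    then show ?thesis by simp
  qed
  have "normal_pairing \<Omega> \<T> \<Gamma>D y u = sum ?I SD + sum ?I SN"
    unfolding normal_pairing_def bd_sides_split(1)
    using finite_bd_sides bd_sides_split(2) by (intro sum.union_disjoint) auto
  also have "sum ?I SN = 0" using N by (intro sum.neutral) blast
  finally show ?thesis using D by simp
qed

lemma normal_pairing_combine:
  assumes "y \<in> RT" "w \<in> RT" "u \<in> L0_sides SD"
  shows "normal_pairing \<Omega> \<T> \<Gamma>D (\<lambda>x. y x + c *\<^sub>R w x) u = normal_pairing \<Omega> \<T> \<Gamma>D y u + c * normal_pairing \<Omega> \<T> \<Gamma>D w u"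
proof -
  have "bflux S (\<lambda>x. y x + c *\<^sub>R w x) = bflux S y + c * bflux S w" if "S \<in> SD" for S
    using that sides_on_subset(1) assms by (intro bflux_combine) auto
  then show ?thesis
    using assms by (simp add: normal_pairing_eq RT0_combine distrib_left sum.distrib sum_distrib_left mult_ac)
qed

lemma normal_pairing_zero:
  assumes "y \<in> RT" "u \<in> L0_sides SD" "\<And>T x. T \<in> \<T> \<Longrightarrow> x \<in> interior T \<Longrightarrow> y x = 0"
  shows "normal_pairing \<Omega> \<T> \<Gamma>D y u = 0"
proof -
  have "bflux S y = 0" if "S \<in> SD" for S
    by (rule bflux_zero) (use assms(3) that sides_on_subset(1) in auto)
  then show ?thesis using assms by (simp add: normal_pairing_eq)
qed

lemma pi_h_side:
  assumes S: "S \<in> SD" and x: "x \<in> rel_interior S"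
  shows "pi_h \<T> SD v x = side_average S (elt_trace (adj \<T> S) v)"
proof -
  have "(\<Sum>S'\<in>SD - {S}. indicator (rel_interior S') x * side_average S' (elt_trace (adj \<T> S') v)) = 0"
  proof (rule sum.neutral, rule ballI)
    fix S' assume S': "S' \<in> SD - {S}"
    have "S \<in> sides \<T>" "S' \<in> sides \<T>" using S S' by (auto simp: sides_on_def bd_sides_def)
    then have "x \<notin> rel_interior S'" using rel_interior_sides_disjoint[of S S' x] x S' by blast
    then show "indicator (rel_interior S') x * side_average S' (elt_trace (adj \<T> S') v) = 0" by simp
  qed
  then show ?thesis unfolding pi_h_def sum.remove[OF finite_bd_sides(2) S] using x by simp
qed

text \<open>The divergence theorem is applied on every element and the sum is rearranged by sides. At an interior
  side the fluxes of neighbouring elements are opposite while the integrals of \<open>u\<close> from the two sides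
  agree; at a Neumann side the flux vanishes; at a Dirichlet side the integral of \<open>u\<close> is that of its mean
  value, which is \<open>uD\<close>.\<close>

theorem integration_by_parts:
  assumes y: "y \<in> RTN" and div: "\<And>T. T \<in> \<T> \<Longrightarrow> dvg T y = 0"
    and u: "u \<in> CR1 \<Omega> \<T>" and uD: "uD \<in> L0_sides SD"
    and trace: "\<And>S x. S \<in> SD \<Longrightarrow> x \<in> rel_interior S \<Longrightarrow> pi_h \<T> SD u x = uD x"
    and grad: "\<And>T x. T \<in> \<T> \<Longrightarrow> x \<in> interior T \<Longrightarrow> u x = G T \<bullet> x + k T"
  shows "normal_pairing \<Omega> \<T> \<Gamma>D y uD = (\<Sum>T\<in>\<T>. vol T * (avg T y \<bullet> G T))"
proof -
  have yRT: "y \<in> RT" using y by (simp add: RT0_N_iff)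
  have tr_y: "elt_trace T y x = avg T y" if "T \<in> \<T>" "x \<in> T" for T x
    by (rule elt_trace_eq[OF that, of y "\<lambda>_. avg T y"]) (use RT0_divergence_free[OF yRT that(1) div[OF that(1)]] in auto)
  have tr_u: "elt_trace T u x = G T \<bullet> x + k T" if "T \<in> \<T>" "x \<in> T" for T x
    by (rule elt_trace_eq[OF that, of u "\<lambda>x. G T \<bullet> x + k T"]) (auto simp: grad[OF that(1)] intro!: continuous_intros)
  have sub: "x \<in> T" if "S facet_of T" "x \<in> S" for S T :: "(real^'n) set" and x
    using that facet_of_imp_subset by blast
  define q where "q T S = avg T y \<bullet> outer_normal T S" for T S
  define J where "J T S = (LINT x:S|side_measure S. elt_trace T u x)" for T S
  have "vol T * (avg T y \<bullet> G T) = (\<Sum>S\<in>{S \<in> sides \<T>. S facet_of T}. q T S * J T S)" if T: "T \<in> \<T>" for T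
  proof -
    interpret F: full_simplex "vertices T" by (rule element(1)[OF T])
    have eT: "convex hull (vertices T) = T" by (rule element(2)[OF T])
    have "{S \<in> sides \<T>. S facet_of T} = (\<lambda>c. convex hull (vertices T - {c})) ` vertices T"
      using T by (auto simp: facet_iff sides_def)
    then have "(\<Sum>S\<in>{S \<in> sides \<T>. S facet_of T}. q T S * J T S)
        = (\<Sum>c\<in>vertices T. q T (convex hull (vertices T - {c})) * J T (convex hull (vertices T - {c})))"
      using F.inj_facet by (simp add: sum.reindex)
    also have "\<dots> = vol T * (avg T y \<bullet> G T)"
      unfolding q_def J_def
    proof (rule F.divergence_simplex_constant_field[unfolded eT])
      fix c x assume "c \<in> vertices T" "x \<in> convex hull (vertices T - {c})"
      then have "x \<in> T" using T sub facet_iff by blast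
      then show "elt_trace T u x = G T \<bullet> x + k T" by (rule tr_u[OF T])
    qed
    finally show ?thesis by simp
  qed
  then have "(\<Sum>T\<in>\<T>. vol T * (avg T y \<bullet> G T)) = (\<Sum>T\<in>\<T>. \<Sum>S\<in>{S \<in> sides \<T>. S facet_of T}. q T S * J T S)"
    by simp
  also have "\<dots> = (\<Sum>S\<in>sides \<T>. \<Sum>T\<in>{T \<in> \<T>. S facet_of T}. q T S * J T S)"
    by (rule sum.swap_restrict) (simp_all add: finite_sides)
  also have "\<dots> = (\<Sum>S\<in>int_sides \<Omega> \<T>. \<Sum>T\<in>{T \<in> \<T>. S facet_of T}. q T S * J T S)
      + (\<Sum>S\<in>bd_sides \<Omega> \<T>. \<Sum>T\<in>{T \<in> \<T>. S facet_of T}. q T S * J T S)"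
    unfolding int_sides_def by (rule sum.subset_diff[OF bd_sides_subset finite_sides])
  also have "(\<Sum>S\<in>int_sides \<Omega> \<T>. \<Sum>T\<in>{T \<in> \<T>. S facet_of T}. q T S * J T S) = 0"
  proof (rule sum.neutral, rule ballI)
    fix S assume S: "S \<in> int_sides \<Omega> \<T>"
    then have sS: "S \<in> sides \<T>" by (simp add: int_sides_def)
    let ?X = "{T \<in> \<T>. S facet_of T}"
    have qq: "q T S + q T' S = 0" if "T \<in> ?X" "T' \<in> ?X" "T \<noteq> T'" for T T'
    proof -
      have "elt_trace T y (side_point S) \<bullet> outer_normal T S + elt_trace T' y (side_point S) \<bullet> outer_normal T' S = 0"
        using yRT S that side_point(2)[OF sS] by (simp add: RT0_def)
      moreover have "elt_trace U y (side_point S) = avg U y" if "U \<in> ?X" for U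
        using that sub[of S U] side_point(2)[OF sS] by (intro tr_y) auto
      ultimately show ?thesis using that by (simp add: q_def)
    qed
    have JJ: "J T S = J T' S" if TT: "T \<in> ?X" "T' \<in> ?X" "T \<noteq> T'" for T T'
    proof -
      have "side_average S (\<lambda>x. elt_trace T u x - elt_trace T' u x) = 0"
        using u S TT by (simp add: CR1_def)
      then have "(LINT x:S|side_measure S. elt_trace T u x - elt_trace T' u x) = 0"
        using side_measure_pos(1)[OF sS] by (simp add: side_average_def)
      moreover have "(LINT x:S|side_measure S. elt_trace T u x - elt_trace T' u x) = J T S - J T' S"
      proof -
        obtain c where c: "c \<in> vertices T" "S = convex hull (vertices T - {c})" using TT(1) by (auto simp: facet_iff)
        interpret F: full_simplex "vertices T" using TT(1) element(1) by blast
        have f: "x \<in> T" "x \<in> T'" if "x \<in> convex hull (vertices T - {c})" for x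
          using that TT sub c(2) by blast+
        have "elt_trace T u x = G T \<bullet> x + k T" "elt_trace T' u x = G T' \<bullet> x + k T'"
          if "x \<in> convex hull (vertices T - {c})" for x
          using f[OF that] TT tr_u by blast+
        then show ?thesis unfolding J_def c(2)
          by (rule F.set_integral_facet_diff[OF c(1)])
      qed
      ultimately show ?thesis by simp
    qed
    show "(\<Sum>T\<in>?X. q T S * J T S) = 0"
    proof (cases "\<forall>T\<in>?X. q T S = 0")
      case True then show ?thesis by (intro sum.neutral) auto
    next
      case False
      then obtain T0 where T0: "T0 \<in> ?X" "q T0 S \<noteq> 0" by blast
      obtain T1 where T1: "T1 \<in> ?X" "T1 \<noteq> T0"
        using interior_side_neighbour[OF S, of T0] T0(1) by blast
      \<comment> \<open>If three elements shared the side, three numbers with pairwise zero sums would vanish.\<close>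
      have "T = T0 \<or> T = T1" if "T \<in> ?X" for T
      proof (rule ccontr)
        assume "\<not> ?thesis"
        then have "q T0 S + q T S = 0" "q T1 S + q T S = 0" "q T0 S + q T1 S = 0"
          using qq[OF T0(1) that] qq[OF T1(1) that] qq[OF T0(1) T1(1)] T1(2) by auto
        then show False using T0(2) by simp
      qed
      then have "?X = {T0, T1}" using T0 T1 by blast
      then have "(\<Sum>T\<in>?X. q T S * J T S) = q T0 S * J T0 S + q T1 S * J T1 S" using T1(2) by simp
      also have "\<dots> = (q T0 S + q T1 S) * J T0 S" using JJ[OF T0(1) T1(1)] T1(2) by (simp add: algebra_simps)
      finally show ?thesis using qq[OF T0(1) T1(1)] T1(2) by simp
    qed
  qed
  also have "(\<Sum>S\<in>bd_sides \<Omega> \<T>. \<Sum>T\<in>{T \<in> \<T>. S facet_of T}. q T S * J T S)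
      = (\<Sum>S\<in>bd_sides \<Omega> \<T>. bflux S y * J (adj \<T> S) S)"
  proof (rule sum.cong[OF refl])
    fix S assume S: "S \<in> bd_sides \<Omega> \<T>"
    have X: "{T \<in> \<T>. S facet_of T} = {adj \<T> S}" using adj_boundary[OF S] by blast
    have "side_point S \<in> adj \<T> S"
      using S bd_sides_subset side_point(2) bd_side_subset_adj by blast
    then have "q (adj \<T> S) S = bflux S y"
      using tr_y[OF adj_boundary(1)[OF S]] by (simp add: q_def bflux_def ntrace_def)
    then show "(\<Sum>T\<in>{T \<in> \<T>. S facet_of T}. q T S * J T S) = bflux S y * J (adj \<T> S) S"
      by (simp add: X)
  qed
  also have "\<dots> = (\<Sum>S\<in>SD. bflux S y * J (adj \<T> S) S) + (\<Sum>S\<in>SN. bflux S y * J (adj \<T> S) S)"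
    unfolding bd_sides_split(1)
    using finite_bd_sides bd_sides_split(2) by (intro sum.union_disjoint) auto
  also have "(\<Sum>S\<in>SN. bflux S y * J (adj \<T> S) S) = 0"
    using y by (intro sum.neutral) (simp add: RT0_N_iff)
  also have "(\<Sum>S\<in>SD. bflux S y * J (adj \<T> S) S) = normal_pairing \<Omega> \<T> \<Gamma>D y uD"
    unfolding normal_pairing_eq[OF yRT uD]
  proof (rule sum.cong[OF refl])
    fix S assume S: "S \<in> SD"
    then have sS: "S \<in> sides \<T>" by (simp add: sides_on_def bd_sides_def)
    have "uD (side_point S) = side_average S (elt_trace (adj \<T> S) u)"
      using trace[OF S side_point(1)[OF sS]] pi_h_side[OF S side_point(1)[OF sS]] by simp
    also have "\<dots> = J (adj \<T> S) S / measure (side_measure S) S"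
      by (simp add: side_average_def J_def)
    finally show "bflux S y * J (adj \<T> S) S = uD (side_point S) * measure (side_measure S) S * bflux S y"
      using side_measure_pos(1)[OF sS] by simp
  qed
  finally show ?thesis by simp
qed

end

section \<open>The Huber density\<close>

text \<open>The density \<open>\<phi>\<^sup>*\<close> for a fixed value \<open>s\<close> of \<open>\<zeta>\<close>, which is the Huber function, and the quotient of its
  derivative and its argument.\<close>

definition huber :: "real \<Rightarrow> real \<Rightarrow> real" where
  "huber s r = (if r \<le> s then r\<^sup>2 / 2 else s * r - s\<^sup>2 / 2)"

definition huber_weight :: "real \<Rightarrow> real \<Rightarrow> real" where
  "huber_weight s r = (if r \<le> s then 1 else s / r)"

lemma phi_star_huber: "phi_star \<zeta> x = huber (\<zeta> x)"
  by (rule ext) (simp add: phi_star_def huber_def)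

lemma huber_deriv:
  assumes "0 < s"
  shows "(huber s has_real_derivative (if r \<le> s then r else s)) (at r)"
proof -
  consider "r < s" | "r > s" | "r = s" by linarith
  then show ?thesis
  proof cases
    case 1
    have "((\<lambda>r. r\<^sup>2 / 2) has_real_derivative r) (at r)" by (auto intro!: derivative_eq_intros)
    then have "(huber s has_real_derivative r) (at r)"
      by (rule has_field_derivative_transform_within_open[OF _ open_lessThan[of s]]) (use 1 in \<open>auto simp: huber_def\<close>)
    then show ?thesis using 1 by simp
  next
    case 2
    have "((\<lambda>r. s * r - s\<^sup>2 / 2) has_real_derivative s) (at r)" by (auto intro!: derivative_eq_intros)
    then have "(huber s has_real_derivative s) (at r)"
      by (rule has_field_derivative_transform_within_open[OF _ open_greaterThan[of s]]) (use 2 in \<open>auto simp: huber_def\<close>)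
    then show ?thesis using 2 by simp
  next
    case 3
    have eq: "huber s (s + h) - huber s s - s * h = (if h \<le> 0 then h\<^sup>2 / 2 else 0)" for h
      by (auto simp: huber_def power2_eq_square field_simps)
    have "((\<lambda>h. (huber s (s + h) - huber s s) / h) \<longlongrightarrow> s) (at 0)"
    proof (rule LIM_zero_cancel, rule tendsto_norm_zero_cancel,
        rule tendsto_sandwich[where f = "\<lambda>_. 0" and h = "\<lambda>h. \<bar>h\<bar> / 2"])
      show "eventually (\<lambda>h. norm ((huber s (s + h) - huber s s) / h - s) \<le> \<bar>h\<bar> / 2) (at 0)"
        unfolding eventually_at
      proof (intro exI[of _ 1] conjI ballI impI)
        fix h :: real assume "h \<noteq> 0 \<and> dist h 0 < 1"
        then have h: "h \<noteq> 0" by simp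
        then have "(huber s (s + h) - huber s s) / h - s = (if h \<le> 0 then h\<^sup>2 / 2 else 0) / h"
          using eq[of h] by (simp add: field_simps)
        then show "norm ((huber s (s + h) - huber s s) / h - s) \<le> \<bar>h\<bar> / 2"
          using h by (simp add: power2_eq_square abs_mult)
      qed simp
      show "((\<lambda>h::real. \<bar>h\<bar> / 2) \<longlongrightarrow> 0) (at 0)"
        by (rule tendsto_eq_intros refl | simp)+
    qed auto
    then show ?thesis using 3 by (simp add: DERIV_def)
  qed
qed

lemma phi_weight_huber:
  assumes "0 < \<zeta> x" "0 \<le> r"
  shows "phi_weight \<zeta> x r = huber_weight (\<zeta> x) r"
  using DERIV_imp_deriv[OF huber_deriv[OF assms(1)], of r] assms
  by (auto simp: phi_weight_def phi_star_huber huber_weight_def)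

lemma huber_weight_bounds: "0 < s \<Longrightarrow> 0 < huber_weight s r" "0 < s \<Longrightarrow> huber_weight s r \<le> 1"
  by (auto simp: huber_weight_def)

lemma huber_lower: "s * r - s\<^sup>2 / 2 \<le> huber s r"
proof -
  have "0 \<le> (r - s)\<^sup>2" by simp
  then show ?thesis by (simp add: huber_def power2_eq_square algebra_simps)
qed

text \<open>As a function of \<open>r\<^sup>2\<close> the Huber function is concave, and its slope is half the weight: this is its
  tangent inequality.\<close>

lemma huber_concave:
  assumes s: "0 < s" and r: "0 \<le> r" and t: "0 \<le> t"
  shows "huber s r - huber s t \<le> huber_weight s t * (r\<^sup>2 - t\<^sup>2) / 2"
proof (cases "t \<le> s")
  case True
  have "huber s r \<le> r\<^sup>2 / 2"
    using zero_le_power2[of "r - s"] by (auto simp: huber_def power2_eq_square algebra_simps)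
  then show ?thesis using True by (simp add: huber_def[of s t] huber_weight_def field_simps)
next
  case False
  then have t0: "0 < t" using s by simp
  have w: "huber_weight s t = s / t" using False by (simp add: huber_weight_def)
  have "2 * t * huber s r \<le> s * r\<^sup>2 + s * t\<^sup>2 - t * s\<^sup>2"
  proof (cases "r \<le> s")
    case True
    have "r\<^sup>2 \<le> s\<^sup>2" using True r by (simp add: power_mono)
    then have "0 \<le> (t - s) * (s\<^sup>2 - r\<^sup>2)" using False by simp
    moreover have "0 \<le> s * (t - s)\<^sup>2" using s by simp
    ultimately show ?thesis using True by (simp add: huber_def power2_eq_square algebra_simps)
  next
    case False
    have "0 \<le> s * (r - t)\<^sup>2" using s by simp
    then show ?thesis using False by (simp add: huber_def power2_eq_square algebra_simps)
  qed
  moreover have t: "huber s t = s * t - s\<^sup>2 / 2" using False by (simp add: huber_def)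
  ultimately have "(huber s r - huber s t) * (2 * t) \<le> s * (r\<^sup>2 - t\<^sup>2)"
    unfolding t by (simp add: algebra_simps power2_eq_square)
  then have "huber s r - huber s t \<le> s * (r\<^sup>2 - t\<^sup>2) / (2 * t)"
    using t0 by (simp add: pos_le_divide_eq)
  then show ?thesis by (simp add: w mult.commute)
qed

text \<open>The inner product \<open>b \<bullet> (b - a)\<close> exceeds half of the increase of the squared norm.\<close>

lemma huber_step:
  fixes a b :: "'a::real_inner"
  assumes s: "0 < s"
  shows "huber s (norm b) - huber s (norm a) \<le> huber_weight s (norm a) * (b \<bullet> (b - a))"
proof -
  have "b \<bullet> (b - a) = ((norm b)\<^sup>2 - (norm a)\<^sup>2) / 2 + (norm (b - a))\<^sup>2 / 2"
    by (simp add: power2_norm_eq_inner inner_diff_left inner_diff_right inner_commute) (simp add: field_simps)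
  then have "((norm b)\<^sup>2 - (norm a)\<^sup>2) / 2 \<le> b \<bullet> (b - a)" by simp
  then have "huber_weight s (norm a) * (((norm b)\<^sup>2 - (norm a)\<^sup>2) / 2) \<le> huber_weight s (norm a) * (b \<bullet> (b - a))"
    using huber_weight_bounds(1)[OF s] by (intro mult_left_mono) (auto intro: less_imp_le)
  then show ?thesis using huber_concave[OF s, of "norm b" "norm a"] by simp
qed

lemma huber_weight_projection:
  fixes v :: "'a::euclidean_space"
  assumes s: "0 < s"
  shows "huber_weight s (norm v) *\<^sub>R v = closest_point (cball 0 s) v"
proof (rule closest_point_unique)
  show "huber_weight s (norm v) *\<^sub>R v \<in> cball 0 s"
    using s by (auto simp: huber_weight_def)
  show "\<forall>z\<in>cball 0 s. dist v (huber_weight s (norm v) *\<^sub>R v) \<le> dist v z"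
  proof
    fix z :: 'a assume z: "z \<in> cball 0 s"
    show "dist v (huber_weight s (norm v) *\<^sub>R v) \<le> dist v z"
    proof (cases "norm v \<le> s")
      case True then show ?thesis by (simp add: huber_weight_def)
    next
      case False
      then have nv: "0 < norm v" using s by linarith
      have "v - (s / norm v) *\<^sub>R v = (1 - s / norm v) *\<^sub>R v" by (simp add: algebra_simps)
      then have "norm (v - (s / norm v) *\<^sub>R v) = \<bar>1 - s / norm v\<bar> * norm v" by simp
      also have "\<dots> = norm v - s" using False nv by (simp add: field_simps abs_if)
      also have "\<dots> \<le> norm v - norm z" using z by simp
      also have "\<dots> \<le> norm (v - z)" by (rule norm_triangle_ineq2)
      finally show ?thesis using False by (simp add: huber_weight_def dist_norm)
    qed
  qed
qed auto

text \<open>This bounds the error of using the weight of \<open>a\<close> in place of that of \<open>b\<close>. The map taking \<open>v\<close> to its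
  weight times \<open>v\<close> is a metric projection and so has Lipschitz constant one, and the weight is at most one.\<close>

lemma huber_weight_lag:
  fixes a b :: "'a::euclidean_space"
  assumes s: "0 < s"
  shows "norm ((huber_weight s (norm b) - huber_weight s (norm a)) *\<^sub>R b) \<le> 2 * norm (b - a)"
proof -
  let ?w = "\<lambda>v::'a. huber_weight s (norm v)"
  have eq: "(?w b - ?w a) *\<^sub>R b = (?w b *\<^sub>R b - ?w a *\<^sub>R a) + ?w a *\<^sub>R (a - b)" by (simp add: algebra_simps)
  have "norm ((?w b - ?w a) *\<^sub>R b) \<le> norm (?w b *\<^sub>R b - ?w a *\<^sub>R a) + norm (?w a *\<^sub>R (a - b))"
    unfolding eq by (rule norm_triangle_ineq)
  also have "norm (?w b *\<^sub>R b - ?w a *\<^sub>R a) \<le> norm (b - a)"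
    using closest_point_lipschitz[of "cball (0::'a) s" b a] s
    by (simp add: huber_weight_projection[OF s] dist_norm)
  also have "norm (?w a *\<^sub>R (a - b)) \<le> norm (b - a)"
    using huber_weight_bounds[OF s, of "norm a"] mult_right_mono[of "?w a" 1 "norm (b - a)"]
    by (simp add: norm_minus_commute)
  finally show ?thesis by simp
qed

section \<open>The semi-implicit step as a finite-dimensional system\<close>

context mesh begin

lemma L0_const: "v \<in> L0 \<T> \<Longrightarrow> T \<in> \<T> \<Longrightarrow> x \<in> interior T \<Longrightarrow> v x = v (point T)"
  using point[of T] unfolding L0_def by fastforce

lemma ess_inf_pos:
  assumes "\<zeta> \<in> L0 \<T>" "ess_inf \<Omega> \<zeta> > 0" "T \<in> \<T>" shows "0 < \<zeta> (point T)"
proof -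
  let ?e = "esssup (lebesgue_on \<Omega>) (\<lambda>x. - ereal (\<zeta> x))"
  have neg: "?e < 0" using assms(2) unfolding ess_inf_def by (simp add: ereal_less_uminus_reorder)
  have "AE x in lebesgue_on \<Omega>. - ereal (\<zeta> x) \<le> ?e" by (rule esssup_AE)
  then obtain x where "x \<in> interior T" "- ereal (\<zeta> x) \<le> ?e" using AE_mesh_point[OF _ assms(3)] by blast
  with neg have "- ereal (\<zeta> x) < 0" by (meson order_le_less_trans)
  then have "0 < \<zeta> x" by simp
  then show ?thesis using L0_const[OF assms(1,3) \<open>x \<in> interior T\<close>] by simp
qed

text \<open>An essential bound on \<open>\<Omega>\<close> holds at some point of each element, and both \<open>\<zeta>\<close> and the gradient are
  constant there.\<close>

lemma gradient_bound:
  assumes \<zeta>: "\<zeta> \<in> L0 \<T>" "\<And>T. T \<in> \<T> \<Longrightarrow> 0 < \<zeta> (point T)"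
    and b: "Linf_norm \<Omega> (\<lambda>x. (1 / \<zeta> x) *\<^sub>R grad u x) < 1"
    and u: "\<And>T x. T \<in> \<T> \<Longrightarrow> x \<in> interior T \<Longrightarrow> u x = G T \<bullet> x + k T" and T: "T \<in> \<T>"
  shows "norm (G T) \<le> \<zeta> (point T)"
proof -
  have "AE x in lebesgue_on \<Omega>. ereal (norm ((1 / \<zeta> x) *\<^sub>R grad u x)) \<le> Linf_norm \<Omega> (\<lambda>x. (1 / \<zeta> x) *\<^sub>R grad u x)"
    unfolding Linf_norm_def by (rule esssup_AE)
  then obtain x where x: "x \<in> interior T" "ereal (norm ((1 / \<zeta> x) *\<^sub>R grad u x)) \<le> Linf_norm \<Omega> (\<lambda>x. (1 / \<zeta> x) *\<^sub>R grad u x)"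
    using AE_mesh_point[OF _ T] by blast
  have "((\<lambda>x. G T \<bullet> x + k T) has_derivative (\<lambda>v. G T \<bullet> v)) (at x)"
    by (auto intro!: derivative_eq_intros)
  then have "(u has_derivative (\<lambda>v. G T \<bullet> v)) (at x)"
    by (rule has_derivative_transform_within_open[OF _ open_interior x(1)]) (simp add: u[OF T])
  then have "frechet_derivative u (at x) = (\<lambda>v. G T \<bullet> v)"
    by (rule frechet_derivative_at[symmetric])
  then have "grad u x = G T" by (simp add: grad_def vec_eq_iff inner_axis)
  moreover have "ereal (norm ((1 / \<zeta> x) *\<^sub>R grad u x)) < 1" using x(2) b by (rule order_le_less_trans)
  ultimately have "norm (G T) / \<bar>\<zeta> x\<bar> < 1" by simp
  then show ?thesis using \<zeta>(2)[OF T] L0_const[OF \<zeta>(1) T x(1)] by (simp add: field_simps)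
qed

end

locale dual_flow = mesh_boundary \<Omega> \<T> \<Gamma>D \<Gamma>N
  for \<Omega> :: "(real^'n) set" and \<T> and \<Gamma>D \<Gamma>N +
  fixes f g \<zeta> uD :: "real^'n \<Rightarrow> real" and \<tau> :: real
  assumes f: "f \<in> L0 \<T>" and g: "g \<in> L0_sides SN" and zeta: "\<zeta> \<in> L0 \<T>" "ess_inf \<Omega> \<zeta> > 0"
    and uD: "uD \<in> L0_sides SD" and tau: "\<tau> > 0"
begin

abbreviation "Kad \<equiv> K_rt \<Omega> \<T> \<Gamma>N f g"
abbreviation "step \<equiv> flow_step \<Omega> \<T> \<Gamma>D \<Gamma>N f g \<zeta> uD \<tau>"
abbreviation "residual \<equiv> flow_residual \<Omega> \<T> \<Gamma>D \<Gamma>N \<zeta> uD"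
abbreviation "N y \<equiv> normal_pairing \<Omega> \<T> \<Gamma>D y uD"
abbreviation "W T \<equiv> huber_weight (\<zeta> (point T))"
text \<open>The average of the difference quotient over the element.\<close>

abbreviation "incr z' z T \<equiv> (1 / \<tau>) *\<^sub>R (avg T z - avg T z')"

lemma zeta_pos: "T \<in> \<T> \<Longrightarrow> 0 < \<zeta> (point T)"
  by (rule ess_inf_pos[OF zeta])

lemma phi_weight_element:
  "T \<in> \<T> \<Longrightarrow> x \<in> interior T \<Longrightarrow> 0 \<le> r \<Longrightarrow> phi_weight \<zeta> x r = W T r"
  using zeta_pos[of T] L0_const[OF zeta(1), of T x] phi_weight_huber[of \<zeta> x r] by simp

lemma avg_d_tau:
  assumes "z' \<in> RT" "z \<in> RT" "T \<in> \<T>"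
  shows "avg T (d_tau \<tau> z' z) = incr z' z T"
proof -
  have "d_tau \<tau> z' z = (\<lambda>x. 0 + (1 / \<tau>) *\<^sub>R (\<lambda>x. z x + (- 1) *\<^sub>R z' x) x)"
    by (rule ext) (simp add: d_tau_def)
  moreover have "(\<lambda>x. z x + (- 1) *\<^sub>R z' x) \<in> RT" using assms by (intro RT0_combine)
  ultimately have "avg T (d_tau \<tau> z' z) = avg T (\<lambda>_. 0) + (1 / \<tau>) *\<^sub>R (avg T z + (- 1) *\<^sub>R avg T z')"
    using avg_combine[OF RT0_zero _ assms(3)] avg_combine[OF assms(2,1,3)] by metis
  moreover have "avg T (\<lambda>_. 0) = 0" by (rule avg_const[OF assms(3)]) simp
  ultimately show ?thesis by simp
qed

lemma pairing_lam_divg: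
  assumes "lam \<in> L0 \<T>" "y \<in> RT"
  shows "pairing \<Omega> lam (divg y) = (\<Sum>T\<in>\<T>. vol T * (lam (point T) * dvg T y))"
  unfolding pairing_def
  by (rule mesh_integral_const) (simp add: L0_const[OF assms(1), symmetric] RT0_divg_dvg[OF assms(2), symmetric])

text \<open>The indicator functions of the elements serve as test functions.\<close>

lemma divergence_constraint_iff:
  assumes z: "z \<in> RT"
  shows "(\<forall>\<eta>\<in>L0 \<T>. pairing \<Omega> (divg z) \<eta> = - pairing \<Omega> f \<eta>) \<longleftrightarrow> (\<forall>T\<in>\<T>. dvg T z = - f (point T))"
proof -
  have p1: "pairing \<Omega> (divg z) \<eta> = (\<Sum>T\<in>\<T>. vol T * (dvg T z * \<eta> (point T)))" if "\<eta> \<in> L0 \<T>" for \<eta>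
    unfolding pairing_def
    by (rule mesh_integral_const) (simp add: L0_const[OF that, symmetric] RT0_divg_dvg[OF z, symmetric])
  have p2: "pairing \<Omega> f \<eta> = (\<Sum>T\<in>\<T>. vol T * (f (point T) * \<eta> (point T)))" if "\<eta> \<in> L0 \<T>" for \<eta>
    unfolding pairing_def
    by (rule mesh_integral_const) (simp add: L0_const[OF that, symmetric] L0_const[OF f, symmetric])
  show ?thesis
  proof
    assume L: "\<forall>\<eta>\<in>L0 \<T>. pairing \<Omega> (divg z) \<eta> = - pairing \<Omega> f \<eta>"
    show "\<forall>T\<in>\<T>. dvg T z = - f (point T)"
    proof
      fix T assume T: "T \<in> \<T>"
      let ?\<eta> = "indicat_real (interior T)"
      have val: "?\<eta> x = (if U = T then 1 else 0)" if "U \<in> \<T>" "x \<in> interior U" for U x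
        using that interior_disjoint[OF T that(1)] interior_subset[of U] by (auto simp: indicator_def)
      have \<eta>: "?\<eta> \<in> L0 \<T>" unfolding L0_def using val by blast
      have pt: "?\<eta> (point U) = (if U = T then 1 else 0)" if "U \<in> \<T>" for U using val[OF that point[OF that]] .
      have sel: "(\<Sum>U\<in>\<T>. vol U * (h U * ?\<eta> (point U))) = vol T * h T" for h
      proof -
        have "(\<Sum>U\<in>\<T>. vol U * (h U * ?\<eta> (point U))) = (\<Sum>U\<in>\<T>. if U = T then vol U * h U else 0)"
          by (intro sum.cong) (auto simp: pt)
        then show ?thesis using T by simp
      qed
      have "vol T * dvg T z = - (vol T * f (point T))"
        using bspec[OF L \<eta>] unfolding p1[OF \<eta>] p2[OF \<eta>] sel[of "\<lambda>U. dvg U z"] sel[of "\<lambda>U. f (point U)"] .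
      then have "vol T * dvg T z = vol T * (- f (point T))" by simp
      then show "dvg T z = - f (point T)" using element_measure_pos[OF T] by (subst (asm) mult_cancel_left) auto
    qed
  next
    assume "\<forall>T\<in>\<T>. dvg T z = - f (point T)"
    then show "\<forall>\<eta>\<in>L0 \<T>. pairing \<Omega> (divg z) \<eta> = - pairing \<Omega> f \<eta>"
      by (simp add: p1 p2 sum_negf)
  qed
qed

lemma flow_step_iff:
  assumes z': "z' \<in> RT"
  shows "step z' z lam \<longleftrightarrow>
    z \<in> RT \<and> lam \<in> L0 \<T> \<and> (\<forall>S\<in>SN. bflux S z = g (side_point S)) \<and>
    (\<forall>T\<in>\<T>. dvg T z = - f (point T)) \<and>
    (\<forall>y\<in>RTN.
      (\<Sum>T\<in>\<T>. vol T * ((incr z' z T + W T (norm (avg T z')) *\<^sub>R avg T z) \<bullet> avg T y))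
      + (\<Sum>T\<in>\<T>. vol T * (lam (point T) * dvg T y)) = N y)"
proof (cases "z \<in> RT \<and> lam \<in> L0 \<T>")
  case False
  then show ?thesis by (auto simp: flow_step_def)
next
  case True
  then have z: "z \<in> RT" and lam: "lam \<in> L0 \<T>" by auto
  have A: "pairing \<Omega> (\<lambda>x. Pi_h \<T> (d_tau \<tau> z' z) x + phi_weight \<zeta> x (norm (Pi_h \<T> z' x)) *\<^sub>R Pi_h \<T> z x) (Pi_h \<T> y)
     = (\<Sum>T\<in>\<T>. vol T * ((incr z' z T + W T (norm (avg T z')) *\<^sub>R avg T z) \<bullet> avg T y))" for y
    unfolding pairing_def
    by (rule mesh_integral_const) (simp add: Pi_h_eq avg_d_tau[OF z' z] phi_weight_element)
  have ne: "\<exists>y. y \<in> RTN" "\<exists>\<eta>. \<eta> \<in> L0 \<T>" using RT0_N_zero f by blast+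
  have N: "y \<in> RTN \<Longrightarrow> y \<in> RT" for y by (simp add: RT0_N_iff)
  have "(\<forall>y\<in>RTN. \<forall>\<eta>\<in>L0 \<T>.
        pairing \<Omega> (\<lambda>x. Pi_h \<T> (d_tau \<tau> z' z) x + phi_weight \<zeta> x (norm (Pi_h \<T> z' x)) *\<^sub>R Pi_h \<T> z x) (Pi_h \<T> y)
          + pairing \<Omega> lam (divg y) = N y \<and> pairing \<Omega> (divg z) \<eta> = - pairing \<Omega> f \<eta>)
    \<longleftrightarrow> (\<forall>y\<in>RTN.
        pairing \<Omega> (\<lambda>x. Pi_h \<T> (d_tau \<tau> z' z) x + phi_weight \<zeta> x (norm (Pi_h \<T> z' x)) *\<^sub>R Pi_h \<T> z x) (Pi_h \<T> y)
          + pairing \<Omega> lam (divg y) = N y) \<and> (\<forall>\<eta>\<in>L0 \<T>. pairing \<Omega> (divg z) \<eta> = - pairing \<Omega> f \<eta>)"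
    using ne by blast
  then show ?thesis
    unfolding flow_step_def A normal_eq_on_iff[OF z g] divergence_constraint_iff[OF z]
    using z lam pairing_lam_divg[OF lam N] by auto
qed

lemma K_rt_iff:
  "z \<in> Kad \<longleftrightarrow> z \<in> RT \<and> (\<forall>T\<in>\<T>. dvg T z = - f (point T)) \<and> (\<forall>S\<in>SN. bflux S z = g (side_point S))"
proof (cases "z \<in> RT")
  case False then show ?thesis by (simp add: K_rt_def)
next
  case True
  have "(AE x in lebesgue_on \<Omega>. divg z x = - f x) \<longleftrightarrow> (\<forall>T\<in>\<T>. dvg T z = - f (point T))"
  proof
    assume AE: "AE x in lebesgue_on \<Omega>. divg z x = - f x"
    show "\<forall>T\<in>\<T>. dvg T z = - f (point T)"
    proof
      fix T assume T: "T \<in> \<T>"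
      obtain x where "x \<in> interior T" "divg z x = - f x" using AE_mesh_point[OF AE T] .
      then show "dvg T z = - f (point T)" using RT0_divg_dvg[OF True T] L0_const[OF f T] by simp
    qed
  next
    assume "\<forall>T\<in>\<T>. dvg T z = - f (point T)"
    then show "AE x in lebesgue_on \<Omega>. divg z x = - f x"
      by (intro AE_mesh) (simp add: RT0_divg_dvg[OF True] L0_const[OF f, symmetric])
  qed
  then show ?thesis using True by (simp add: K_rt_def normal_eq_on_iff[OF True g])
qed

definition energy :: "(real^'n \<Rightarrow> real^'n) \<Rightarrow> real" where
  "energy z = (\<Sum>T\<in>\<T>. vol T * huber (\<zeta> (point T)) (norm (avg T z))) - N z"

lemma D_rt_energy:
  assumes "z \<in> Kad"
  shows "- D_rt \<Omega> \<T> \<Gamma>D \<Gamma>N f g \<zeta> uD z = ereal (energy z)"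
proof -
  have "(LINT x:\<Omega>|lebesgue. phi_star \<zeta> x (norm (Pi_h \<T> z x))) = (\<Sum>T\<in>\<T>. vol T * huber (\<zeta> (point T)) (norm (avg T z)))"
    by (rule mesh_integral_const) (simp add: Pi_h_eq phi_star_huber L0_const[OF zeta(1), symmetric])
  then show ?thesis using assms by (simp add: D_rt_def energy_def)
qed

lemma L2norm_increment:
  assumes "z' \<in> RT" "z \<in> RT"
  shows "(L2norm \<Omega> (Pi_h \<T> (d_tau \<tau> z' z)))\<^sup>2 = (\<Sum>T\<in>\<T>. vol T * (norm (incr z' z T))\<^sup>2)"
proof -
  have "(LINT x:\<Omega>|lebesgue. (norm (Pi_h \<T> (d_tau \<tau> z' z) x))\<^sup>2) = (\<Sum>T\<in>\<T>. vol T * (norm (incr z' z T))\<^sup>2)"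
    by (rule mesh_integral_const) (simp add: Pi_h_eq avg_d_tau[OF assms])
  moreover have "0 \<le> (\<Sum>T\<in>\<T>. vol T * (norm (incr z' z T))\<^sup>2)" by (intro sum_nonneg) auto
  ultimately show ?thesis by (simp add: L2norm_def)
qed

lemma difference_admissible:
  assumes "z \<in> Kad" "w \<in> Kad"
  defines "y \<equiv> \<lambda>x. z x + (- 1) *\<^sub>R w x"
  shows "y \<in> RTN" "T \<in> \<T> \<Longrightarrow> dvg T y = 0" "T \<in> \<T> \<Longrightarrow> avg T y = avg T z - avg T w" "N y = N z - N w"
proof -
  have zw: "z \<in> RT" "w \<in> RT" using assms by (auto simp: K_rt_iff)
  have "bflux S y = 0" if "S \<in> SN" for S
    using that assms(1,2) sides_on_subset(2) bflux_combine[OF zw, of S "- 1"] by (auto simp: K_rt_iff y_def)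
  then show "y \<in> RTN" using RT0_combine[OF zw] unfolding RT0_N_iff y_def by blast
  show "T \<in> \<T> \<Longrightarrow> dvg T y = 0" using assms(1,2) dvg_combine[OF zw, of T "- 1"] by (simp add: K_rt_iff y_def)
  show "T \<in> \<T> \<Longrightarrow> avg T y = avg T z - avg T w" using avg_combine[OF zw, of T "- 1"] by (simp add: y_def)
  show "N y = N z - N w" using normal_pairing_combine[OF zw uD, of "- 1"] by (simp add: y_def)
qed

lemma flow_step_K_rt:
  assumes "z' \<in> RT" "step z' z lam"
  shows "z \<in> Kad"
  using assms(2) unfolding flow_step_iff[OF assms(1)] K_rt_iff by blast

lemma flow_step_test:
  assumes "z' \<in> RT" "step z' z lam"
    and "y \<in> RTN" "\<And>T. T \<in> \<T> \<Longrightarrow> dvg T y = 0"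
  shows "(\<Sum>T\<in>\<T>. vol T * ((incr z' z T + W T (norm (avg T z')) *\<^sub>R avg T z) \<bullet> avg T y)) = N y"
proof -
  have "(\<Sum>T\<in>\<T>. vol T * ((incr z' z T + W T (norm (avg T z')) *\<^sub>R avg T z) \<bullet> avg T y))
      + (\<Sum>T\<in>\<T>. vol T * (lam (point T) * dvg T y)) = N y"
    using assms(2,3) unfolding flow_step_iff[OF assms(1)] by blast
  moreover have "(\<Sum>T\<in>\<T>. vol T * (lam (point T) * dvg T y)) = 0"
    by (rule sum.neutral) (simp add: assms(4))
  ultimately show ?thesis by simp
qed

lemma weighted_definite:
  assumes y: "y \<in> RT" and dv: "\<And>T. T \<in> \<T> \<Longrightarrow> dvg T y = 0" and w: "\<And>T. T \<in> \<T> \<Longrightarrow> 0 < w T"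
    and zero: "(\<Sum>T\<in>\<T>. vol T * (w T * (avg T y \<bullet> avg T y))) = 0" and T: "T \<in> \<T>"
  shows "avg T y = 0" "x \<in> interior T \<Longrightarrow> y x = 0"
proof -
  have "0 \<le> vol T * (w T * (avg T y \<bullet> avg T y))" if "T \<in> \<T>" for T
    using w[OF that] by simp
  then have "vol T * (w T * (avg T y \<bullet> avg T y)) = 0"
    using zero T by (simp add: sum_nonneg_eq_0_iff)
  then show a: "avg T y = 0" using element_measure_pos[OF T] w[OF T] by simp
  show "x \<in> interior T \<Longrightarrow> y x = 0" using RT0_divergence_free[OF y T dv[OF T]] a by simp
qed

lemma flow_step_unique:
  assumes z': "z' \<in> RT" and z: "step z' z lam"
    and w: "step z' w lam'"
  shows "AE x in lebesgue_on \<Omega>. w x = z x"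
proof (rule AE_mesh)
  fix T x assume T: "T \<in> \<T>" "x \<in> interior T"
  note K = flow_step_K_rt[OF z' z] flow_step_K_rt[OF z' w]
  define y where "y = (\<lambda>x. z x + (- 1) *\<^sub>R w x)"
  note y = difference_admissible[OF K, folded y_def]
  let ?m = "\<lambda>T. 1 / \<tau> + W T (norm (avg T z'))"
  have "0 = (\<Sum>T\<in>\<T>. vol T * ((incr z' z T + W T (norm (avg T z')) *\<^sub>R avg T z) \<bullet> avg T y))
    - (\<Sum>T\<in>\<T>. vol T * ((incr z' w T + W T (norm (avg T z')) *\<^sub>R avg T w) \<bullet> avg T y))"
    using flow_step_test[OF z' z y(1,2)] flow_step_test[OF z' w y(1,2)] by simp
  also have "\<dots> = (\<Sum>T\<in>\<T>. vol T * (?m T * (avg T y \<bullet> avg T y)))"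
    unfolding sum_subtractf[symmetric]
    by (intro sum.cong refl) (simp add: y(3) inner_diff_left inner_diff_right inner_add_left algebra_simps)
  finally have "(\<Sum>T\<in>\<T>. vol T * (?m T * (avg T y \<bullet> avg T y))) = 0" by simp
  moreover have "0 < ?m T" if "T \<in> \<T>" for T
    using huber_weight_bounds(1)[OF zeta_pos[OF that]] tau by (simp add: add_pos_pos)
  moreover have "y \<in> RT" using y(1) by (simp add: RT0_N_iff)
  ultimately have "y x = 0" using weighted_definite(2)[of y ?m] y(2) T by blast
  then show "w x = z x" by (simp add: y_def)
qed

text \<open>The Riesz theorem is applied twice: on the divergence-free fields, to correct \<open>z0\<close> such that \<open>R z\<close>, the
  defect of the equation without the multiplier, vanishes on them; and on all test fields, to write
  \<open>R z\<close> as a combination of the element divergences.\<close>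

lemma flow_step_exists:
  assumes z': "z' \<in> RT" and z0: "z0 \<in> Kad"
  shows "\<exists>z lam. step z' z lam"
proof -
  let ?m = "\<lambda>T. 1 / \<tau> + W T (norm (avg T z'))"
  have m: "0 < ?m T" if "T \<in> \<T>" for T
    using huber_weight_bounds(1)[OF zeta_pos[OF that]] tau by (simp add: add_pos_pos)
  define M where "M z T = incr z' z T + W T (norm (avg T z')) *\<^sub>R avg T z" for z T
  define R where "R z y = N y - (\<Sum>T\<in>\<T>. vol T * (M z T \<bullet> avg T y))" for z y
  define B where "B u v = (\<Sum>T\<in>\<T>. vol T * (?m T * (avg T u \<bullet> avg T v)))" for u v
  define Z where "Z = {y \<in> RTN. \<forall>T\<in>\<T>. dvg T y = 0}"
  have ZR: "y \<in> RT" "y \<in> RTN" "\<And>T. T \<in> \<T> \<Longrightarrow> dvg T y = 0" if "y \<in> Z" for y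
    using that by (auto simp: Z_def RT0_N_iff)
  have NR: "y \<in> RT" if "y \<in> RTN" for y using that by (simp add: RT0_N_iff)
  have R_lin: "R z (\<lambda>x. u x + c *\<^sub>R v x) = R z u + c * R z v" if "u \<in> RT" "v \<in> RT" for z u v c
  proof -
    have "(\<Sum>T\<in>\<T>. vol T * (M z T \<bullet> avg T (\<lambda>x. u x + c *\<^sub>R v x)))
        = (\<Sum>T\<in>\<T>. vol T * (M z T \<bullet> avg T u) + c * (vol T * (M z T \<bullet> avg T v)))"
      using that by (intro sum.cong refl) (simp add: avg_combine inner_add_right distrib_left)
    then show ?thesis
      using normal_pairing_combine[OF that uD, of c]
      by (simp add: R_def sum.distrib sum_distrib_left[symmetric] right_diff_distrib)
  qed
  have R_null: "R z u = 0" if u: "u \<in> Z" and u0: "\<And>T. T \<in> \<T> \<Longrightarrow> avg T u = 0" for z u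
  proof -
    have "u x = 0" if "T \<in> \<T>" "x \<in> interior T" for T x
      using RT0_divergence_free[OF ZR(1)[OF u] that(1) ZR(3)[OF u that(1)] that(2)] u0[OF that(1)] by simp
    then have "N u = 0" using normal_pairing_zero[OF ZR(1)[OF u] uD] by blast
    then show ?thesis using u0 by (simp add: R_def)
  qed
  have "\<exists>x\<in>Z. \<forall>y\<in>Z. R z0 y = B x y"
  proof (rule riesz_finitely_many_functionals[where I = "\<T> \<times> (UNIV :: 'n set)" and \<phi> = "\<lambda>(T, i) y. avg T y $ i"])
    show "finite (\<T> \<times> (UNIV :: 'n set))" by simp
    have "dvg T (\<lambda>_. 0) = 0" if "T \<in> \<T>" for T
      using RT0_dvg[OF that, of "\<lambda>_. 0" 0 0] by simp
    then show "(\<lambda>_. 0) \<in> Z" using RT0_N_zero by (simp add: Z_def)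
    show "(\<lambda>x. u x + c *\<^sub>R v x) \<in> Z" if "u \<in> Z" "v \<in> Z" for u v c
    proof -
      have "dvg T (\<lambda>x. u x + c *\<^sub>R v x) = 0" if T: "T \<in> \<T>" for T
        using dvg_combine[OF ZR(1)[OF \<open>u \<in> Z\<close>] ZR(1)[OF \<open>v \<in> Z\<close>] T] ZR(3)[OF \<open>u \<in> Z\<close> T] ZR(3)[OF \<open>v \<in> Z\<close> T] by simp
      then show ?thesis using RT0_N_combine[OF ZR(2)[OF that(1)] ZR(2)[OF that(2)]] unfolding Z_def by blast
    qed
    show "(case i of (T, i) \<Rightarrow> \<lambda>y. avg T y $ i) (\<lambda>x. u x + c *\<^sub>R v x) =
        (case i of (T, i) \<Rightarrow> \<lambda>y. avg T y $ i) u + c * (case i of (T, i) \<Rightarrow> \<lambda>y. avg T y $ i) v"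
      if "i \<in> \<T> \<times> UNIV" "u \<in> Z" "v \<in> Z" for i u v c
      using that ZR by (auto simp: avg_combine)
    show "B u v = B v u" for u v by (simp add: B_def inner_commute)
    show "B (\<lambda>x. u x + c *\<^sub>R v x) w = B u w + c * B v w" if "u \<in> Z" "v \<in> Z" "w \<in> Z" for u v w c
      using that ZR by (simp add: B_def avg_combine inner_add_left algebra_simps sum.distrib sum_distrib_left)
    show "(case i of (T, i) \<Rightarrow> \<lambda>y. avg T y $ i) u = 0" if "u \<in> Z" "B u u = 0" "i \<in> \<T> \<times> UNIV" for u i
      using weighted_definite(1)[OF ZR(1)[OF that(1)] ZR(3)[OF that(1)] m that(2)[unfolded B_def]] that(3) by auto
    show "B u w = 0" if u0: "\<forall>i\<in>\<T> \<times> UNIV. (case i of (T, i) \<Rightarrow> \<lambda>y. avg T y $ i) u = 0" for u w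
    proof -
      have "avg T u = 0" if "T \<in> \<T>" for T using that u0 by (auto simp: vec_eq_iff)
      then show ?thesis by (simp add: B_def)
    qed
    show "R z0 (\<lambda>x. u x + c *\<^sub>R v x) = R z0 u + c * R z0 v" if "u \<in> Z" "v \<in> Z" for u v c
      using that ZR R_lin by blast
    show "R z0 u = 0" if "u \<in> Z" "\<forall>i\<in>\<T> \<times> UNIV. (case i of (T, i) \<Rightarrow> \<lambda>y. avg T y $ i) u = 0" for u
      using that by (intro R_null) (auto simp: vec_eq_iff)
  qed
  then obtain x where x: "x \<in> Z" "\<And>y. y \<in> Z \<Longrightarrow> R z0 y = B x y" by blast
  define z where "z = (\<lambda>p. z0 p + 1 *\<^sub>R x p)"
  have z0R: "z0 \<in> RT" using z0 by (simp add: K_rt_iff)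
  have zR: "z \<in> RT" unfolding z_def by (rule RT0_combine[OF z0R ZR(1)[OF x(1)]])
  have zavg: "avg T z = avg T z0 + avg T x" if "T \<in> \<T>" for T
    unfolding z_def using avg_combine[OF z0R ZR(1)[OF x(1)] that, of 1] by simp
  have Rz: "R z y = 0" if "y \<in> Z" for y
  proof -
    have "M z T = M z0 T + ?m T *\<^sub>R avg T x" if "T \<in> \<T>" for T
      using zavg[OF that] by (simp add: M_def algebra_simps)
    then have "(\<Sum>T\<in>\<T>. vol T * (M z T \<bullet> avg T y))
        = (\<Sum>T\<in>\<T>. vol T * (M z0 T \<bullet> avg T y) + vol T * (?m T * (avg T x \<bullet> avg T y)))"
      by (intro sum.cong refl) (simp add: inner_add_left distrib_left)
    then have "R z y = R z0 y - B x y"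
      by (simp add: R_def B_def sum.distrib)
    then show ?thesis using x(2)[OF that] by simp
  qed
  have "\<exists>x\<in>RTN. \<forall>y\<in>RTN. R z y = (\<Sum>T\<in>\<T>. dvg T x * dvg T y)"
  proof (rule riesz_finitely_many_functionals[where I = \<T> and \<phi> = dvg])
    show "(\<lambda>_. 0) \<in> RTN" by (rule RT0_N_zero)
    show "(\<Sum>T\<in>\<T>. dvg T (\<lambda>x. u x + c *\<^sub>R v x) * dvg T w) = (\<Sum>T\<in>\<T>. dvg T u * dvg T w) + c * (\<Sum>T\<in>\<T>. dvg T v * dvg T w)"
      if "u \<in> RTN" "v \<in> RTN" for u v w c
      using that NR by (simp add: dvg_combine algebra_simps sum.distrib sum_distrib_left)
    show "dvg i u = 0" if "(\<Sum>T\<in>\<T>. dvg T u * dvg T u) = 0" "i \<in> \<T>" for u i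
      using that by (simp add: sum_nonneg_eq_0_iff)
    show "R z u = 0" if "u \<in> RTN" "\<forall>i\<in>\<T>. dvg i u = 0" for u
      using that by (intro Rz) (simp add: Z_def)
  qed (auto simp: RT0_N_combine NR dvg_combine R_lin mult.commute)
  then obtain \<mu> where \<mu>: "\<And>y. y \<in> RTN \<Longrightarrow> R z y = (\<Sum>T\<in>\<T>. dvg T \<mu> * dvg T y)" by blast
  \<comment> \<open>Dividing by the volume makes the integral of \<open>lam\<close> against a divergence the required combination.\<close>
  define lam where "lam p = (\<Sum>T\<in>\<T>. indicat_real (interior T) p * (dvg T \<mu> / vol T))" for p
  have lam: "lam p = dvg T \<mu> / vol T" if T: "T \<in> \<T>" "p \<in> interior T" for T p
  proof -
    have "indicat_real (interior U) p * (dvg U \<mu> / vol U) = (if U = T then dvg T \<mu> / vol T else 0)" if "U \<in> \<T>" for U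
      using interior_disjoint[OF T(1) that] T interior_subset[of U] by (auto simp: indicator_def)
    then show ?thesis using T by (simp add: lam_def)
  qed
  have "lam \<in> L0 \<T>" unfolding L0_def using lam by blast
  moreover have "(\<Sum>T\<in>\<T>. vol T * ((incr z' z T + W T (norm (avg T z')) *\<^sub>R avg T z) \<bullet> avg T y))
      + (\<Sum>T\<in>\<T>. vol T * (lam (point T) * dvg T y)) = N y" if y: "y \<in> RTN" for y
  proof -
    have "(\<Sum>T\<in>\<T>. vol T * (lam (point T) * dvg T y)) = (\<Sum>T\<in>\<T>. dvg T \<mu> * dvg T y)"
      using element_measure_pos by (intro sum.cong refl) (fastforce simp: lam[OF _ point])
    then show ?thesis using \<mu>[OF y] by (simp add: R_def M_def)
  qed
  moreover have "\<forall>S\<in>SN. bflux S z = g (side_point S)"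
    using z0 ZR(2)[OF x(1)] sides_on_subset(2) bflux_combine[OF z0R ZR(1)[OF x(1)], of _ 1]
    by (auto simp: K_rt_iff RT0_N_iff z_def)
  moreover have "\<forall>T\<in>\<T>. dvg T z = - f (point T)"
    using z0 ZR(3)[OF x(1)] dvg_combine[OF z0R ZR(1)[OF x(1)], of _ 1] by (simp add: K_rt_iff z_def)
  ultimately have "step z' z lam"
    unfolding flow_step_iff[OF z'] using zR by blast
  then show ?thesis by blast
qed

end

section \<open>Stability and termination\<close>

context dual_flow begin

text \<open>The step is tested with the increment \<open>y = z - z'\<close>, whose averages are \<open>\<tau>\<close> times those of the
  difference quotient; \<open>huber_step\<close> compares the weighted term with the change of the energy density.\<close>

lemma energy_decreases:
  assumes z': "z' \<in> Kad" and step: "step z' z lam"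
  shows "energy z + \<tau> * (\<Sum>T\<in>\<T>. vol T * (norm (incr z' z T))\<^sup>2) \<le> energy z'"
proof -
  have z'R: "z' \<in> RT" using z' by (simp add: K_rt_iff)
  have z: "z \<in> Kad" by (rule flow_step_K_rt[OF z'R step])
  define y where "y = (\<lambda>x. z x + (- 1) *\<^sub>R z' x)"
  note y = difference_admissible[OF z z', folded y_def]
  have "(\<Sum>T\<in>\<T>. vol T * (\<tau> * (norm (incr z' z T))\<^sup>2
        + (huber (\<zeta> (point T)) (norm (avg T z)) - huber (\<zeta> (point T)) (norm (avg T z')))))
     \<le> (\<Sum>T\<in>\<T>. vol T * ((incr z' z T + W T (norm (avg T z')) *\<^sub>R avg T z) \<bullet> avg T y))"
  proof (rule sum_mono, rule mult_left_mono)
    fix T assume T: "T \<in> \<T>"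
    have "avg T y = \<tau> *\<^sub>R incr z' z T" using tau by (simp add: y(3)[OF T])
    then have "incr z' z T \<bullet> avg T y = \<tau> * (norm (incr z' z T))\<^sup>2"
      by (simp only: inner_scaleR_right power2_norm_eq_inner)
    moreover have "huber (\<zeta> (point T)) (norm (avg T z)) - huber (\<zeta> (point T)) (norm (avg T z'))
        \<le> W T (norm (avg T z')) * (avg T z \<bullet> avg T y)"
      using huber_step[OF zeta_pos[OF T], of "avg T z" "avg T z'"] by (simp add: y(3)[OF T])
    ultimately show "\<tau> * (norm (incr z' z T))\<^sup>2
        + (huber (\<zeta> (point T)) (norm (avg T z)) - huber (\<zeta> (point T)) (norm (avg T z')))
      \<le> (incr z' z T + W T (norm (avg T z')) *\<^sub>R avg T z) \<bullet> avg T y"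
      unfolding inner_add_left inner_scaleR_left by linarith
  qed simp
  also have "\<dots> = N z - N z'" using flow_step_test[OF z'R step y(1,2)] y(4) by simp
  also have "(\<Sum>T\<in>\<T>. vol T * (\<tau> * (norm (incr z' z T))\<^sup>2
        + (huber (\<zeta> (point T)) (norm (avg T z)) - huber (\<zeta> (point T)) (norm (avg T z')))))
      = \<tau> * (\<Sum>T\<in>\<T>. vol T * (norm (incr z' z T))\<^sup>2)
        + ((\<Sum>T\<in>\<T>. vol T * huber (\<zeta> (point T)) (norm (avg T z))) - (\<Sum>T\<in>\<T>. vol T * huber (\<zeta> (point T)) (norm (avg T z'))))"
    by (simp only: distrib_left right_diff_distrib sum.distrib sum_subtractf sum_distrib_left mult.left_commute)
  finally show ?thesis by (simp add: energy_def)
qed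

text \<open>For \<open>y = z - z0\<close> the boundary term is the integral of \<open>y\<close> against the gradient of the lift, so it is at
  most the sum of \<open>\<zeta> |z|\<close> and \<open>\<zeta> |z0|\<close> integrated. The first part is absorbed by the Huber density, which
  stays above \<open>\<zeta> r - \<zeta>\<^sup>2 / 2\<close>.\<close>

lemma energy_bounded_below:
  assumes u: "u \<in> CR1 \<Omega> \<T>"
    and trace: "\<And>S x. S \<in> SD \<Longrightarrow> x \<in> rel_interior S \<Longrightarrow> pi_h \<T> SD u x = uD x"
    and bound: "Linf_norm \<Omega> (\<lambda>x. (1 / \<zeta> x) *\<^sub>R grad u x) < 1"
    and z0: "z0 \<in> Kad"
  obtains m where "\<And>z. z \<in> Kad \<Longrightarrow> m \<le> energy z"
proof -
  have "\<forall>T\<in>\<T>. \<exists>p. \<forall>x\<in>interior T. u x = fst p \<bullet> x + snd p"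
  proof
    fix T assume "T \<in> \<T>"
    moreover have "\<forall>T\<in>\<T>. \<exists>a c. \<forall>x\<in>interior T. u x = a \<bullet> x + c" using u by (simp add: CR1_def L1_def)
    ultimately obtain a c where "\<forall>x\<in>interior T. u x = a \<bullet> x + c" by blast
    then show "\<exists>p. \<forall>x\<in>interior T. u x = fst p \<bullet> x + snd p" by (intro exI[of _ "(a, c)"]) simp
  qed
  then obtain p where p: "\<forall>T\<in>\<T>. \<forall>x\<in>interior T. u x = fst (p T) \<bullet> x + snd (p T)"
    by (rule bchoice[THEN exE])
  define G k where "G T = fst (p T)" and "k T = snd (p T)" for T
  have Gk: "u x = G T \<bullet> x + k T" if "T \<in> \<T>" "x \<in> interior T" for T x
    using p that by (simp add: G_def k_def)
  have G: "norm (G T) \<le> \<zeta> (point T)" if "T \<in> \<T>" for T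
    by (rule gradient_bound[OF zeta(1) _ bound _ that, where k = k]) (simp_all add: zeta_pos Gk)
  show ?thesis
  proof (rule that)
    fix z assume z: "z \<in> Kad"
    define y where "y = (\<lambda>x. z x + (- 1) *\<^sub>R z0 x)"
    note y = difference_admissible[OF z z0, folded y_def]
    have Ny: "N y = (\<Sum>T\<in>\<T>. vol T * (avg T y \<bullet> G T))"
      by (rule integration_by_parts[OF y(1) _ u uD, where G = G and k = k]) (simp_all add: y(2) trace Gk)
    have "(\<Sum>T\<in>\<T>. vol T * (- (\<zeta> (point T))\<^sup>2 / 2 - \<zeta> (point T) * norm (avg T z0)))
       \<le> (\<Sum>T\<in>\<T>. vol T * (huber (\<zeta> (point T)) (norm (avg T z)) - avg T y \<bullet> G T))"
    proof (rule sum_mono, rule mult_left_mono)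
      fix T assume T: "T \<in> \<T>"
      let ?s = "\<zeta> (point T)"
      have "avg T y \<bullet> G T \<le> norm (avg T y) * norm (G T)" by (rule norm_cauchy_schwarz)
      also have "\<dots> \<le> (norm (avg T z) + norm (avg T z0)) * ?s"
        using G[OF T] by (intro mult_mono) (auto simp: y(3)[OF T] norm_triangle_ineq4)
      finally have "avg T y \<bullet> G T \<le> ?s * norm (avg T z) + ?s * norm (avg T z0)" by (simp add: algebra_simps)
      then show "- ?s\<^sup>2 / 2 - ?s * norm (avg T z0) \<le> huber ?s (norm (avg T z)) - avg T y \<bullet> G T"
        using huber_lower[of ?s "norm (avg T z)"] by linarith
    qed simp
    also have "\<dots> = energy z + N z0"
      using y(4) by (simp add: energy_def right_diff_distrib sum_subtractf Ny[symmetric])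
    finally show "(\<Sum>T\<in>\<T>. vol T * (- (\<zeta> (point T))\<^sup>2 / 2 - \<zeta> (point T) * norm (avg T z0))) - N z0 \<le> energy z" by simp
  qed
qed

text \<open>Subtracting the equation of the step eliminates both the multiplier and the boundary term.\<close>

lemma residual_equation:
  assumes z': "z' \<in> RT" and step: "step z' z lam"
    and y: "y \<in> RTN"
  shows "pairing \<Omega> (\<lambda>x. phi_weight \<zeta> x (norm (Pi_h \<T> z x)) *\<^sub>R Pi_h \<T> z x) (Pi_h \<T> y)
      + pairing \<Omega> lam (divg y) - N y
    = (\<Sum>T\<in>\<T>. vol T * (((W T (norm (avg T z)) - W T (norm (avg T z'))) *\<^sub>R avg T z - incr z' z T) \<bullet> avg T y))"
proof -
  have yR: "y \<in> RT" using y by (simp add: RT0_N_iff)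
  have lam: "lam \<in> L0 \<T>"
    and eq: "(\<Sum>T\<in>\<T>. vol T * ((incr z' z T + W T (norm (avg T z')) *\<^sub>R avg T z) \<bullet> avg T y))
      + (\<Sum>T\<in>\<T>. vol T * (lam (point T) * dvg T y)) = N y"
    using step y unfolding flow_step_iff[OF z'] by blast+
  have "pairing \<Omega> (\<lambda>x. phi_weight \<zeta> x (norm (Pi_h \<T> z x)) *\<^sub>R Pi_h \<T> z x) (Pi_h \<T> y)
      = (\<Sum>T\<in>\<T>. vol T * ((W T (norm (avg T z)) *\<^sub>R avg T z) \<bullet> avg T y))"
    unfolding pairing_def by (rule mesh_integral_const) (simp add: Pi_h_eq phi_weight_element)
  moreover have "(\<Sum>T\<in>\<T>. vol T * (((W T (norm (avg T z)) - W T (norm (avg T z'))) *\<^sub>R avg T z - incr z' z T) \<bullet> avg T y))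
    = (\<Sum>T\<in>\<T>. vol T * ((W T (norm (avg T z)) *\<^sub>R avg T z) \<bullet> avg T y))
     - (\<Sum>T\<in>\<T>. vol T * ((incr z' z T + W T (norm (avg T z')) *\<^sub>R avg T z) \<bullet> avg T y))"
    unfolding sum_subtractf[symmetric] right_diff_distrib[symmetric] inner_diff_left[symmetric]
    by (intro sum.cong refl arg_cong[where f = "\<lambda>v. _ * (v \<bullet> _)"]) (simp only: scaleR_left_diff_distrib, simp)
  ultimately show ?thesis using eq pairing_lam_divg[OF lam yR] by simp
qed

text \<open>The residual is its own test field. With \<open>K = 1 + 2 \<tau>\<close> the coefficients in \<open>residual_equation\<close> are at most
  \<open>K\<close> times the difference quotient, because the change of the weight costs at most twice the increment
  \<open>\<tau>\<close> times the quotient.\<close>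

lemma residual_bound:
  assumes z': "z' \<in> RT" and step: "step z' z lam"
    and r: "residual z lam r"
  shows "(L2norm \<Omega> r)\<^sup>2 \<le> (1 + 2 * \<tau>)\<^sup>2 * (\<Sum>T\<in>\<T>. vol T * (norm (incr z' z T))\<^sup>2)"
proof -
  have rN: "r \<in> RTN" using r by (simp add: flow_residual_def)
  then have rR: "r \<in> RT" by (simp add: RT0_N_iff)
  let ?e = "\<lambda>T. (W T (norm (avg T z)) - W T (norm (avg T z'))) *\<^sub>R avg T z - incr z' z T"
  let ?K = "1 + 2 * \<tau>"
  have "pairing \<Omega> r r = (\<Sum>T\<in>\<T>. vol T * (?e T \<bullet> avg T r))"
    using r rN residual_equation[OF z' step rN] by (simp add: flow_residual_def)
  also have "\<dots> \<le> (\<Sum>T\<in>\<T>. vol T * (?K\<^sup>2 * (norm (incr z' z T))\<^sup>2 / 2 + (norm (avg T r))\<^sup>2 / 2))"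
  proof (rule sum_mono, rule mult_left_mono)
    fix T assume T: "T \<in> \<T>"
    have d: "norm (avg T z - avg T z') = \<tau> * norm (incr z' z T)" using tau by simp
    have "norm (?e T) \<le> norm ((W T (norm (avg T z)) - W T (norm (avg T z'))) *\<^sub>R avg T z) + norm (incr z' z T)"
      by (rule norm_triangle_ineq4)
    also have "\<dots> \<le> 2 * norm (avg T z - avg T z') + norm (incr z' z T)"
      using huber_weight_lag[OF zeta_pos[OF T], of "avg T z" "avg T z'"] by linarith
    also have "\<dots> = ?K * norm (incr z' z T)" unfolding d by (simp only: distrib_right mult.assoc mult_1 add.commute)
    finally have e: "norm (?e T) \<le> ?K * norm (incr z' z T)" .
    have "?e T \<bullet> avg T r \<le> norm (?e T) * norm (avg T r)" by (rule norm_cauchy_schwarz)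
    also have "\<dots> \<le> (?K * norm (incr z' z T)) * norm (avg T r)" using e by (intro mult_right_mono) auto
    \<comment> \<open>Half of the squared norm of the residual is absorbed on the left-hand side.\<close>
    also have "\<dots> \<le> (?K * norm (incr z' z T))\<^sup>2 / 2 + (norm (avg T r))\<^sup>2 / 2"
    proof -
      have "a * b \<le> a\<^sup>2 / 2 + b\<^sup>2 / 2" for a b :: real
        using sum_squares_bound[of a b] by simp
      then show ?thesis .
    qed
    finally show "?e T \<bullet> avg T r \<le> ?K\<^sup>2 * (norm (incr z' z T))\<^sup>2 / 2 + (norm (avg T r))\<^sup>2 / 2"
      by (simp only: power_mult_distrib)
  qed simp
  also have "\<dots> = ?K\<^sup>2 * (\<Sum>T\<in>\<T>. vol T * (norm (incr z' z T))\<^sup>2) / 2 + (\<Sum>T\<in>\<T>. vol T * (norm (avg T r))\<^sup>2) / 2"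
    by (simp only: distrib_left sum.distrib sum_distrib_left sum_divide_distrib times_divide_eq_right mult.left_commute)
  finally have "pairing \<Omega> r r \<le> ?K\<^sup>2 * (\<Sum>T\<in>\<T>. vol T * (norm (incr z' z T))\<^sup>2) / 2 + pairing \<Omega> r r / 2"
    using avg_norm_le(1)[OF rR] by linarith
  then show ?thesis by (simp add: avg_norm_le(2)[OF rR])
qed

text \<open>The \<open>L\<^sup>2\<close> inner product is represented on the test space, where a field is determined up to null sets by
  its element divergences (\<open>None\<close>) and the components of its element averages (\<open>Some\<close>).\<close>

lemma residual_exists:
  assumes z': "z' \<in> RT" and step: "step z' z lam"
  shows "\<exists>r. residual z lam r"
proof -
    define e where "e T = (W T (norm (avg T z)) - W T (norm (avg T z'))) *\<^sub>R avg T z - incr z' z T" for T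
  define F where "F y = (\<Sum>T\<in>\<T>. vol T * (e T \<bullet> avg T y))" for y
  define \<phi> where "\<phi> i y = (case snd i of None \<Rightarrow> dvg (fst i) y | Some j \<Rightarrow> avg (fst i) y $ j)" for i :: "(real^'n) set \<times> 'n option" and y
  let ?I = "\<T> \<times> (UNIV :: 'n option set)"
  have R: "y \<in> RT" if "y \<in> RTN" for y using that by (simp add: RT0_N_iff)
  have \<phi>0: "dvg T y = 0" "avg T y = 0" if all: "\<forall>i\<in>?I. \<phi> i y = 0" and T: "T \<in> \<T>" for T y
  proof -
    show "dvg T y = 0" using bspec[OF all, of "(T, None)"] T by (simp add: \<phi>_def)
    have "avg T y $ j = 0" for j using bspec[OF all, of "(T, Some j)"] T by (simp add: \<phi>_def)
    then show "avg T y = 0" by (simp add: vec_eq_iff)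
  qed
  have "\<exists>r\<in>RTN. \<forall>y\<in>RTN. F y = pairing \<Omega> r y"
  proof (rule riesz_finitely_many_functionals[where I = ?I and \<phi> = \<phi>])
    show "finite ?I" by simp
    show "(\<lambda>_. 0) \<in> RTN" by (rule RT0_N_zero)
    show "(\<lambda>x. u x + c *\<^sub>R v x) \<in> RTN" if "u \<in> RTN" "v \<in> RTN" for u v c
      using that by (rule RT0_N_combine)
    show "\<phi> i (\<lambda>x. u x + c *\<^sub>R v x) = \<phi> i u + c * \<phi> i v" if "i \<in> ?I" "u \<in> RTN" "v \<in> RTN" for i u v c
      using that R by (auto simp: \<phi>_def avg_combine dvg_combine split: option.split)
    show "pairing \<Omega> u v = pairing \<Omega> v u" for u v :: "real^'n \<Rightarrow> real^'n"
      by (simp add: pairing_def inner_commute)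
    show "pairing \<Omega> (\<lambda>x. u x + c *\<^sub>R v x) w = pairing \<Omega> u w + c * pairing \<Omega> v w" if "u \<in> RTN" "v \<in> RTN" "w \<in> RTN" for u v w c
      using that R by (intro pairing_combine) auto
    show "\<phi> i u = 0" if u: "u \<in> RTN" "pairing \<Omega> u u = 0" and i: "i \<in> ?I" for u i
    proof -
      have z: "u x = 0" if "T \<in> \<T>" "x \<in> interior T" for T x using pairing_zero_imp[OF R[OF u(1)] u(2) that] .
      have "avg T u = 0" if "T \<in> \<T>" for T by (rule avg_const[OF that z[OF that]])
      moreover have "dvg T u = 0" if "T \<in> \<T>" for T using RT0_dvg[OF that, of u 0 0] z[OF that] by simp
      ultimately show ?thesis using i by (auto simp: \<phi>_def split: option.split)
    qed
    show "pairing \<Omega> u w = 0" if u: "u \<in> RTN" and "w \<in> RTN" and u0: "\<forall>i\<in>?I. \<phi> i u = 0" for u w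
    proof -
      have "u x = 0" if "T \<in> \<T>" "x \<in> interior T" for T x
        using RT0_divergence_free[OF R[OF u] that(1) \<phi>0(1)[OF u0 that(1)] that(2)] \<phi>0(2)[OF u0 that(1)] by simp
      then have "pairing \<Omega> u w = (\<Sum>T\<in>\<T>. vol T * 0)"
        unfolding pairing_def by (intro mesh_integral_const) simp
      then show ?thesis by simp
    qed
    show "F (\<lambda>x. u x + c *\<^sub>R v x) = F u + c * F v" if "u \<in> RTN" "v \<in> RTN" for u v c
    proof -
      have "F (\<lambda>x. u x + c *\<^sub>R v x) = (\<Sum>T\<in>\<T>. vol T * (e T \<bullet> avg T u) + c * (vol T * (e T \<bullet> avg T v)))"
        unfolding F_def using that R by (intro sum.cong refl) (simp add: avg_combine inner_add_right distrib_left)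
      then show ?thesis by (simp add: F_def sum.distrib sum_distrib_left)
    qed
    show "F u = 0" if "u \<in> RTN" "\<forall>i\<in>?I. \<phi> i u = 0" for u
      using \<phi>0(2)[OF that(2)] by (simp add: F_def)
  qed
  then obtain r where "r \<in> RTN" "\<And>y. y \<in> RTN \<Longrightarrow> F y = pairing \<Omega> r y" by blast
  then have "residual z lam r"
    unfolding flow_residual_def using residual_equation[OF z' step] by (simp add: F_def e_def)
  then show ?thesis by blast
qed

context
  fixes z :: "nat \<Rightarrow> real^'n \<Rightarrow> real^'n" and lam :: "nat \<Rightarrow> real^'n \<Rightarrow> real"
  assumes start: "z 0 \<in> Kad"
    and steps: "\<And>k. k \<ge> 1 \<Longrightarrow> step (z (k - 1)) (z k) (lam k)"
begin

abbreviation "dissipation k \<equiv> (\<Sum>T\<in>\<T>. vol T * (norm (incr (z (k - 1)) (z k) T))\<^sup>2)"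

lemma iterates_admissible: "z k \<in> Kad"
proof (induction k)
  case (Suc k)
  then have "z k \<in> RT" by (simp add: K_rt_iff)
  then show ?case using flow_step_K_rt steps[of "Suc k"] by simp
qed (rule start)

lemma iterates_RT0: "z k \<in> RT"
  using iterates_admissible by (simp add: K_rt_iff)

lemma energy_telescopes: "energy (z L) + \<tau> * (\<Sum>k=1..L. dissipation k) \<le> energy (z 0)"
proof (induction L)
  case (Suc L)
  have "energy (z (Suc L)) + \<tau> * dissipation (Suc L) \<le> energy (z L)"
    using energy_decreases[OF iterates_admissible[of L]] steps[of "Suc L"] by simp
  then show ?case using Suc by (simp add: distrib_left)
qed simp

text \<open>Otherwise the energy would decrease by at least \<open>\<tau> \<delta>\<close> in every step.\<close>

lemma small_dissipation:
  assumes m: "\<And>w. w \<in> Kad \<Longrightarrow> m \<le> energy w" and "\<delta> > 0"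
  shows "\<exists>k\<ge>1. dissipation k \<le> \<delta>"
proof (rule ccontr)
  assume "\<not> ?thesis"
  then have big: "\<delta> \<le> dissipation k" if "k \<ge> 1" for k using that by (meson linear)
  obtain L :: nat where L: "(energy (z 0) - m) / (\<tau> * \<delta>) < real L" using reals_Archimedean2 by blast
  have "energy (z 0) - m < real L * (\<tau> * \<delta>)"
    using L tau \<open>\<delta> > 0\<close> by (simp add: pos_divide_less_eq)
  also have "\<dots> = \<tau> * (\<Sum>k=1..L. \<delta>)" by simp
  also have "\<dots> \<le> \<tau> * (\<Sum>k=1..L. dissipation k)"
    using tau by (intro mult_left_mono sum_mono big) auto
  also have "\<dots> \<le> energy (z 0) - m"
    using energy_telescopes[of L] m[OF iterates_admissible[of L]] by linarith
  finally show False by simp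
qed

end

end

theorem proposition7p2:
  fixes \<Omega> \<Gamma>D \<Gamma>N :: "(real^'n) set"
    and \<T> :: "(real^'n) set set"
    and f g \<zeta> uD :: "real^'n \<Rightarrow> real"
    and z0 :: "real^'n \<Rightarrow> real^'n"
    and \<kappa> \<tau> \<epsilon> :: real
  assumes domain: "lipschitz_domain \<Omega>"
    and mesh: "simplicial_mesh \<Omega> \<T>" "shape_regular \<kappa> \<T>"
    and bdry: "boundary_partition \<Omega> \<T> \<Gamma>D \<Gamma>N"
    and f: "f \<in> L0 \<T>"
    and g: "g \<in> L0_sides (sides_on \<Omega> \<T> \<Gamma>N)"
    and zeta: "\<zeta> \<in> L0 \<T>" "ess_inf \<Omega> \<zeta> > 0"
    and uD: "uD \<in> L0_sides (sides_on \<Omega> \<T> \<Gamma>D)"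
    and lift: "\<exists>u\<in>CR1 \<Omega> \<T>.
        (\<forall>S\<in>sides_on \<Omega> \<T> \<Gamma>D. \<forall>x\<in>rel_interior S. pi_h \<T> (sides_on \<Omega> \<T> \<Gamma>D) u x = uD x) \<and>
        Linf_norm \<Omega> (\<lambda>x. (1 / \<zeta> x) *\<^sub>R grad u x) < 1"
    and z0: "z0 \<in> K_rt \<Omega> \<T> \<Gamma>N f g"
    and pos: "\<tau> > 0" "\<epsilon> > 0"
  shows
    "(\<forall>z'\<in>RT0 \<Omega> \<T>. \<exists>z.
        (\<exists>lam. flow_step \<Omega> \<T> \<Gamma>D \<Gamma>N f g \<zeta> uD \<tau> z' z lam) \<and>
        (\<forall>w. (\<exists>lam. flow_step \<Omega> \<T> \<Gamma>D \<Gamma>N f g \<zeta> uD \<tau> z' w lam) \<longrightarrow>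
             (AE x in lebesgue_on \<Omega>. w x = z x)))
     \<and>
     (\<forall>(z :: nat \<Rightarrow> real^'n \<Rightarrow> real^'n) (lam :: nat \<Rightarrow> real^'n \<Rightarrow> real). z 0 = z0 \<and>
        (\<forall>k\<ge>1. flow_step \<Omega> \<T> \<Gamma>D \<Gamma>N f g \<zeta> uD \<tau> (z (k - 1)) (z k) (lam k)) \<longrightarrow>
        (\<forall>L::nat. - D_rt \<Omega> \<T> \<Gamma>D \<Gamma>N f g \<zeta> uD (z L)
             + ereal (\<tau> * (\<Sum>k=1..L. (L2norm \<Omega> (Pi_h \<T> (d_tau \<tau> (z (k - 1)) (z k))))\<^sup>2))
           \<le> - D_rt \<Omega> \<T> \<Gamma>D \<Gamma>N f g \<zeta> uD z0))
     \<and>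
     (\<forall>(z :: nat \<Rightarrow> real^'n \<Rightarrow> real^'n) (lam :: nat \<Rightarrow> real^'n \<Rightarrow> real). z 0 = z0 \<and>
        (\<forall>k\<ge>1. flow_step \<Omega> \<T> \<Gamma>D \<Gamma>N f g \<zeta> uD \<tau> (z (k - 1)) (z k) (lam k)) \<longrightarrow>
        (\<exists>k\<ge>1. (\<exists>r. flow_residual \<Omega> \<T> \<Gamma>D \<Gamma>N \<zeta> uD (z k) (lam k) r) \<and>
                (\<forall>r. flow_residual \<Omega> \<T> \<Gamma>D \<Gamma>N \<zeta> uD (z k) (lam k) r \<longrightarrow> L2norm \<Omega> r \<le> \<epsilon>)))"
proof (intro conjI ballI allI impI)
  interpret dual_flow \<Omega> \<T> \<Gamma>D \<Gamma>N f g \<zeta> uD \<tau>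
    by unfold_locales (fact domain mesh(1) bdry f g zeta uD pos(1))+
  {
    fix z' assume z': "z' \<in> RT"
    show "\<exists>z. (\<exists>lam. step z' z lam) \<and>
        (\<forall>w. (\<exists>lam. step z' w lam) \<longrightarrow> (AE x in lebesgue_on \<Omega>. w x = z x))"
      using flow_step_exists[OF z' z0] flow_step_unique[OF z'] by blast
  next
    fix z :: "nat \<Rightarrow> real^'n \<Rightarrow> real^'n" and lam :: "nat \<Rightarrow> real^'n \<Rightarrow> real" and L :: nat
    assume it: "z 0 = z0 \<and> (\<forall>k\<ge>1. step (z (k - 1)) (z k) (lam k))"
    have start: "z 0 \<in> Kad" using it z0 by simp
    have steps: "\<And>k. k \<ge> 1 \<Longrightarrow> step (z (k - 1)) (z k) (lam k)" using it by blast
    note it_RT0 = iterates_RT0[OF start steps] and it_K = iterates_admissible[OF start steps]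
    have "energy (z L) + \<tau> * (\<Sum>k=1..L. (L2norm \<Omega> (Pi_h \<T> (d_tau \<tau> (z (k - 1)) (z k))))\<^sup>2) \<le> energy (z 0)"
      using energy_telescopes[OF start steps, of L] by (simp only: L2norm_increment[OF it_RT0 it_RT0])
    then show "- D_rt \<Omega> \<T> \<Gamma>D \<Gamma>N f g \<zeta> uD (z L)
             + ereal (\<tau> * (\<Sum>k=1..L. (L2norm \<Omega> (Pi_h \<T> (d_tau \<tau> (z (k - 1)) (z k))))\<^sup>2))
           \<le> - D_rt \<Omega> \<T> \<Gamma>D \<Gamma>N f g \<zeta> uD z0"
      using it by (simp add: D_rt_energy[OF it_K] D_rt_energy[OF z0])
  next
    fix z :: "nat \<Rightarrow> real^'n \<Rightarrow> real^'n" and lam :: "nat \<Rightarrow> real^'n \<Rightarrow> real"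
    assume it: "z 0 = z0 \<and> (\<forall>k\<ge>1. step (z (k - 1)) (z k) (lam k))"
    have start: "z 0 \<in> Kad" using it z0 by simp
    have steps: "\<And>k. k \<ge> 1 \<Longrightarrow> step (z (k - 1)) (z k) (lam k)" using it by blast
    note it_RT0 = iterates_RT0[OF start steps]
    obtain u where u: "u \<in> CR1 \<Omega> \<T>"
      "\<And>S x. S \<in> SD \<Longrightarrow> x \<in> rel_interior S \<Longrightarrow> pi_h \<T> SD u x = uD x"
      "Linf_norm \<Omega> (\<lambda>x. (1 / \<zeta> x) *\<^sub>R grad u x) < 1"
      using lift by blast
    have "\<exists>m. \<forall>w\<in>Kad. m \<le> energy w"
    proof (rule energy_bounded_below[OF u(1) _ u(3) z0])
      show "pi_h \<T> SD u x = uD x" if "S \<in> SD" "x \<in> rel_interior S" for S x by (rule u(2)[OF that])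
    qed blast
    then obtain m where m: "\<And>w. w \<in> Kad \<Longrightarrow> m \<le> energy w" by blast
    have K: "0 < 1 + 2 * \<tau>" using pos by simp
    then have "0 < (\<epsilon> / (1 + 2 * \<tau>))\<^sup>2" using pos by simp
    from small_dissipation[OF start steps m this]
    obtain k where k: "k \<ge> 1" "(\<Sum>T\<in>\<T>. vol T * (norm (incr (z (k - 1)) (z k) T))\<^sup>2) \<le> (\<epsilon> / (1 + 2 * \<tau>))\<^sup>2"
      by blast
    have "L2norm \<Omega> r \<le> \<epsilon>" if r: "residual (z k) (lam k) r" for r
    proof -
      have "(L2norm \<Omega> r)\<^sup>2 \<le> (1 + 2 * \<tau>)\<^sup>2 * (\<epsilon> / (1 + 2 * \<tau>))\<^sup>2"
        using residual_bound[OF it_RT0 steps[OF k(1)] r] mult_left_mono[OF k(2), of "(1 + 2 * \<tau>)\<^sup>2"] by simp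
      also have "\<dots> = \<epsilon>\<^sup>2" using K by (simp add: power_divide)
      finally show ?thesis using pos by (meson less_imp_le power2_le_imp_le)
    qed
    then show "\<exists>k\<ge>1. (\<exists>r. residual (z k) (lam k) r) \<and>
        (\<forall>r. residual (z k) (lam k) r \<longrightarrow> L2norm \<Omega> r \<le> \<epsilon>)"
      using k(1) residual_exists[OF it_RT0 steps[OF k(1)]] by blast
  }
qed

end
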